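(* Let $\mathcal{G}$ be a noncompact metric graph with non-empty compact core $\mathcal{K}$, let $m,c>0$, $a>0$ and $p>2$, and let $\mathcal{D}$ be the Dirac operator with Kirchhoff-type vertex conditions on $\mathcal{G}$. Assume that $\lambda=-mc^2$ is an eigenvalue of $\mathcal{D}$. Then one of the following two cases holds: (i) either there exist a non-trivial $u\in\operatorname{dom}(\mathcal{D})$ and $\omega\in(-mc^2,mc^2)$ such that $$\mathcal{D}u+\omega u=-a\chi_{\mathcal{K}}|u|^{p-2}u\ \text{ on every edge } e\in\mathrm{E},\qquad \int_{\mathcal{G}}|u|^2\,dx=1;$$ (ii) or for every $\omega\in(-mc^2,mc^2)$ there exists a non-trivial $u_\omega\in\operatorname{dom}(\mathcal{D})$ such that $$\mathcal{D}u_\omega+\omega u_\omega=-a\chi_{\mathcal{K}}|u_\omega|^{p-2}u_\omega\ \text{ on every edge } e\in\mathrm{E},\qquad \int_{\mathcal{G}}|u_\omega|^2\,dx<1.$$ Moreover, if $0<a<\widetilde{a_0}$, where $$\widetilde{a_0}=\begin{cases}\dfrac{m^{\frac{4-p}{2}}c^{4-p}}{2C_{p,\mathcal{K}}}, & p\in(2,4),\\[2mm] 2^{-\frac p4}C_{p,\mathcal{K}}^{-1}m^{\frac{4-p}{2}}c^{4-p}\left(\frac{p}{p-2}\right)^{\frac{-p^2+5p-4}{2p-4}}, & p\in[4,+\infty),\end{cases}$$ then the first case occurs with some non-trivial $u\in\operatorname{dom}(\mathcal{D})$ and $\omega\in[0,mc^2)$, that is, $$\mathcal{D}u+\omega u=-a\chi_{\mathcal{K}}|u|^{p-2}u\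 \text{ on every edge } e\in\mathrm{E},\qquad \int_{\mathcal{G}}|u|^2\,dx=1.$$
   Context: Metric graph. $\mathcal{G}=(\mathrm{V},\mathrm{E})$ is a connected noncompact metric graph with finitely many edges. Each bounded edge $e$ is identified with an interval $I_e=[0,\ell_e]$, $\ell_e>0$; each unbounded edge (half-line) is identified with $I_e=[0,+\infty)$; noncompact means that there is at least one half-line. The compact core $\mathcal{K}$ is the metric subgraph consisting of all bounded edges; it is assumed non-empty. $\chi_{\mathcal{K}}$ is its characteristic function. A spinor $u:\mathcal{G}\to\mathbb{C}^2$ is a family $(u_e)_{e\in\mathrm{E}}$ with $u_e=(u_e^1,u_e^2)^T:I_e\to\mathbb{C}^2$; $L^2(\mathcal{G},\mathbb{C}^2)=\bigoplus_{e}L^2(I_e,\mathbb{C}^2)$ and $H^1(\mathcal{G},\mathbb{C}^2)=\bigoplus_{e}H^1(I_e,\mathbb{C}^2)$ (no vertex condition is included in $H^1$). $e\succ \mathrm{v}$ means that $e$ is incident at the vertex $\mathrm{v}$. Dirac operator. For $m,c>0$, $\mathcal{D}$ acts on each edge by $\mathcal{D}_e u_e=-\imath c\,\sigma_1u_e'+mc^2\sigma_3u_e$, with $\sigma_1=\begin{pmatrix}0&1\\1&0\end{pmatrix}$, $\sigma_3=\begin{pmatrix}1&0\\0&-1\end{pmatrix}$, and $\operatorname{dom}(\mathcal{D})$ is the set of $u\in H^1(\mathcal{G},\mathbb{C}^2)$ such that at every vertex $\mathrm{v}$: $u_e^1(\mathrm{v})=u_f^1(\mathrm{v})$ for all $e,f\succ\mathrm{v}$,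 and $\sum_{e\succ\mathrm{v}}u_e^2(\mathrm{v})_\pm=0$, where $u_e^2(\mathrm{v})_\pm$ stands for $u_e^2(0)$ or $-u_e^2(\ell_e)$ according to whether the coordinate $x_e$ equals $0$ or $\ell_e$ at $\mathrm{v}$. $\mathcal{D}$ is self-adjoint on $L^2(\mathcal{G},\mathbb{C}^2)$ with spectrum $(-\infty,-mc^2]\cup[mc^2,+\infty)$. Form domain and constant. $Y=\operatorname{dom}(|\mathcal{D}|^{1/2})$, with norm $\|u\|=\||\mathcal{D}|^{1/2}u\|_{L^2}$; $\|u\|_2$ is the $L^2(\mathcal{G},\mathbb{C}^2)$ norm. $C_{p,\mathcal{K}}>0$ is a constant (depending only on $c,m,p,\mathcal{G}$) in the Gagliardo–Nirenberg–Sobolev inequality $\int_{\mathcal{K}}|u|^p\,dx\le C_{p,\mathcal{K}}\|u\|^{p-2}\|u\|_2^2$ for all $u\in Y$. *)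

theory Defs
  imports "HOL-Analysis.Analysis"
begin

section \<open>Metric graphs\<close>

text \<open>
  Loops and multiple edges are allowed. An edge \<open>e\<close> is the interval \<open>[0, len e]\<close>, or \<open>[0, \<infinity>)\<close> if
  \<open>len e = \<infinity>\<close>; \<open>src e\<close> is the vertex at coordinate \<open>0\<close> and \<open>tgt e\<close> the vertex at coordinate \<open>len e\<close>.
  The value of \<open>tgt\<close> on a half-line is meaningless and never used: the point at infinity is not a
  vertex.
\<close>

record ('v, 'e) mgraph =
  verts :: "'v set"
  edges :: "'e set"
  len :: "'e \<Rightarrow> ereal"
  src :: "'e \<Rightarrow> 'v"
  tgt :: "'e \<Rightarrow> 'v"

definition bounded_edges :: "('v, 'e) mgraph \<Rightarrow> 'e set" where
  "bounded_edges G = {e \<in> edges G. len G e < \<infinity>}"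

definition half_lines :: "('v, 'e) mgraph \<Rightarrow> 'e set" where
  "half_lines G = {e \<in> edges G. len G e = \<infinity>}"

definition edge_interval :: "('v, 'e) mgraph \<Rightarrow> 'e \<Rightarrow> real set" where
  "edge_interval G e = {x. 0 \<le> x \<and> ereal x \<le> len G e}"

abbreviation edge_measure :: "('v, 'e) mgraph \<Rightarrow> 'e \<Rightarrow> real measure" where
  "edge_measure G e \<equiv> lebesgue_on (edge_interval G e)"

text \<open>Half-lines have a single endpoint and so play no role for connectedness.\<close>

definition connected_mgraph :: "('v, 'e) mgraph \<Rightarrow> bool" where
  "connected_mgraph G \<longleftrightarrow>
     (let R = {(src G e, tgt G e) | e. e \<in> bounded_edges G}
      in \<forall>v\<in>verts G. \<forall>w\<in>verts G. (v, w) \<in> (R \<union> R\<inverse>)\<^sup>*)"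

definition metric_graph :: "('v, 'e) mgraph \<Rightarrow> bool" where
  "metric_graph G \<longleftrightarrow>
     finite (edges G) \<and>
     (\<forall>e\<in>edges G. 0 < len G e \<and> src G e \<in> verts G) \<and>
     (\<forall>e\<in>bounded_edges G. tgt G e \<in> verts G) \<and>
     connected_mgraph G"

definition noncompact_mgraph :: "('v, 'e) mgraph \<Rightarrow> bool" where
  "noncompact_mgraph G \<longleftrightarrow> half_lines G \<noteq> {}"

text \<open>
  The edge ends at a vertex, as pairs of an edge and the coordinate of the end. A loop contributes
  two ends to its vertex.
\<close>

definition ends_at :: "('v, 'e) mgraph \<Rightarrow> 'v \<Rightarrow> ('e \<times> real) set" where
  "ends_at G v =
     {(e, 0) | e. e \<in> edges G \<and> src G e = v} \<union>
     {(e, real_of_ereal (len G e)) | e. e \<in> bounded_edges G \<and> tgt G e = v}"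

definition core_chi :: "('v, 'e) mgraph \<Rightarrow> 'e \<Rightarrow> real" where
  "core_chi G e = (if e \<in> bounded_edges G then 1 else 0)"


section \<open>Spinors, \<open>L\<^sup>2\<close> and \<open>H\<^sup>1\<close>\<close>

text \<open>
  Elements of \<open>L\<^sup>2\<close> are handled through representatives \<open>u e x\<close>, of which only the values for
  \<open>e \<in> edges G\<close> and \<open>x \<in> edge_interval G e\<close> matter, and equality is \<open>ae_eq\<close>.
\<close>

type_synonym 'e spinor = "'e \<Rightarrow> real \<Rightarrow> complex ^ 2"

definition ae_eq :: "('v, 'e) mgraph \<Rightarrow> 'e spinor \<Rightarrow> 'e spinor \<Rightarrow> bool" where
  "ae_eq G u v \<longleftrightarrow> (\<forall>e\<in>edges G. AE x in edge_measure G e. u e x = v e x)"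

definition nontrivial :: "('v, 'e) mgraph \<Rightarrow> 'e spinor \<Rightarrow> bool" where
  "nontrivial G u \<longleftrightarrow> \<not> ae_eq G u (\<lambda>e x. 0)"

definition L2 :: "('v, 'e) mgraph \<Rightarrow> 'e spinor set" where
  "L2 G = {u. \<forall>e\<in>edges G. u e \<in> borel_measurable (edge_measure G e) \<and>
                 integrable (edge_measure G e) (\<lambda>x. (norm (u e x))\<^sup>2)}"

definition mass :: "('v, 'e) mgraph \<Rightarrow> 'e spinor \<Rightarrow> real" where
  "mass G u = (\<Sum>e\<in>edges G. LINT x|edge_measure G e. (norm (u e x))\<^sup>2)"

definition L2_norm :: "('v, 'e) mgraph \<Rightarrow> 'e spinor \<Rightarrow> real" where
  "L2_norm G u = sqrt (mass G u)"

definition L2_inner :: "('v, 'e) mgraph \<Rightarrow> 'e spinor \<Rightarrow> 'e spinor \<Rightarrow> complex" where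
  "L2_inner G u v =
     (\<Sum>e\<in>edges G. LINT x|edge_measure G e. (\<Sum>i\<in>UNIV. u e x $ i * cnj (v e x $ i)))"

definition test_function :: "real set \<Rightarrow> (real \<Rightarrow> real) \<Rightarrow> bool" where
  "test_function I \<phi> \<longleftrightarrow>
     (\<forall>n x. (deriv ^^ n) \<phi> differentiable (at x)) \<and>
     (\<exists>K. compact K \<and> K \<subseteq> interior I \<and> (\<forall>x. x \<notin> K \<longrightarrow> \<phi> x = 0))"

definition weak_deriv :: "('v, 'e) mgraph \<Rightarrow> 'e spinor \<Rightarrow> 'e spinor \<Rightarrow> bool" where
  "weak_deriv G u du \<longleftrightarrow>
     (\<forall>e\<in>edges G. \<forall>\<phi>. test_function (edge_interval G e) \<phi> \<longrightarrow>
        (LINT x|edge_measure G e. deriv \<phi> x *\<^sub>R u e x) =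
        - (LINT x|edge_measure G e. \<phi> x *\<^sub>R du e x))"

definition H1 :: "('v, 'e) mgraph \<Rightarrow> 'e spinor set" where
  "H1 G = {u \<in> L2 G. \<exists>du\<in>L2 G. weak_deriv G u du}"


section \<open>The Dirac operator with Kirchhoff-type vertex conditions\<close>

definition pauli1 :: "complex ^ 2 ^ 2" where
  "pauli1 = vector [vector [0, 1], vector [1, 0]]"

definition pauli3 :: "complex ^ 2 ^ 2" where
  "pauli3 = vector [vector [1, 0], vector [0, -1]]"

text \<open>To be applied to spinors that are continuous on every (closed) edge.\<close>

definition kirchhoff :: "('v, 'e) mgraph \<Rightarrow> 'e spinor \<Rightarrow> bool" where
  "kirchhoff G w \<longleftrightarrow>
     (\<forall>v\<in>verts G.
        (\<forall>(e, x)\<in>ends_at G v. \<forall>(f, y)\<in>ends_at G v. w e x $ 1 = w f y $ 1) \<and>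
        (\<Sum>(e, x)\<in>ends_at G v. if x = 0 then w e x $ 2 else - (w e x $ 2)) = 0)"

text \<open>The vertex values of an \<open>H\<^sup>1\<close> spinor are those of its continuous representative \<open>w\<close>.\<close>

definition dirac_dom :: "('v, 'e) mgraph \<Rightarrow> 'e spinor set" where
  "dirac_dom G =
     {u \<in> H1 G. \<exists>w. (\<forall>e\<in>edges G. continuous_on (edge_interval G e) (w e)) \<and>
                    ae_eq G w u \<and> kirchhoff G w}"

definition dirac_edge ::
    "real \<Rightarrow> real \<Rightarrow> complex ^ 2 \<Rightarrow> complex ^ 2 \<Rightarrow> complex ^ 2" where
  "dirac_edge m c u du = (- \<i> * of_real c) *s (pauli1 *v du) + (m * c\<^sup>2) *\<^sub>R (pauli3 *v u)"

text \<open>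
  Unbounded operators on \<open>L\<^sup>2\<close> are represented by their graphs: \<open>(u, f) \<in> A\<close> means that \<open>u\<close> is in
  the domain of \<open>A\<close> and \<open>A u = f\<close>. All graphs below are closed under \<open>ae_eq\<close> in both components.
\<close>

definition dirac :: "('v, 'e) mgraph \<Rightarrow> real \<Rightarrow> real \<Rightarrow> 'e spinor rel" where
  "dirac G m c =
     {(u, f). u \<in> dirac_dom G \<and> f \<in> L2 G \<and>
        (\<exists>du\<in>L2 G. weak_deriv G u du \<and> ae_eq G f (\<lambda>e x. dirac_edge m c (u e x) (du e x)))}"

definition eigenvalue :: "('v, 'e) mgraph \<Rightarrow> 'e spinor rel \<Rightarrow> complex \<Rightarrow> bool" where
  "eigenvalue G A z \<longleftrightarrow>
     (\<exists>u f. (u, f) \<in> A \<and> nontrivial G u \<and> ae_eq G f (\<lambda>e x. z *s u e x))"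


section \<open>The form domain\<close>

definition densely_defined :: "('v, 'e) mgraph \<Rightarrow> 'e spinor rel \<Rightarrow> bool" where
  "densely_defined G A \<longleftrightarrow>
     (\<forall>u\<in>L2 G. \<forall>\<epsilon>>0. \<exists>v\<in>Domain A. L2_norm G (\<lambda>e x. u e x - v e x) < \<epsilon>)"

definition op_adjoint :: "('v, 'e) mgraph \<Rightarrow> 'e spinor rel \<Rightarrow> 'e spinor rel" where
  "op_adjoint G A =
     {(v, g). v \<in> L2 G \<and> g \<in> L2 G \<and> (\<forall>(u, f)\<in>A. L2_inner G f v = L2_inner G u g)}"

definition self_adjoint :: "('v, 'e) mgraph \<Rightarrow> 'e spinor rel \<Rightarrow> bool" where
  "self_adjoint G A \<longleftrightarrow> densely_defined G A \<and> op_adjoint G A = A"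

definition nonneg_op :: "('v, 'e) mgraph \<Rightarrow> 'e spinor rel \<Rightarrow> bool" where
  "nonneg_op G A \<longleftrightarrow> (\<forall>(u, f)\<in>A. 0 \<le> Re (L2_inner G f u))"

text \<open>
  The unique nonnegative self-adjoint square root of a nonnegative self-adjoint operator; relation
  composition is the composition of operators on its natural domain.
\<close>

definition op_sqrt :: "('v, 'e) mgraph \<Rightarrow> 'e spinor rel \<Rightarrow> 'e spinor rel" where
  "op_sqrt G A = (THE B. self_adjoint G B \<and> nonneg_op G B \<and> B O B = A)"

text \<open>\<open>|A| = (A\<^sup>* A)\<^bsup>1/2\<^esup>\<close>\<close>

definition op_abs :: "('v, 'e) mgraph \<Rightarrow> 'e spinor rel \<Rightarrow> 'e spinor rel" where
  "op_abs G A = op_sqrt G (A O op_adjoint G A)"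

definition dirac_abs_sqrt :: "('v, 'e) mgraph \<Rightarrow> real \<Rightarrow> real \<Rightarrow> 'e spinor rel" where
  "dirac_abs_sqrt G m c = op_sqrt G (op_abs G (dirac G m c))"

text \<open>
  \<open>C\<close> is a constant in the Gagliardo--Nirenberg--Sobolev inequality on the compact core. The pairs
  \<open>(u, f)\<close> with \<open>f = |D|\<^bsup>1/2\<^esup> u\<close> range over all \<open>u\<close> in the form domain, and \<open>L2_norm G f\<close> is the norm
  of \<open>u\<close> in the form domain. The left-hand side is a nonnegative integral, so that the inequality
  includes its finiteness.
\<close>

definition GNS_const :: "('v, 'e) mgraph \<Rightarrow> real \<Rightarrow> real \<Rightarrow> real \<Rightarrow> real \<Rightarrow> bool" where
  "GNS_const G m c p C \<longleftrightarrow> C > 0 \<and>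
     (\<forall>(u, f)\<in>dirac_abs_sqrt G m c.
        (\<Sum>e\<in>bounded_edges G. \<integral>\<^sup>+x. ennreal (norm (u e x) powr p) \<partial>edge_measure G e)
        \<le> ennreal (C * L2_norm G f powr (p - 2) * (L2_norm G u)\<^sup>2))"

definition a0_tilde :: "real \<Rightarrow> real \<Rightarrow> real \<Rightarrow> real \<Rightarrow> real" where
  "a0_tilde m c p C =
     (if p < 4 then m powr ((4 - p) / 2) * c powr (4 - p) / (2 * C)
      else 2 powr (- p / 4) * inverse C * m powr ((4 - p) / 2) * c powr (4 - p)
           * (p / (p - 2)) powr ((- p\<^sup>2 + 5 * p - 4) / (2 * p - 4)))"


section \<open>The nonlinear Dirac equation\<close>

text \<open>\<open>u \<in> dom D\<close> and \<open>D u + \<omega> u = - a \<chi>\<^sub>K |u|\<^bsup>p - 2\<^esup> u\<close> almost everywhere on every edge.\<close>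

definition NLD_solution ::
    "('v, 'e) mgraph \<Rightarrow> real \<Rightarrow> real \<Rightarrow> real \<Rightarrow> real \<Rightarrow> real \<Rightarrow> 'e spinor \<Rightarrow> bool" where
  "NLD_solution G m c a p \<omega> u \<longleftrightarrow>
     (\<exists>f. (u, f) \<in> dirac G m c \<and>
        ae_eq G (\<lambda>e x. f e x + \<omega> *\<^sub>R u e x)
                (\<lambda>e x. (- a * core_chi G e * norm (u e x) powr (p - 2)) *\<^sub>R u e x))"

end

theory Submission
  imports Defs "HOL-Library.Function_Algebras"
begin

text \<open>
  The whole theorem rests on an explicit family of solutions. If \<open>D u = - m c\<^sup>2 u\<close>, the two components
  of the equation say that \<open>u\<^sup>1\<close> is constant on every edge, and that \<open>u\<^sup>2\<close> is constant as soon as \<open>u\<^sup>1\<close>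
  vanishes. On a half-line a constant is square-integrable only if it is zero, and continuity at the
  vertices together with connectedness carries this zero of \<open>u\<^sup>1\<close> to all edges. Hence \<open>u = (0, k)\<close>,
  where \<open>k\<close> is constant on the bounded edges and zero on the half-lines, and the vertex condition on
  \<open>u\<^sup>2\<close> is Kirchhoff's law: \<open>k\<close> is a circulation (\<open>eigenspinor_circulation\<close>). A graph with a nonzero
  circulation contains a simple cycle, that is, a circulation \<open>g\<close> with values in \<open>{-1, 0, 1}\<close>
  (\<open>circulation_imp_simple_cycle\<close>), and \<open>u = t (0, g)\<close> is an eigenspinor whose modulus is the constant
  \<open>t\<close> on its support. For such a spinor the nonlinear equation reduces to the scalar equation
  \<open>a t\<^bsup>p - 2\<^esup> = m c\<^sup>2 - \<omega>\<close>, and its mass is \<open>t\<^sup>2 L\<close>, with \<open>L\<close> the length of the cycle. Let \<open>t\<^sub>1\<close> be the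
  amplitude of mass one. If \<open>a t\<^sub>1\<^bsup>p - 2\<^esup> < 2 m c\<^sup>2\<close>, the first case of the dichotomy holds; otherwise every
  \<open>\<omega>\<close> in the gap has an amplitude smaller than \<open>t\<^sub>1\<close>, which is the second case.

  For the last assertion, the Gagliardo--Nirenberg--Sobolev inequality is applied to the same spinor of
  mass one. Since \<open>|D|\<^bsup>1/2\<^esup> u = (m c\<^sup>2)\<^bsup>1/2\<^esup> u\<close>, it reads \<open>t\<^sub>1\<^bsup>p - 2\<^esup> \<le> C (m c\<^sup>2)\<^bsup>(p - 2)/2\<^esup>\<close>, so that the
  bound on \<open>a\<close> gives \<open>a t\<^sub>1\<^bsup>p - 2\<^esup> \<le> m c\<^sup>2\<close>, which is \<open>\<omega> \<ge> 0\<close> (\<open>cyc_GNS\<close>, \<open>a0_tilde_bound\<close>).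

  Most of the work lies in \<open>|D|\<^bsup>1/2\<^esup> u\<close>. The square roots in its definition are given by a definite
  description, so nothing can be said about them before existence and uniqueness of the positive
  square root of an unbounded positive self-adjoint operator \<open>A\<close> are known. With
  \<open>R = (1 + A)\<^bsup>-1\<^esup>\<close> and the square roots \<open>S\<close> of \<open>R\<close> and \<open>T\<close> of \<open>1 - R\<close>, which are bounded operators,
  the square root of \<open>A\<close> is the graph of all \<open>(S h, T h)\<close> (\<open>positive_sa_sqrt\<close>). It is applied to \<open>D\<^sup>*D\<close>,
  which is self-adjoint by von Neumann's theorem because \<open>D\<close> is closed and densely defined
  (\<open>dirac_closed\<close>, \<open>dirac_dense\<close>), and then to \<open>|D|\<close>. An eigenvector of a positive self-adjoint
  operator is an eigenvector of its square root (\<open>sqrt_eigenvector\<close>), so all that is needed of \<open>D\<close>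
  itself is that \<open>u\<close> is an eigenspinor of \<open>D\<close> and of its adjoint (\<open>cyc_dirac\<close>, \<open>cyc_adjoint\<close>).

  The Hilbert space theory uses real scalars: a complex operator is linear over the reals and
  commutes with the multiplication by \<open>\<i>\<close>, its complex adjoint is its real adjoint, and the square root
  commutes with \<open>\<i>\<close> by uniqueness.
\<close>

section \<open>Hilbert spaces without quotients\<close>

lemma nonneg_quadratic_discriminant:
  fixes a b c :: real
  assumes q: "\<And>t. 0 \<le> a + 2 * t * b + t\<^sup>2 * c" and c: "0 \<le> c"
  shows "b\<^sup>2 \<le> a * c"
proof (cases "c = 0")
  case True
  have "b = 0"
  proof (rule ccontr)
    assume "b \<noteq> 0"
    with q[of "- (a + 1) / (2 * b)"] True show False by (simp add: field_simps)
  qed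
  with True show ?thesis by simp
next
  case False
  with c have "c > 0" by simp
  with q[of "- b / c"] have "0 \<le> a - b\<^sup>2 / c"
    by (simp add: field_simps power2_eq_square)
  with \<open>c > 0\<close> show ?thesis by (simp add: field_simps)
qed

text \<open>
  A complete space with a possibly degenerate inner product, on a subspace of a vector space of
  functions. Elements of \<open>L\<^sup>2\<close> are functions and not classes of functions, so that null vectors occur.
\<close>

locale semi_hilbert =
  fixes V :: "'a::real_vector set" and ip :: "'a \<Rightarrow> 'a \<Rightarrow> real"
  assumes subspace_V: "subspace V"
    and ip_add: "\<And>x y z. x \<in> V \<Longrightarrow> y \<in> V \<Longrightarrow> z \<in> V \<Longrightarrow> ip (x + y) z = ip x z + ip y z"
    and ip_scale: "\<And>r x y. x \<in> V \<Longrightarrow> y \<in> V \<Longrightarrow> ip (r *\<^sub>R x) y = r * ip x y"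
    and ip_sym: "\<And>x y. x \<in> V \<Longrightarrow> y \<in> V \<Longrightarrow> ip x y = ip y x"
    and ip_nonneg: "\<And>x. x \<in> V \<Longrightarrow> 0 \<le> ip x x"
    and ip_complete: "\<And>s. (\<And>n. s n \<in> V) \<Longrightarrow>
       (\<And>\<epsilon>. \<epsilon> > 0 \<Longrightarrow> \<exists>N. \<forall>m\<ge>N. \<forall>n\<ge>N. ip (s m - s n) (s m - s n) < \<epsilon>) \<Longrightarrow>
       \<exists>l\<in>V. (\<lambda>n. ip (s n - l) (s n - l)) \<longlonglongrightarrow> 0"
begin

lemma V_zero [simp, intro]: "0 \<in> V"
  and V_add [simp, intro]: "x \<in> V \<Longrightarrow> y \<in> V \<Longrightarrow> x + y \<in> V"
  and V_scale [simp, intro]: "x \<in> V \<Longrightarrow> r *\<^sub>R x \<in> V"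
  and V_diff [simp, intro]: "x \<in> V \<Longrightarrow> y \<in> V \<Longrightarrow> x - y \<in> V"
  and V_neg [simp, intro]: "x \<in> V \<Longrightarrow> - x \<in> V"
  by (rule subspace_0[OF subspace_V] subspace_add[OF subspace_V] subspace_scale[OF subspace_V]
      subspace_diff[OF subspace_V] subspace_neg[OF subspace_V], assumption?, assumption?)+

lemma ip_add_right: "x \<in> V \<Longrightarrow> y \<in> V \<Longrightarrow> z \<in> V \<Longrightarrow> ip z (x + y) = ip z x + ip z y"
  using ip_add[of x y z] ip_sym[of z x] ip_sym[of z y] ip_sym[of z "x + y"] by simp

lemma ip_scale_right: "x \<in> V \<Longrightarrow> y \<in> V \<Longrightarrow> ip y (r *\<^sub>R x) = r * ip y x"
  using ip_scale[of x y r] ip_sym[of y x] ip_sym[of y "r *\<^sub>R x"] by simp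

lemma ip_neg: "x \<in> V \<Longrightarrow> y \<in> V \<Longrightarrow> ip (- x) y = - ip x y"
  using ip_scale[of x y "-1"] by simp

lemma ip_neg_right: "x \<in> V \<Longrightarrow> y \<in> V \<Longrightarrow> ip y (- x) = - ip y x"
  using ip_scale_right[of x y "-1"] by simp

lemma ip_diff: "x \<in> V \<Longrightarrow> y \<in> V \<Longrightarrow> z \<in> V \<Longrightarrow> ip (x - y) z = ip x z - ip y z"
  using ip_add[of x "- y" z] ip_neg[of y z] by simp

lemma ip_diff_right: "x \<in> V \<Longrightarrow> y \<in> V \<Longrightarrow> z \<in> V \<Longrightarrow> ip z (x - y) = ip z x - ip z y"
  using ip_add_right[of x "- y" z] ip_neg_right[of y z] by simp

lemma ip_zero [simp]: "x \<in> V \<Longrightarrow> ip 0 x = 0" "x \<in> V \<Longrightarrow> ip x 0 = 0"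
  using ip_scale[of 0 x 0] ip_scale_right[of 0 x 0] by auto

lemmas ip_simps = ip_add ip_add_right ip_scale ip_scale_right ip_neg ip_neg_right
  ip_diff ip_diff_right

definition nrm :: "'a \<Rightarrow> real" where "nrm x = sqrt (ip x x)"

lemma nrm_nonneg [simp]: "x \<in> V \<Longrightarrow> 0 \<le> nrm x"
  by (simp add: nrm_def ip_nonneg)

lemma nrm_sq: "x \<in> V \<Longrightarrow> (nrm x)\<^sup>2 = ip x x"
  by (simp add: nrm_def ip_nonneg)

lemma nrm_zero [simp]: "nrm 0 = 0"
  by (simp add: nrm_def)

lemma nrm_scale: "x \<in> V \<Longrightarrow> nrm (r *\<^sub>R x) = \<bar>r\<bar> * nrm x"
proof -
  assume "x \<in> V"
  then have "ip (r *\<^sub>R x) (r *\<^sub>R x) = r\<^sup>2 * ip x x" by (simp add: ip_simps power2_eq_square)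
  then show ?thesis by (simp add: nrm_def real_sqrt_mult)
qed

lemma nrm_eq_0: "x \<in> V \<Longrightarrow> nrm x = 0 \<longleftrightarrow> ip x x = 0"
  by (simp add: nrm_def)

lemma nrm_minus_commute: "x \<in> V \<Longrightarrow> y \<in> V \<Longrightarrow> nrm (x - y) = nrm (y - x)"
  using nrm_scale[of "x - y" "-1"] by simp

text \<open>
  Stated for an arbitrary positive form, since it serves for the inner product and for the form
  \<open>\<langle>X u, v\<rangle>\<close> of a positive operator \<open>X\<close>.
\<close>

lemma positive_form_Cauchy_Schwarz:
  assumes q: "\<And>u v w. u \<in> V \<Longrightarrow> v \<in> V \<Longrightarrow> w \<in> V \<Longrightarrow> q (u + v) w = q u w + q v w"
      "\<And>r u v. u \<in> V \<Longrightarrow> v \<in> V \<Longrightarrow> q (r *\<^sub>R u) v = r * q u v"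
      "\<And>u v. u \<in> V \<Longrightarrow> v \<in> V \<Longrightarrow> q u v = q v u"
      "\<And>u. u \<in> V \<Longrightarrow> 0 \<le> q u u"
    and xy: "x \<in> V" "y \<in> V"
  shows "(q x y)\<^sup>2 \<le> q x x * q y y"
proof (rule nonneg_quadratic_discriminant)
  fix t :: real
  have ty: "t *\<^sub>R y \<in> V" "x + t *\<^sub>R y \<in> V" using xy by auto
  have l: "q (x + t *\<^sub>R y) w = q x w + t * q y w" if w: "w \<in> V" for w
    using q(1)[OF xy(1) ty(1) w] q(2)[OF xy(2) w] by simp
  have r: "q w (x + t *\<^sub>R y) = q x w + t * q y w" if w: "w \<in> V" for w
    using l[OF w] q(3)[OF w ty(2)] by simp
  have "0 \<le> q (x + t *\<^sub>R y) (x + t *\<^sub>R y)" by (rule q(4)[OF ty(2)])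
  also have "\<dots> = q x x + 2 * t * q x y + t\<^sup>2 * q y y"
    unfolding l[OF ty(2)] r[OF xy(1)] r[OF xy(2)] q(3)[OF xy(2,1)]
    by (simp add: algebra_simps power2_eq_square)
  finally show "0 \<le> q x x + 2 * t * q x y + t\<^sup>2 * q y y" .
qed (rule q(4)[OF xy(2)])

lemma Cauchy_Schwarz: "x \<in> V \<Longrightarrow> y \<in> V \<Longrightarrow> \<bar>ip x y\<bar> \<le> nrm x * nrm y"
proof -
  assume *: "x \<in> V" "y \<in> V"
  have "(ip x y)\<^sup>2 \<le> ip x x * ip y y"
    by (rule positive_form_Cauchy_Schwarz) (use * in \<open>auto simp: ip_simps ip_nonneg intro: ip_sym\<close>)
  from real_sqrt_le_mono[OF this] show ?thesis
    by (simp only: real_sqrt_abs real_sqrt_mult nrm_def)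
qed

lemma nrm_triangle: "x \<in> V \<Longrightarrow> y \<in> V \<Longrightarrow> nrm (x + y) \<le> nrm x + nrm y"
proof -
  assume *: "x \<in> V" "y \<in> V"
  have "(nrm (x + y))\<^sup>2 = (nrm x)\<^sup>2 + 2 * ip x y + (nrm y)\<^sup>2"
    using * ip_sym[of x y] by (simp add: nrm_sq ip_simps)
  also have "\<dots> \<le> (nrm x + nrm y)\<^sup>2"
    using Cauchy_Schwarz[of x y] * by (simp add: power2_sum)
  finally show ?thesis by (rule power2_le_imp_le) (use * in simp)
qed

lemma ip_null: "x \<in> V \<Longrightarrow> y \<in> V \<Longrightarrow> ip x x = 0 \<Longrightarrow> ip x y = 0"
  using Cauchy_Schwarz[of x y] by (simp add: nrm_def)

lemma ip_cong:
  assumes "x \<in> V" "x' \<in> V" "y \<in> V" "y' \<in> V" "ip (x - x') (x - x') = 0" "ip (y - y') (y - y') = 0"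
  shows "ip x y = ip x' y'"
proof -
  have "ip (x - x') y = 0" "ip (y - y') x' = 0"
    using ip_null[of "x - x'" y] ip_null[of "y - y'" x'] assms by simp_all
  then show ?thesis using assms ip_sym[of x' y] ip_sym[of x' y'] by (simp add: ip_simps)
qed

text \<open>Convergence in the seminorm; limits are unique only up to null vectors.\<close>

definition conv :: "(nat \<Rightarrow> 'a) \<Rightarrow> 'a \<Rightarrow> bool" where
  "conv s l \<longleftrightarrow> (\<forall>n. s n \<in> V) \<and> l \<in> V \<and> (\<lambda>n. nrm (s n - l)) \<longlonglongrightarrow> 0"

lemma conv_in: "conv s l \<Longrightarrow> s n \<in> V" "conv s l \<Longrightarrow> l \<in> V"
  by (auto simp: conv_def)

lemma conv_const: "x \<in> V \<Longrightarrow> ip (x - y) (x - y) = 0 \<Longrightarrow> y \<in> V \<Longrightarrow> conv (\<lambda>n. x) y"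
  by (simp add: conv_def nrm_def)

lemma conv_ip:
  assumes "conv s l" "conv t k"
  shows "(\<lambda>n. ip (s n) (t n)) \<longlonglongrightarrow> ip l k"
proof -
  note [simp] = conv_in[OF assms(1)] conv_in[OF assms(2)]
  have "(\<lambda>n. nrm (s n - l) * nrm (t n - k) + nrm (s n - l) * nrm k + nrm l * nrm (t n - k)) \<longlonglongrightarrow> 0 * 0 + 0 * nrm k + nrm l * 0"
    using assms unfolding conv_def by (intro tendsto_intros) auto
  then have "(\<lambda>n. nrm (s n - l) * nrm (t n - k) + nrm (s n - l) * nrm k + nrm l * nrm (t n - k)) \<longlonglongrightarrow> 0"
    by simp
  then have "(\<lambda>n. ip (s n) (t n) - ip l k) \<longlonglongrightarrow> 0"
  proof (rule Lim_null_comparison[rotated], intro always_eventually allI)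
    fix n
    have "ip (s n) (t n) - ip l k = ip (s n - l) (t n - k) + ip (s n - l) k + ip l (t n - k)"
      by (simp add: ip_simps)
    then show "norm (ip (s n) (t n) - ip l k) \<le> nrm (s n - l) * nrm (t n - k) + nrm (s n - l) * nrm k + nrm l * nrm (t n - k)"
      using Cauchy_Schwarz[of "s n - l" "t n - k"] Cauchy_Schwarz[of "s n - l" k] Cauchy_Schwarz[of l "t n - k"]
      by simp
  qed
  then show ?thesis by (simp add: Lim_null[symmetric])
qed

lemma conv_combine:
  assumes "conv s l" "conv t k"
  shows "conv (\<lambda>n. a *\<^sub>R s n + b *\<^sub>R t n) (a *\<^sub>R l + b *\<^sub>R k)"
proof -
  note [simp] = conv_in[OF assms(1)] conv_in[OF assms(2)]
  have "(\<lambda>n. \<bar>a\<bar> * nrm (s n - l) + \<bar>b\<bar> * nrm (t n - k)) \<longlonglongrightarrow> \<bar>a\<bar> * 0 + \<bar>b\<bar> * 0"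
    using assms unfolding conv_def by (intro tendsto_intros) auto
  then have lim: "(\<lambda>n. \<bar>a\<bar> * nrm (s n - l) + \<bar>b\<bar> * nrm (t n - k)) \<longlonglongrightarrow> 0"
    by simp
  have bd: "nrm ((a *\<^sub>R s n + b *\<^sub>R t n) - (a *\<^sub>R l + b *\<^sub>R k)) \<le> \<bar>a\<bar> * nrm (s n - l) + \<bar>b\<bar> * nrm (t n - k)" for n
  proof -
    have "(a *\<^sub>R s n + b *\<^sub>R t n) - (a *\<^sub>R l + b *\<^sub>R k) = a *\<^sub>R (s n - l) + b *\<^sub>R (t n - k)"
      by (simp add: algebra_simps)
    then show ?thesis
      using nrm_triangle[of "a *\<^sub>R (s n - l)" "b *\<^sub>R (t n - k)"] by (simp add: nrm_scale)
  qed
  show ?thesis unfolding conv_def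
    by (intro conjI allI Lim_null_comparison[OF always_eventually lim]) (use bd in auto)
qed

lemma conv_const': "x \<in> V \<Longrightarrow> conv (\<lambda>n. x) x"
  by (simp add: conv_def)

lemma conv_diff: "conv s l \<Longrightarrow> conv t k \<Longrightarrow> conv (\<lambda>n. s n - t n) (l - k)"
  using conv_combine[of s l t k 1 "-1"] by simp

lemma Cauchy_conv:
  assumes "\<And>n. s n \<in> V" and "\<And>\<epsilon>. \<epsilon> > 0 \<Longrightarrow> \<exists>N. \<forall>m\<ge>N. \<forall>n\<ge>N. nrm (s m - s n) < \<epsilon>"
  shows "\<exists>l. conv s l"
proof -
  have "\<exists>l\<in>V. (\<lambda>n. ip (s n - l) (s n - l)) \<longlonglongrightarrow> 0"
  proof (rule ip_complete[OF assms(1)])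
    fix \<epsilon> :: real assume "\<epsilon> > 0"
    then obtain N where "\<forall>m\<ge>N. \<forall>n\<ge>N. nrm (s m - s n) < sqrt \<epsilon>" using assms(2)[of "sqrt \<epsilon>"] by auto
    then show "\<exists>N. \<forall>m\<ge>N. \<forall>n\<ge>N. ip (s m - s n) (s m - s n) < \<epsilon>" by (auto simp: nrm_def)
  qed
  then obtain l where "l \<in> V" and l: "(\<lambda>n. ip (s n - l) (s n - l)) \<longlonglongrightarrow> 0" by blast
  moreover have "(\<lambda>n. nrm (s n - l)) \<longlonglongrightarrow> 0" using tendsto_real_sqrt[OF l] by (simp add: nrm_def)
  ultimately show ?thesis using assms(1) by (auto simp: conv_def)
qed

lemma conv_Cauchy:
  assumes "conv s l" "\<epsilon> > 0"
  shows "\<exists>N. \<forall>m\<ge>N. \<forall>n\<ge>N. nrm (s m - s n) < \<epsilon>"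
proof -
  note [simp] = conv_in[OF assms(1)]
  from assms have "\<forall>\<^sub>F n in sequentially. nrm (s n - l) < \<epsilon> / 2"
    unfolding conv_def by (intro order_tendstoD(2)) auto
  then obtain N where N: "\<And>n. n \<ge> N \<Longrightarrow> nrm (s n - l) < \<epsilon> / 2" by (auto simp: eventually_sequentially)
  have "nrm (s m - s n) < \<epsilon>" if "m \<ge> N" "n \<ge> N" for m n
    using nrm_triangle[of "s m - l" "l - s n"] N[OF that(1)] N[OF that(2)] nrm_minus_commute[of l "s n"]
    by simp
  then show ?thesis by blast
qed

text \<open>
  Minimizing the distance produces the orthogonal projection onto the closure of \<open>M\<close>; the minimizing
  sequence is Cauchy by the parallelogram law.
\<close>

lemma orthogonal_projection:
  assumes M: "subspace M" "M \<subseteq> V" and x: "x \<in> V"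
  obtains s l where "\<And>n. s n \<in> M" "conv s l" "\<And>z. z \<in> M \<Longrightarrow> ip (x - l) z = 0"
proof -
  define Q where "Q z = ip (x - z) (x - z)" for z
  define d where "d = Inf (Q ` M)"
  have bdd: "bdd_below (Q ` M)"
    by (rule bdd_belowI[of _ 0]) (use M x in \<open>auto simp: Q_def intro!: ip_nonneg\<close>)
  have d_le: "d \<le> Q z" if "z \<in> M" for z
    unfolding d_def by (rule cInf_lower) (use that bdd in auto)
  have "\<exists>z\<in>M. Q z < d + 1 / Suc n" for n
  proof -
    have "Q ` M \<noteq> {}" using subspace_0[OF M(1)] by auto
    then have "\<exists>q\<in>Q ` M. q < d + 1 / Suc n"
      using cInf_lessD[of "Q ` M" "d + 1 / Suc n"] by (auto simp: d_def)
    then show ?thesis by auto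
  qed
  then obtain s where s: "\<And>n. s n \<in> M" "\<And>n. Q (s n) < d + 1 / Suc n" by metis
  have [simp]: "s n \<in> V" for n using s(1) M by auto
  have par: "ip (s m - s n) (s m - s n) \<le> 2 / Suc m + 2 / Suc n" for m n
  proof -
    let ?z = "(1/2) *\<^sub>R (s m + s n)"
    have "?z \<in> M" using s(1) M(1) by (intro subspace_scale subspace_add) auto
    then have "d \<le> Q ?z" by (rule d_le)
    moreover have "ip (s m - s n) (s m - s n) = 2 * Q (s m) + 2 * Q (s n) - 4 * Q ?z"
      using x ip_sym[of "s m" x] ip_sym[of "s n" x] ip_sym[of "s m" "s n"]
      by (simp add: Q_def ip_simps algebra_simps)
    ultimately show ?thesis using s(2)[of m] s(2)[of n] by simp
  qed
  have "\<exists>l. conv s l"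
  proof (rule Cauchy_conv)
    fix \<epsilon> :: real assume "\<epsilon> > 0"
    then obtain N where N: "4 / Suc N < \<epsilon>\<^sup>2"
      using reals_Archimedean[of "\<epsilon>\<^sup>2 / 4"] by (auto simp: field_simps)
    have "nrm (s m - s n) < \<epsilon>" if "m \<ge> N" "n \<ge> N" for m n
    proof -
      have "2 / Suc m \<le> 2 / Suc N" "2 / Suc n \<le> 2 / Suc N" using that by (auto intro!: divide_left_mono)
      with par[of m n] N have "ip (s m - s n) (s m - s n) < \<epsilon>\<^sup>2" by simp
      then have "sqrt (ip (s m - s n) (s m - s n)) < sqrt (\<epsilon>\<^sup>2)" by (rule real_sqrt_less_mono)
      with \<open>\<epsilon> > 0\<close> show ?thesis by (simp add: nrm_def)
    qed
    then show "\<exists>N. \<forall>m\<ge>N. \<forall>n\<ge>N. nrm (s m - s n) < \<epsilon>" by blast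
  qed simp
  then obtain l where l: "conv s l" by blast
  have [simp]: "l \<in> V" using l conv_in by blast
  have Ql: "Q l \<le> d"
  proof (rule LIMSEQ_le)
    show "(\<lambda>n. Q (s n)) \<longlonglongrightarrow> Q l"
      unfolding Q_def by (intro conv_ip conv_diff l conv_const' x)
    have "(\<lambda>n. d + 1 / Suc n) \<longlonglongrightarrow> d + 0"
      by (intro tendsto_intros LIMSEQ_inverse_real_of_nat[unfolded inverse_eq_divide])
    then show "(\<lambda>n. d + 1 / Suc n) \<longlonglongrightarrow> d" by simp
    show "\<exists>N. \<forall>n\<ge>N. Q (s n) \<le> d + 1 / Suc n" using s(2) less_imp_le by blast
  qed
  have "ip (x - l) z = 0" if z: "z \<in> M" for z
  proof -
    have [simp]: "z \<in> V" using z M by auto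
    have "(ip (x - l) z)\<^sup>2 \<le> 0 * ip z z"
    proof (rule nonneg_quadratic_discriminant)
      fix t :: real
      have "d \<le> Q (l - t *\<^sub>R z)"
      proof (rule LIMSEQ_le_const)
        have "conv (\<lambda>n. x - (s n - t *\<^sub>R z)) (x - (l - t *\<^sub>R z))"
          by (intro conv_diff l conv_const' x) auto
        from conv_ip[OF this this] show "(\<lambda>n. Q (s n - t *\<^sub>R z)) \<longlonglongrightarrow> Q (l - t *\<^sub>R z)"
          by (simp add: Q_def)
        have "s n - t *\<^sub>R z \<in> M" for n using s(1) z M(1) by (intro subspace_diff subspace_scale) auto
        then show "\<exists>N. \<forall>n\<ge>N. d \<le> Q (s n - t *\<^sub>R z)" using d_le by blast
      qed
      also have "Q (l - t *\<^sub>R z) = Q l + 2 * t * ip (x - l) z + t\<^sup>2 * ip z z"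
        using x ip_sym[of z x] ip_sym[of z l]
        by (simp add: Q_def ip_simps algebra_simps power2_eq_square)
      finally show "0 \<le> 0 + 2 * t * ip (x - l) z + t\<^sup>2 * ip z z" using Ql by simp
    qed (simp add: ip_nonneg)
    then show ?thesis by simp
  qed
  with s(1) l show ?thesis using that by blast
qed

section \<open>Adjoints and von Neumann's theorem\<close>

text \<open>
  Operators are graphs. The names \<open>sa\<close> and \<open>nn\<close> stand for self-adjoint and nonnegative.
\<close>

definition adj :: "'a rel \<Rightarrow> 'a rel" where
  "adj A = {(v, g). v \<in> V \<and> g \<in> V \<and> (\<forall>(u, f)\<in>A. ip f v = ip u g)}"

definition dense_dom :: "'a rel \<Rightarrow> bool" where
  "dense_dom A \<longleftrightarrow> (\<forall>v\<in>V. \<forall>\<epsilon>>0. \<exists>u\<in>Domain A. nrm (v - u) < \<epsilon>)"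

definition sa :: "'a rel \<Rightarrow> bool" where
  "sa A \<longleftrightarrow> dense_dom A \<and> adj A = A"

definition nn :: "'a rel \<Rightarrow> bool" where
  "nn A \<longleftrightarrow> (\<forall>(u, f)\<in>A. 0 \<le> ip f u)"

definition closed_rel :: "'a rel \<Rightarrow> bool" where
  "closed_rel A \<longleftrightarrow> (\<forall>s t u f. (\<forall>n. (s n, t n) \<in> A) \<longrightarrow> conv s u \<longrightarrow> conv t f \<longrightarrow> (u, f) \<in> A)"

lemma adj_in: "(v, g) \<in> adj A \<Longrightarrow> v \<in> V" "(v, g) \<in> adj A \<Longrightarrow> g \<in> V"
  by (auto simp: adj_def)

lemma adjD: "(v, g) \<in> adj A \<Longrightarrow> (u, f) \<in> A \<Longrightarrow> ip f v = ip u g"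
  by (auto simp: adj_def)

lemma closed_relD:
  "closed_rel A \<Longrightarrow> (\<And>n. (s n, t n) \<in> A) \<Longrightarrow> conv s u \<Longrightarrow> conv t f \<Longrightarrow> (u, f) \<in> A"
  by (auto simp: closed_rel_def)

lemma adj_closed: assumes "A \<subseteq> V \<times> V" shows "closed_rel (adj A)"
  unfolding closed_rel_def
proof (intro allI impI)
  fix s t u f assume st: "\<forall>n. (s n, t n) \<in> adj A" and c: "conv s u" "conv t f"
  have "ip y u = ip x f" if xy: "(x, y) \<in> A" for x y
  proof -
    have [simp]: "x \<in> V" "y \<in> V" using xy assms by auto
    have "(\<lambda>n. ip y (s n)) \<longlonglongrightarrow> ip y u" by (intro conv_ip conv_const' c) auto
    moreover have "(\<lambda>n. ip x (t n)) \<longlonglongrightarrow> ip x f" by (intro conv_ip conv_const' c) auto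
    moreover have "ip y (s n) = ip x (t n)" for n using st xy adjD by blast
    ultimately show ?thesis using LIMSEQ_unique by auto
  qed
  then show "(u, f) \<in> adj A" using conv_in[OF c(1)] conv_in[OF c(2)] by (auto simp: adj_def)
qed

lemma adj_subspace: assumes "A \<subseteq> V \<times> V" shows "subspace (adj A)"
proof -
  have m: "u \<in> V" "f \<in> V" if "(u, f) \<in> A" for u f using that assms by auto
  have "(0, 0) \<in> adj A" using m by (auto simp: adj_def)
  moreover have "(v + v', g + g') \<in> adj A" if "(v, g) \<in> adj A" "(v', g') \<in> adj A" for v g v' g'
    using that m by (fastforce simp: adj_def ip_simps)
  moreover have "(r *\<^sub>R v, r *\<^sub>R g) \<in> adj A" if "(v, g) \<in> adj A" for v g r
    using that m by (fastforce simp: adj_def ip_simps)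
  ultimately show ?thesis by (auto simp: subspace_def zero_prod_def)
qed

lemma closed_rel_cong:
  assumes "closed_rel A" "(x, y) \<in> A" "x \<in> V" "y \<in> V" "x' \<in> V" "y' \<in> V"
    "ip (x - x') (x - x') = 0" "ip (y - y') (y - y') = 0"
  shows "(x', y') \<in> A"
proof -
  have "conv (\<lambda>n. x) x'" "conv (\<lambda>n. y) y'" using assms by (auto intro: conv_const)
  then show ?thesis by (rule closed_relD[OF assms(1,2)])
qed

lemma sa_props:
  assumes "sa A"
  shows sa_sub: "A \<subseteq> V \<times> V" and sa_closed: "closed_rel A" and sa_subspace: "subspace A"
proof -
  have A: "adj A = A" using assms by (simp add: sa_def)
  have "adj A \<subseteq> V \<times> V" by (auto simp: adj_def)
  then show *: "A \<subseteq> V \<times> V" by (simp only: A)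
  show "closed_rel A" "subspace A" using adj_closed[OF *] adj_subspace[OF *] by (simp_all add: A)
qed

lemma sa_in: "sa A \<Longrightarrow> (u, f) \<in> A \<Longrightarrow> u \<in> V" "sa A \<Longrightarrow> (u, f) \<in> A \<Longrightarrow> f \<in> V"
  using sa_sub by blast+

lemma sa_symmetric: "sa A \<Longrightarrow> (u, f) \<in> A \<Longrightarrow> (v, g) \<in> A \<Longrightarrow> ip f v = ip u g"
  using adjD[of v g A u f] by (simp add: sa_def)

lemma subspace_rel:
  assumes "subspace (A :: ('a \<times> 'a) set)" "(u, f) \<in> A" "(v, g) \<in> A"
  shows "(u + v, f + g) \<in> A" "(u - v, f - g) \<in> A" "(r *\<^sub>R u, r *\<^sub>R f) \<in> A"
  using subspace_add[OF assms] subspace_diff[OF assms] subspace_scale[OF assms(1,2)] by simp_all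

lemma subspace_Domain: "subspace A \<Longrightarrow> subspace (Domain A)" for A :: "('a \<times> 'a) set"
proof -
  assume A: "subspace A"
  have "Domain A = fst ` A" by (auto simp: Domain_fst)
  then show ?thesis using linear_subspace_image[OF linear_fst A] by simp
qed

text \<open>
  A vector orthogonal to the domain is orthogonal to vectors arbitrarily close to itself; conversely
  the projection error \<open>v - l\<close> is orthogonal to the domain, hence null.
\<close>

lemma dense_dom_iff:
  assumes A: "subspace A" "A \<subseteq> V \<times> V"
  shows "dense_dom A \<longleftrightarrow> (\<forall>v\<in>V. (\<forall>u\<in>Domain A. ip v u = 0) \<longrightarrow> ip v v = 0)"
proof
  assume d: "dense_dom A"
  show "\<forall>v\<in>V. (\<forall>u\<in>Domain A. ip v u = 0) \<longrightarrow> ip v v = 0"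
  proof (intro ballI impI)
    fix v assume v: "v \<in> V" and o: "\<forall>u\<in>Domain A. ip v u = 0"
    have "nrm v \<le> \<epsilon>" if "\<epsilon> > 0" for \<epsilon>
    proof -
      obtain u where u: "u \<in> Domain A" "nrm (v - u) < \<epsilon>" using d v \<open>\<epsilon> > 0\<close> unfolding dense_dom_def by blast
      have uV: "u \<in> V" using u A by auto
      have "(nrm v)\<^sup>2 = ip v (v - u)" using u o v uV by (simp add: ip_simps nrm_sq)
      also have "\<dots> \<le> nrm v * nrm (v - u)" using Cauchy_Schwarz[of v "v - u"] v uV by simp
      also have "\<dots> \<le> nrm v * \<epsilon>" using u v by (intro mult_left_mono) auto
      finally have "nrm v * nrm v \<le> nrm v * \<epsilon>" by (simp add: power2_eq_square)
      then show ?thesis using nrm_nonneg[OF v] \<open>\<epsilon> > 0\<close>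
        by (cases "nrm v = 0") auto
    qed
    then have "nrm v \<le> 0" by (rule dense_ge)
    then show "ip v v = 0" using v nrm_nonneg[OF v] nrm_eq_0[OF v] by simp
  qed
next
  assume o: "\<forall>v\<in>V. (\<forall>u\<in>Domain A. ip v u = 0) \<longrightarrow> ip v v = 0"
  have DV: "Domain A \<subseteq> V" using A by auto
  show "dense_dom A" unfolding dense_dom_def
  proof (intro ballI allI impI)
    fix v and \<epsilon> :: real assume v: "v \<in> V" and "\<epsilon> > 0"
    obtain s l where s: "\<And>n. s n \<in> Domain A" "conv s l" "\<And>z. z \<in> Domain A \<Longrightarrow> ip (v - l) z = 0"
      using orthogonal_projection[OF subspace_Domain[OF A(1)] DV v] by blast
    have [simp]: "l \<in> V" "\<And>n. s n \<in> V" using s(2) conv_in by blast+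
    have "nrm (v - l) = 0" using o s v by (simp add: nrm_eq_0)
    moreover have "\<forall>\<^sub>F n in sequentially. nrm (s n - l) < \<epsilon>"
      using s(2) \<open>\<epsilon> > 0\<close> unfolding conv_def by (intro order_tendstoD(2)) auto
    then obtain n where "nrm (s n - l) < \<epsilon>" by (auto simp: eventually_sequentially)
    ultimately have "nrm (v - s n) < \<epsilon>"
      using nrm_triangle[of "v - l" "l - s n"] nrm_minus_commute[of l "s n"] v by simp
    then show "\<exists>u\<in>Domain A. nrm (v - u) < \<epsilon>" using s by blast
  qed
qed

text \<open>The space that contains the graphs of operators.\<close>

lemma semi_hilbert_prod: "semi_hilbert (V \<times> V) (\<lambda>x y. ip (fst x) (fst y) + ip (snd x) (snd y))"
proof
  show "subspace (V \<times> V)" by (simp add: subspace_V subspace_Times)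
next
  fix s :: "nat \<Rightarrow> 'a \<times> 'a" assume s: "\<And>n. s n \<in> V \<times> V"
    and c: "\<And>\<epsilon>. \<epsilon> > 0 \<Longrightarrow> \<exists>N. \<forall>m\<ge>N. \<forall>n\<ge>N. ip (fst (s m - s n)) (fst (s m - s n)) + ip (snd (s m - s n)) (snd (s m - s n)) < \<epsilon>"
  have m: "fst (s n) \<in> V" "snd (s n) \<in> V" for n using s[of n] by (auto simp: mem_Times_iff)
  have n: "0 \<le> ip (fst (s m - s n)) (fst (s m - s n))" "0 \<le> ip (snd (s m - s n)) (snd (s m - s n))" for m n
    using m by (auto intro: ip_nonneg)
  have "\<exists>l\<in>V. (\<lambda>n. ip (fst (s n) - l) (fst (s n) - l)) \<longlonglongrightarrow> 0"
  proof (rule ip_complete[OF m(1)])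
    fix \<epsilon> :: real assume "\<epsilon> > 0"
    from c[OF this] show "\<exists>N. \<forall>m\<ge>N. \<forall>n\<ge>N. ip (fst (s m) - fst (s n)) (fst (s m) - fst (s n)) < \<epsilon>"
      using n(2) by (force simp: add_nonneg_nonneg intro: le_less_trans[rotated])
  qed
  moreover have "\<exists>l\<in>V. (\<lambda>n. ip (snd (s n) - l) (snd (s n) - l)) \<longlonglongrightarrow> 0"
  proof (rule ip_complete[OF m(2)])
    fix \<epsilon> :: real assume "\<epsilon> > 0"
    from c[OF this] show "\<exists>N. \<forall>m\<ge>N. \<forall>n\<ge>N. ip (snd (s m) - snd (s n)) (snd (s m) - snd (s n)) < \<epsilon>"
      using n(1) by (force simp: add_nonneg_nonneg intro: le_less_trans[rotated])
  qed
  ultimately obtain l k where "l \<in> V" "k \<in> V" "(\<lambda>n. ip (fst (s n) - l) (fst (s n) - l)) \<longlonglongrightarrow> 0"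
    "(\<lambda>n. ip (snd (s n) - k) (snd (s n) - k)) \<longlonglongrightarrow> 0" by blast
  then show "\<exists>l\<in>V \<times> V. (\<lambda>n. ip (fst (s n - l)) (fst (s n - l)) + ip (snd (s n - l)) (snd (s n - l))) \<longlonglongrightarrow> 0"
    by (intro bexI[of _ "(l, k)"]) (auto intro: tendsto_add_zero)
next
  fix x y :: "'a \<times> 'a" assume "x \<in> V \<times> V" "y \<in> V \<times> V"
  then show "ip (fst x) (fst y) + ip (snd x) (snd y) = ip (fst y) (fst x) + ip (snd y) (snd x)"
    using ip_sym[of "fst x" "fst y"] ip_sym[of "snd x" "snd y"] by (auto simp: mem_Times_iff)
qed (auto simp: ip_simps ip_nonneg algebra_simps)

text \<open>
  A symmetric relation \<open>A\<close> with \<open>1 + A\<close> onto has no proper symmetric extension: an element of the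
  adjoint is matched by an element of \<open>A\<close> with the same image, and their difference is orthogonal to
  the range of \<open>1 + A\<close>.
\<close>

lemma adj_eq_if_onto:
  assumes sub: "A \<subseteq> V \<times> V" and cl: "\<And>x y x' y'. (x, y) \<in> A \<Longrightarrow> x' \<in> V \<Longrightarrow> y' \<in> V \<Longrightarrow>
      ip (x - x') (x - x') = 0 \<Longrightarrow> ip (y - y') (y - y') = 0 \<Longrightarrow> (x', y') \<in> A"
    and sym: "A \<subseteq> adj A" and onto: "\<And>h. h \<in> V \<Longrightarrow> \<exists>(u, f)\<in>A. ip (u + f - h) (u + f - h) = 0"
  shows "adj A = A"
proof
  show "adj A \<subseteq> A"
  proof safe
    fix v g assume vg: "(v, g) \<in> adj A"
    have [simp]: "v \<in> V" "g \<in> V" using vg adj_in by blast+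
    obtain u f where uf: "(u, f) \<in> A" "ip (u + f - (v + g)) (u + f - (v + g)) = 0"
      using onto[of "v + g"] by auto
    have [simp]: "u \<in> V" "f \<in> V" using uf sub by auto
    have n: "ip (u + f) x = ip (v + g) x" if "x \<in> V" for x
      using ip_cong[OF _ _ that that _ _] uf(2) that by simp
    have o: "ip (x + y) (v - u) = 0" if xy: "(x, y) \<in> A" for x y
    proof -
      have [simp]: "x \<in> V" "y \<in> V" using xy sub by auto
      have "ip y v = ip x g" "ip y u = ip x f" using adjD[OF vg xy] adjD[of u f A x y] uf(1) xy sym by auto
      then show ?thesis using n[of x] ip_sym[of x f] ip_sym[of x g] ip_sym[of x u] ip_sym[of x v] by (simp add: ip_simps)
    qed
    obtain x y where xy: "(x, y) \<in> A" "ip (x + y - (v - u)) (x + y - (v - u)) = 0"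
      using onto[of "v - u"] by auto
    have [simp]: "x \<in> V" "y \<in> V" using xy sub by auto
    have uv: "ip (v - u) (v - u) = 0"
      using o[OF xy(1)] ip_cong[of "x + y" "v - u" "v - u" "v - u"] xy(2) by simp
    have "ip (f - g) (f - g) = ip (v - u) (v - u)"
    proof -
      have "ip (v - u) (v - u) = ip (v - u) (f - g)"
        using n[of "v - u"] uv ip_null[of "v - u" "f - g"] by simp
      moreover have "ip (f - g) (f - g) = ip (v - u) (f - g)" using n[of "f - g"]
        by (simp add: ip_simps)
      ultimately show ?thesis by simp
    qed
    moreover have "ip (u - v) (u - v) = 0" using uv nrm_minus_commute[of u v] by (simp add: nrm_def)
    ultimately show "(v, g) \<in> A" using cl[OF uf(1), of v g] uv by simp
  qed
qed (rule sym)

text \<open>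
  Von Neumann's theorem. Splitting \<open>(h, 0)\<close> along the graph of \<open>D\<close> and its orthogonal complement,
  which is the rotated graph of the adjoint, gives \<open>u\<close> in the domain of \<open>D\<^sup>*D\<close> with \<open>u + D\<^sup>*Du = h\<close>.
\<close>

proposition von_Neumann_adj_comp:
  assumes sub: "D \<subseteq> V \<times> V" and lin: "subspace D" and cl: "closed_rel D" and dn: "dense_dom D"
  shows "sa (D O adj D)" "nn (D O adj D)"
proof -
  let ?A = "D O adj D"
  have subA: "?A \<subseteq> V \<times> V" using sub by (auto simp: adj_def)
  have clA: "(x', z') \<in> ?A" if xz: "(x, z) \<in> ?A" and [simp]: "x' \<in> V" "z' \<in> V" and
      "ip (x - x') (x - x') = 0" "ip (z - z') (z - z') = 0" for x z x' z'
  proof -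
    obtain y where y: "(x, y) \<in> D" "(y, z) \<in> adj D" using xz by blast
    have [simp]: "x \<in> V" "y \<in> V" "z \<in> V" using y sub adj_in by auto
    have "(x', y) \<in> D" by (rule closed_rel_cong[OF cl y(1)]) (use that in auto)
    moreover have "(y, z') \<in> adj D" by (rule closed_rel_cong[OF adj_closed[OF sub] y(2)]) (use that in auto)
    ultimately show ?thesis by blast
  qed
  have symA: "?A \<subseteq> adj ?A"
  proof safe
    fix x y z assume y: "(x, y) \<in> D" "(y, z) \<in> adj D"
    have [simp]: "x \<in> V" "y \<in> V" "z \<in> V" using y sub adj_in by auto
    have "ip f x = ip u z" if uf: "(u, g) \<in> D" "(g, f) \<in> adj D" for u g f
    proof -
      have [simp]: "u \<in> V" "g \<in> V" "f \<in> V" using uf sub adj_in by auto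
      show ?thesis using adjD[OF y(2) uf(1)] adjD[OF uf(2) y(1)] ip_sym[of y g] ip_sym[of f x] by simp
    qed
    then show "(x, z) \<in> adj ?A" by (auto simp: adj_def)
  qed
  interpret P: semi_hilbert "V \<times> V" "\<lambda>x y. ip (fst x) (fst y) + ip (snd x) (snd y)"
    by (rule semi_hilbert_prod)
  have onto: "\<exists>(u, f)\<in>?A. ip (u + f - h) (u + f - h) = 0" if h: "h \<in> V" for h
  proof -
    have "(h, 0) \<in> V \<times> V" using h by auto
    from P.orthogonal_projection[OF lin sub this] obtain s l
      where s: "\<And>n. s n \<in> D" "P.conv s l"
        and o: "\<And>z. z \<in> D \<Longrightarrow> ip (fst ((h, 0) - l)) (fst z) + ip (snd ((h, 0) - l)) (snd z) = 0"
      by blast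
    obtain u f where l: "l = (u, f)" by force
    have [simp]: "u \<in> V" "f \<in> V" using P.conv_in[OF s(2)] l by auto
    have sV: "fst (s n) \<in> V" "snd (s n) \<in> V" for n using subsetD[OF sub s(1)[of n]] by (auto simp: mem_Times_iff)
    have lim: "(\<lambda>n. P.nrm (s n - l)) \<longlonglongrightarrow> 0" using s(2) by (simp add: P.conv_def)
    have le: "nrm (fst (s n) - u) \<le> P.nrm (s n - l)" "nrm (snd (s n) - f) \<le> P.nrm (s n - l)" for n
      using sV by (auto simp: nrm_def P.nrm_def l ip_nonneg)
    have "conv (\<lambda>n. fst (s n)) u" "conv (\<lambda>n. snd (s n)) f"
      unfolding conv_def using sV le by (auto intro!: Lim_null_comparison[OF always_eventually lim])
    moreover have "\<forall>n. (fst (s n), snd (s n)) \<in> D" using s by simp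
    ultimately have ufD: "(u, f) \<in> D" using closed_relD[OF cl, of "\<lambda>n. fst (s n)" "\<lambda>n. snd (s n)"] by blast
    have "(f, h - u) \<in> adj D" unfolding adj_def
    proof (clarsimp simp: h)
      fix x y assume xy: "(x, y) \<in> D"
      have [simp]: "x \<in> V" "y \<in> V" using xy sub by auto
      show "ip y f = ip x (h - u)" using o[OF xy] h by (simp add: l ip_simps ip_sym[of x h] ip_sym[of x u] ip_sym[of y f])
    qed
    with ufD have "(u, h - u) \<in> ?A" by blast
    then show ?thesis using h by (intro bexI[of _ "(u, h - u)"]) auto
  qed
  have adjA: "adj ?A = ?A" by (rule adj_eq_if_onto[OF subA clA symA onto])
  have linA: "subspace ?A" using adj_subspace[OF subA] adjA by simp
  have nrmA: "ip z x = ip y y" if "(x, y) \<in> D" "(y, z) \<in> adj D" for x y z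
    using adjD[OF that(2,1)] sub that adj_in[OF that(2)] ip_sym by auto
  have "ip h h = 0" if h: "h \<in> V" and o: "\<forall>u\<in>Domain ?A. ip h u = 0" for h
  proof -
    obtain u g f where uf: "(u, g) \<in> D" "(g, f) \<in> adj D" "ip (u + f - h) (u + f - h) = 0"
      using onto[OF h] by blast
    have [simp]: "u \<in> V" "g \<in> V" "f \<in> V" using uf sub adj_in by auto
    have "ip h u = 0" using o uf by blast
    then have "ip (u + f) u = 0" using ip_cong[of "u + f" h u u] uf(3) h by simp
    then have z: "ip u u = 0" "ip g g = 0"
      using nrmA[OF uf(1,2)] ip_nonneg[of u] ip_nonneg[of g] by (auto simp: ip_simps)
    have "ip x f = 0" if xy: "(x, y) \<in> D" for x y
      using adjD[OF uf(2) xy] ip_null[of g y] z ip_sym[of y g] xy sub by auto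
    then have "\<forall>x\<in>Domain D. ip f x = 0" using sub ip_sym[OF \<open>f \<in> V\<close>] by (auto simp: Domain_iff subset_iff)
    then have "ip f f = 0" using dn dense_dom_iff[OF lin sub] by simp
    then have "ip (u + f) (u + f) = 0" using z ip_null[of u f] ip_sym[of u f] by (simp add: ip_simps)
    then show ?thesis using ip_cong[of "u + f" h "u + f" h] uf(3) h by simp
  qed
  then show "sa ?A" unfolding sa_def using adjA dense_dom_iff[OF linA subA] by blast
  show "nn ?A" unfolding nn_def using nrmA sub by (fastforce intro: ip_nonneg)
qed

end

section \<open>Square roots of bounded positive operators\<close>

text \<open>
  The fixed-point iteration for \<open>2 Y = Z + Y\<^sup>2\<close>. The sequence \<open>sqrt_bound\<close> is the same iteration for
  the number \<open>Z = 1\<close>; it increases to \<open>1\<close>.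
\<close>

primrec sqrt_iter :: "('a::real_vector \<Rightarrow> 'a) \<Rightarrow> nat \<Rightarrow> 'a \<Rightarrow> 'a" where
  "sqrt_iter Z 0 = (\<lambda>x. 0)"
| "sqrt_iter Z (Suc n) = (\<lambda>x. (1/2) *\<^sub>R (Z x + sqrt_iter Z n (sqrt_iter Z n x)))"

primrec sqrt_bound :: "nat \<Rightarrow> real" where
  "sqrt_bound 0 = 0"
| "sqrt_bound (Suc n) = (1 + (sqrt_bound n)\<^sup>2) / 2"

lemma sqrt_bound_range: "0 \<le> sqrt_bound n \<and> sqrt_bound n \<le> 1"
proof (induction n)
  case (Suc n)
  then have "(sqrt_bound n)\<^sup>2 \<le> 1" by (simp add: abs_square_le_1)
  then show ?case by simp
qed simp

lemma sqrt_bound_step: "sqrt_bound n \<le> sqrt_bound (Suc n)"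
proof -
  have "0 \<le> (sqrt_bound n - 1)\<^sup>2" by simp
  then show ?thesis by (simp add: power2_eq_square algebra_simps)
qed

lemma sqrt_bound_mono: "m \<le> n \<Longrightarrow> sqrt_bound m \<le> sqrt_bound n"
  using sqrt_bound_step by (rule lift_Suc_mono_le)

lemma sqrt_bound_Cauchy: "\<epsilon> > 0 \<Longrightarrow> \<exists>N. \<forall>m\<ge>N. \<forall>n\<ge>N. \<bar>sqrt_bound m - sqrt_bound n\<bar> < \<epsilon>"
proof -
  assume "\<epsilon> > 0"
  have "incseq sqrt_bound" using sqrt_bound_mono by (simp add: incseq_def)
  then obtain L where "sqrt_bound \<longlonglongrightarrow> L"
    by (rule incseq_convergent[of sqrt_bound 1]) (simp add: sqrt_bound_range)
  then have "Cauchy sqrt_bound" by (rule LIMSEQ_imp_Cauchy)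
  then show ?thesis using \<open>\<epsilon> > 0\<close> by (simp add: Cauchy_def dist_real_def)
qed

text \<open>
  Composing operators requires genuine equality of vectors, which a definite inner product provides.
\<close>

locale hilbert = semi_hilbert +
  assumes ip_definite: "\<And>x. x \<in> V \<Longrightarrow> ip x x = 0 \<Longrightarrow> x = 0"
begin

lemma nrm_0_iff [simp]: "x \<in> V \<Longrightarrow> nrm x = 0 \<longleftrightarrow> x = 0"
  using ip_definite[of x] by (auto simp: nrm_eq_0)

lemma conv_unique: "conv s l \<Longrightarrow> conv s k \<Longrightarrow> l = k"
proof -
  assume c: "conv s l" "conv s k"
  from conv_diff[OF c] have "(\<lambda>n::nat. nrm (0 - (l - k))) \<longlonglongrightarrow> 0" by (simp add: conv_def)
  then have "nrm (0 - (l - k)) = 0" using LIMSEQ_const_iff[of "nrm (0 - (l - k))" 0] by simp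
  then show ?thesis using conv_in[OF c(1)] conv_in[OF c(2)] by simp
qed

lemma ext_eq: "x \<in> V \<Longrightarrow> y \<in> V \<Longrightarrow> (\<And>z. z \<in> V \<Longrightarrow> ip x z = ip y z) \<Longrightarrow> x = y"
  using ip_definite[of "x - y"] by (simp add: ip_simps)

definition contr :: "('a \<Rightarrow> 'a) \<Rightarrow> bool" where
  "contr T \<longleftrightarrow> (\<forall>x\<in>V. T x \<in> V \<and> nrm (T x) \<le> nrm x) \<and>
     (\<forall>x\<in>V. \<forall>y\<in>V. T (x + y) = T x + T y) \<and> (\<forall>x\<in>V. \<forall>r. T (r *\<^sub>R x) = r *\<^sub>R T x)"

lemma contrD:
  assumes "contr T"
  shows contr_in: "x \<in> V \<Longrightarrow> T x \<in> V" and contr_le: "x \<in> V \<Longrightarrow> nrm (T x) \<le> nrm x"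
    and contr_add: "x \<in> V \<Longrightarrow> y \<in> V \<Longrightarrow> T (x + y) = T x + T y"
    and contr_scale: "x \<in> V \<Longrightarrow> T (r *\<^sub>R x) = r *\<^sub>R T x"
    and contr_diff: "x \<in> V \<Longrightarrow> y \<in> V \<Longrightarrow> T (x - y) = T x - T y"
proof -
  show "x \<in> V \<Longrightarrow> T x \<in> V" "x \<in> V \<Longrightarrow> nrm (T x) \<le> nrm x" 
    and a: "x \<in> V \<Longrightarrow> y \<in> V \<Longrightarrow> T (x + y) = T x + T y"
    and s: "x \<in> V \<Longrightarrow> T (r *\<^sub>R x) = r *\<^sub>R T x" for x y r
    using assms by (auto simp: contr_def)
  show "x \<in> V \<Longrightarrow> y \<in> V \<Longrightarrow> T (x - y) = T x - T y"
    using a[of x "- y"] s[of y "-1"] by simp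
qed

lemma contr_comp: "contr S \<Longrightarrow> contr T \<Longrightarrow> contr (\<lambda>x. S (T x))"
  unfolding contr_def[of "\<lambda>x. S (T x)"]
  by (auto simp: contr_in contr_add contr_scale intro: order_trans[OF contr_le contr_le])

lemma contr_conv: "contr T \<Longrightarrow> conv s l \<Longrightarrow> conv (\<lambda>n. T (s n)) (T l)"
proof -
  assume T: "contr T" and c: "conv s l"
  have lim: "(\<lambda>n. nrm (s n - l)) \<longlonglongrightarrow> 0" using c by (simp add: conv_def)
  have "nrm (T (s n) - T l) \<le> nrm (s n - l)" for n
    using contr_le[OF T, of "s n - l"] contr_diff[OF T] conv_in[OF c] by simp
  then show ?thesis unfolding conv_def
    by (intro conjI allI Lim_null_comparison[OF always_eventually lim])
       (use conv_in[OF c] contr_in[OF T] in auto)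
qed

definition symm :: "('a \<Rightarrow> 'a) \<Rightarrow> bool" where
  "symm T \<longleftrightarrow> (\<forall>x\<in>V. \<forall>y\<in>V. ip (T x) y = ip x (T y))"

definition posi :: "('a \<Rightarrow> 'a) \<Rightarrow> bool" where
  "posi T \<longleftrightarrow> (\<forall>x\<in>V. 0 \<le> ip (T x) x)"

text \<open>The operators \<open>T\<close> with \<open>0 \<le> T \<le> 1\<close>.\<close>

definition effect :: "('a \<Rightarrow> 'a) \<Rightarrow> bool" where
  "effect T \<longleftrightarrow> contr T \<and> symm T \<and> posi T"

definition commute :: "('a \<Rightarrow> 'a) \<Rightarrow> ('a \<Rightarrow> 'a) \<Rightarrow> bool" where
  "commute S T \<longleftrightarrow> (\<forall>x\<in>V. S (T x) = T (S x))"

lemma symmD: "symm T \<Longrightarrow> x \<in> V \<Longrightarrow> y \<in> V \<Longrightarrow> ip (T x) y = ip x (T y)"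
  and posiD: "posi T \<Longrightarrow> x \<in> V \<Longrightarrow> 0 \<le> ip (T x) x"
  and commuteD: "commute S T \<Longrightarrow> x \<in> V \<Longrightarrow> S (T x) = T (S x)"
  and commute_sym: "commute S T \<Longrightarrow> commute T S"
  by (auto simp: symm_def posi_def commute_def)

lemma sqrt_iter_commute:
  assumes Z: "contr Z" and C: "contr C" and CZ: "commute C Z"
    and Y: "\<And>n. contr (sqrt_iter Z n)"
  shows "commute C (sqrt_iter Z n)"
proof (induction n)
  case 0
  show ?case using contr_scale[OF C, of 0 0] by (simp add: commute_def)
next
  case (Suc n)
  show ?case unfolding commute_def
  proof
    fix x assume x: "x \<in> V"
    have [simp]: "Z x \<in> V" "sqrt_iter Z n x \<in> V" "sqrt_iter Z n (sqrt_iter Z n x) \<in> V"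
      using contr_in[OF Z] contr_in[OF Y] x by auto
    show "C (sqrt_iter Z (Suc n) x) = sqrt_iter Z (Suc n) (C x)"
      using x by (simp add: contr_scale[OF C] contr_add[OF C] commuteD[OF CZ] commuteD[OF Suc])
  qed
qed

lemma sqrt_iter_props:
  assumes Z: "contr Z"
  shows "contr (sqrt_iter Z n) \<and> (\<forall>x\<in>V. nrm (sqrt_iter Z n x) \<le> sqrt_bound n * nrm x)"
proof (induction n)
  case (Suc n)
  let ?Y = "sqrt_iter Z n"
  have Y: "contr ?Y" and le: "\<And>x. x \<in> V \<Longrightarrow> nrm (?Y x) \<le> sqrt_bound n * nrm x" using Suc by auto
  note [simp] = contr_in[OF Z] contr_in[OF Y]
  have bd: "nrm (sqrt_iter Z (Suc n) x) \<le> sqrt_bound (Suc n) * nrm x" if x: "x \<in> V" for x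
  proof -
    have "nrm (?Y (?Y x)) \<le> sqrt_bound n * (sqrt_bound n * nrm x)"
      using le[of "?Y x"] le[of x] x mult_left_mono[OF le[of x], of "sqrt_bound n"] sqrt_bound_range[of n] by simp
    moreover have "nrm (Z x + ?Y (?Y x)) \<le> nrm x + nrm (?Y (?Y x))"
      using nrm_triangle[of "Z x" "?Y (?Y x)"] contr_le[OF Z x] x by simp
    moreover have "nrm (sqrt_iter Z (Suc n) x) = (1/2) * nrm (Z x + ?Y (?Y x))"
      using nrm_scale[of "Z x + ?Y (?Y x)" "1/2"] x by (simp del: scaleR_add_right)
    ultimately show ?thesis using x
      by (simp add: power2_eq_square algebra_simps del: sqrt_iter.simps)
  qed
  have "sqrt_bound (Suc n) * nrm x \<le> nrm x" if "x \<in> V" for x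
    using sqrt_bound_range[of "Suc n"] nrm_nonneg[OF that] mult_right_mono[of "sqrt_bound (Suc n)" 1 "nrm x"] by simp
  with bd have "nrm (sqrt_iter Z (Suc n) x) \<le> nrm x" if "x \<in> V" for x using that by fastforce
  then have "contr (sqrt_iter Z (Suc n))"
    by (auto simp: contr_def contr_add[OF Z] contr_add[OF Y] contr_scale[OF Z] contr_scale[OF Y] algebra_simps)
  with bd show ?case by blast
qed (simp add: contr_def)

text \<open>
  The square root of \<open>1 - Z\<close> is \<open>1 - Y\<close> for the solution \<open>Y\<close> of \<open>2 Y = Z + Y\<^sup>2\<close>. The iterates of this
  fixed-point equation commute, so their increments are dominated by those of the same iteration
  for the number \<open>1\<close>, which converges.
\<close>

lemma effect_sqrt:
  assumes Z: "effect Z"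
  obtains S where "effect S" "effect (\<lambda>x. x - S x)" "\<And>x. x \<in> V \<Longrightarrow> S (S x) = x - Z x"
    "\<And>C. contr C \<Longrightarrow> commute C Z \<Longrightarrow> commute C S"
proof -
  have cZ: "contr Z" and sZ: "symm Z" and pZ: "posi Z" using Z by (auto simp: effect_def)
  let ?Y = "sqrt_iter Z"
  let ?b = sqrt_bound
  have cY: "contr (?Y n)" and bY: "\<And>x. x \<in> V \<Longrightarrow> nrm (?Y n x) \<le> ?b n * nrm x" for n
    using sqrt_iter_props[OF cZ] by auto
  note [simp] = contr_in[OF cZ] contr_in[OF cY]
  have comm: "commute C (?Y n)" if "contr C" "commute C Z" for C n
    by (rule sqrt_iter_commute[OF cZ that cY])
  have commYZ: "commute (?Y n) Z" for n
    by (rule commute_sym, rule comm) (auto simp: cZ commute_def)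
  have commYY: "?Y m (?Y n x) = ?Y n (?Y m x)" if "x \<in> V" for m n x
    by (rule commuteD[OF comm[OF cY commYZ] that])
  have symY: "symm (?Y n)" for n
  proof (induction n)
    case (Suc n)
    show ?case unfolding symm_def
    proof (intro ballI)
      fix x y assume [simp]: "x \<in> V" "y \<in> V"
      show "ip (?Y (Suc n) x) y = ip x (?Y (Suc n) y)"
        using symmD[OF sZ, of x y] symmD[OF Suc, of "?Y n x" y] symmD[OF Suc, of x "?Y n y"]
        by (simp add: ip_simps)
    qed
  qed (simp add: symm_def)
  have step: "nrm (?Y (Suc n) x - ?Y n x) \<le> (?b (Suc n) - ?b n) * nrm x" if "x \<in> V" for n x
    using that
  proof (induction n arbitrary: x)
    case 0
    then show ?case using contr_le[OF cZ, of x] by (simp add: nrm_scale)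
  next
    case (Suc n)
    note x [simp] = Suc.prems
    let ?d = "?Y (Suc n) x - ?Y n x"
    have d [simp]: "?d \<in> V" by (intro V_diff contr_in[OF cY] x)
    have "?Y (Suc n) (?Y (Suc n) x) - ?Y n (?Y n x) = ?Y (Suc n) ?d + ?Y n ?d"
      using commYY[OF x, of "Suc n" n]
      by (simp add: contr_diff[OF cY] contr_in[OF cY] del: sqrt_iter.simps)
    moreover have "nrm (?Y (Suc n) ?d) \<le> ?b (Suc n) * nrm ?d" "nrm (?Y n ?d) \<le> ?b n * nrm ?d"
      by (rule bY, rule d)+
    moreover have "nrm (?Y (Suc n) ?d + ?Y n ?d) \<le> nrm (?Y (Suc n) ?d) + nrm (?Y n ?d)"
      by (intro nrm_triangle contr_in[OF cY] d)
    ultimately have "nrm (?Y (Suc n) (?Y (Suc n) x) - ?Y n (?Y n x)) \<le> (?b (Suc n) + ?b n) * nrm ?d"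
      by (simp add: distrib_right del: sqrt_iter.simps sqrt_bound.simps)
    also have "\<dots> \<le> (?b (Suc n) + ?b n) * ((?b (Suc n) - ?b n) * nrm x)"
      using sqrt_bound_range[of n] sqrt_bound_range[of "Suc n"] Suc.IH[OF x]
      by (intro mult_left_mono) auto
    finally have *: "nrm (?Y (Suc n) (?Y (Suc n) x) - ?Y n (?Y n x)) \<le> ((?b (Suc n))\<^sup>2 - (?b n)\<^sup>2) * nrm x"
      by (simp add: power2_eq_square algebra_simps del: sqrt_iter.simps sqrt_bound.simps)
    have "?Y (Suc (Suc n)) x - ?Y (Suc n) x = (1/2) *\<^sub>R (?Y (Suc n) (?Y (Suc n) x) - ?Y n (?Y n x))"
      by (simp add: scaleR_diff_right[symmetric] del: scaleR_diff_right)
    then have "nrm (?Y (Suc (Suc n)) x - ?Y (Suc n) x) = (1/2) * nrm (?Y (Suc n) (?Y (Suc n) x) - ?Y n (?Y n x))"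
      using nrm_scale[of "?Y (Suc n) (?Y (Suc n) x) - ?Y n (?Y n x)" "1/2"] contr_in[OF cY] x
      by (simp del: sqrt_iter.simps)
    also have "\<dots> \<le> (1/2) * (((?b (Suc n))\<^sup>2 - (?b n)\<^sup>2) * nrm x)" using * by simp
    also have "\<dots> = (?b (Suc (Suc n)) - ?b (Suc n)) * nrm x"
      unfolding sqrt_bound.simps(2)[of "Suc n"] sqrt_bound.simps(2)[of n]
      by (simp add: field_simps)
    finally show ?case .
  qed
  have tele: "nrm (?Y (n + k) x - ?Y n x) \<le> (?b (n + k) - ?b n) * nrm x" if "x \<in> V" for n k x
  proof (induction k)
    case (Suc k)
    have "?Y (n + Suc k) x - ?Y n x = (?Y (Suc (n + k)) x - ?Y (n + k) x) + (?Y (n + k) x - ?Y n x)"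
      by (simp del: sqrt_iter.simps)
    then have "nrm (?Y (n + Suc k) x - ?Y n x) \<le> nrm (?Y (Suc (n + k)) x - ?Y (n + k) x) + nrm (?Y (n + k) x - ?Y n x)"
      using nrm_triangle[of "?Y (Suc (n + k)) x - ?Y (n + k) x" "?Y (n + k) x - ?Y n x"] contr_in[OF cY] that
      by (simp del: sqrt_iter.simps)
    then show ?case using Suc step[OF that, of "n + k"]
      by (simp add: algebra_simps del: sqrt_iter.simps sqrt_bound.simps)
  qed simp
  have "\<exists>l. conv (\<lambda>n. ?Y n x) l" if x: "x \<in> V" for x
  proof (rule Cauchy_conv)
    fix \<epsilon> :: real assume e: "\<epsilon> > 0"
    then obtain N where N: "\<forall>m\<ge>N. \<forall>n\<ge>N. \<bar>?b m - ?b n\<bar> < \<epsilon> / (nrm x + 1)"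
      using sqrt_bound_Cauchy[of "\<epsilon> / (nrm x + 1)"] nrm_nonneg[OF x] by auto
    have lt: "nrm (?Y m x - ?Y n x) < \<epsilon>" if "N \<le> n" "n \<le> m" for m n
    proof -
      have "nrm (?Y m x - ?Y n x) \<le> (?b m - ?b n) * nrm x" using tele[OF x, of n "m - n"] that by simp
      also have "\<dots> \<le> \<epsilon> / (nrm x + 1) * nrm x"
        using N that nrm_nonneg[OF x] by (intro mult_right_mono) (auto simp: abs_less_iff intro: less_imp_le)
      also have "\<dots> < \<epsilon>" using e nrm_nonneg[OF x] by (simp add: field_simps)
      finally show ?thesis .
    qed
    have "nrm (?Y m x - ?Y n x) < \<epsilon>" if "m \<ge> N" "n \<ge> N" for m n
      using lt[of n m] lt[of m n] that nrm_minus_commute[of "?Y m x" "?Y n x"] x by (cases "n \<le> m") auto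
    then show "\<exists>N. \<forall>m\<ge>N. \<forall>n\<ge>N. nrm (?Y m x - ?Y n x) < \<epsilon>" by blast
  qed (use x in simp)
  then obtain Y where Y: "\<And>x. x \<in> V \<Longrightarrow> conv (\<lambda>n. ?Y n x) (Y x)" by metis
  have YV [simp]: "Y x \<in> V" if "x \<in> V" for x using Y[OF that] conv_in by blast
  have nrm_lim: "nrm l \<le> K" if "conv s l" "\<And>n. nrm (s n) \<le> K" "0 \<le> K" for s l K
  proof -
    have "ip l l \<le> K\<^sup>2"
    proof (rule LIMSEQ_le_const2[OF conv_ip[OF that(1,1)]])
      have "ip (s n) (s n) \<le> K\<^sup>2" for n
        using that(2)[of n] conv_in(1)[OF that(1), of n] power_mono[OF that(2)[of n], of 2] by (simp add: nrm_sq)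
      then show "\<exists>N. \<forall>n\<ge>N. ip (s n) (s n) \<le> K\<^sup>2" by blast
    qed
    then have "sqrt (ip l l) \<le> sqrt (K\<^sup>2)" by (rule real_sqrt_le_mono)
    then show ?thesis using that(3) by (simp add: nrm_def)
  qed
  have contrY: "contr Y" unfolding contr_def
  proof (intro conjI ballI allI)
    fix x y :: 'a and r :: real assume x: "x \<in> V"
    show "Y x \<in> V" using x by simp
    show "nrm (Y x) \<le> nrm x" by (rule nrm_lim[OF Y[OF x] contr_le[OF cY x] nrm_nonneg[OF x]])
    show "Y (r *\<^sub>R x) = r *\<^sub>R Y x"
      using conv_unique[OF Y[of "r *\<^sub>R x"]] conv_combine[OF Y[OF x] Y[OF x], of r 0] x
      by (simp add: contr_scale[OF cY])
    assume y: "y \<in> V"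
    show "Y (x + y) = Y x + Y y"
      using conv_unique[OF Y[of "x + y"]] conv_combine[OF Y[OF x] Y[OF y], of 1 1] x y
      by (simp add: contr_add[OF cY])
  qed
  have symmY: "symm Y" unfolding symm_def
  proof (intro ballI)
    fix x y assume x: "x \<in> V" and y: "y \<in> V"
    have "(\<lambda>n. ip (?Y n x) y) \<longlonglongrightarrow> ip (Y x) y" by (intro conv_ip Y conv_const' x y)
    moreover have "(\<lambda>n. ip x (?Y n y)) \<longlonglongrightarrow> ip x (Y y)" by (intro conv_ip Y conv_const' x y)
    ultimately show "ip (Y x) y = ip x (Y y)" using symmD[OF symY x y] LIMSEQ_unique by auto
  qed
  have commY: "commute C Y" if C: "contr C" "commute C Z" for C
    unfolding commute_def
  proof
    fix x assume x: "x \<in> V"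
    have "conv (\<lambda>n. C (?Y n x)) (C (Y x))" by (rule contr_conv[OF C(1) Y[OF x]])
    moreover have "C (?Y n x) = ?Y n (C x)" for n by (rule commuteD[OF comm[OF C] x])
    ultimately show "C (Y x) = Y (C x)" using conv_unique Y[OF contr_in[OF C(1) x]] by simp
  qed
  have fix_eq: "Y x = (1/2) *\<^sub>R (Z x + Y (Y x))" if x: "x \<in> V" for x
  proof -
    have "conv (\<lambda>n. ?Y n (Y x) + (?Y n (?Y n x) - ?Y n (Y x))) (Y (Y x) + 0)"
    proof (rule conv_combine[where a = 1 and b = 1, simplified])
      show "conv (\<lambda>n. ?Y n (Y x)) (Y (Y x))" using Y x by simp
      have lim: "(\<lambda>n. nrm (?Y n x - Y x)) \<longlonglongrightarrow> 0" using Y[OF x] by (simp add: conv_def)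
      have "nrm (?Y n (?Y n x) - ?Y n (Y x)) \<le> nrm (?Y n x - Y x)" for n
        using contr_le[OF cY, of "?Y n x - Y x" n] x by (simp add: contr_diff[OF cY])
      then show "conv (\<lambda>n. ?Y n (?Y n x) - ?Y n (Y x)) 0" unfolding conv_def
        using x by (auto intro!: Lim_null_comparison[OF always_eventually lim])
    qed
    then have "conv (\<lambda>n. ?Y n (?Y n x)) (Y (Y x))" by simp
    from conv_combine[OF conv_const'[of "Z x"] this, of "1/2" "1/2"]
    have "conv (\<lambda>n. ?Y (Suc n) x) ((1/2) *\<^sub>R (Z x + Y (Y x)))"
      using x by (simp add: scaleR_add_right)
    moreover have "conv (\<lambda>n. ?Y (Suc n) x) (Y x)"
      using Y[OF x] unfolding conv_def by (auto simp del: sqrt_iter.simps intro: LIMSEQ_Suc)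
    ultimately show ?thesis using conv_unique by blast
  qed
  have posY: "posi Y" unfolding posi_def
  proof
    fix x assume x: "x \<in> V"
    have "ip (Y x) x = (1/2) * (ip (Z x) x + ip (Y (Y x)) x)"
      by (subst fix_eq[OF x]) (use x in \<open>simp add: ip_simps\<close>)
    then show "0 \<le> ip (Y x) x"
      using posiD[OF pZ x] symmD[OF symmY, of "Y x" x] ip_nonneg[of "Y x"] x by simp
  qed
  define S where "S x = x - Y x" for x
  have S2: "S (S x) = x - Z x" if x: "x \<in> V" for x
  proof -
    have "S (S x) = x - 2 *\<^sub>R Y x + Y (Y x)"
      using x by (simp add: S_def contr_diff[OF contrY] scaleR_2)
    also have "2 *\<^sub>R Y x = Z x + Y (Y x)" by (subst fix_eq[OF x]) simp
    finally show ?thesis by simp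
  qed
  have symmS: "symm S" using symmD[OF symmY] by (auto simp: symm_def S_def ip_simps)
  have SV [simp]: "S x \<in> V" if "x \<in> V" for x using that by (simp add: S_def)
  have effY: "effect Y" using contrY symmY posY by (simp add: effect_def)
  have "posi S" unfolding posi_def
  proof
    fix x assume x: "x \<in> V"
    have "ip (Y x) x \<le> nrm (Y x) * nrm x" using Cauchy_Schwarz[of "Y x" x] x by simp
    also have "\<dots> \<le> nrm x * nrm x" using contr_le[OF contrY x] x by (intro mult_right_mono) auto
    finally show "0 \<le> ip (S x) x" using x nrm_sq[OF x] by (simp add: S_def ip_simps power2_eq_square)
  qed
  moreover have "contr S"
  proof -
    have "nrm (S x) \<le> nrm x" if x: "x \<in> V" for x
    proof -
      have "ip (S x) (S x) = ip x x - ip (Z x) x"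
        using symmD[OF symmS, of "S x" x] S2[OF x] x by (simp add: ip_simps)
      then have "sqrt (ip (S x) (S x)) \<le> sqrt (ip x x)" using posiD[OF pZ x] by (intro real_sqrt_le_mono) simp
      then show ?thesis by (simp add: nrm_def)
    qed
    then show ?thesis
      by (auto simp: contr_def) (auto simp: S_def contr_add[OF contrY] contr_scale[OF contrY] algebra_simps)
  qed
  ultimately have "effect S" using symmS by (simp add: effect_def)
  moreover have "effect (\<lambda>x. x - S x)" using effY by (simp add: S_def[abs_def])
  moreover have "commute C S" if C: "contr C" "commute C Z" for C
    using commuteD[OF commY[OF C]] contr_diff[OF C(1)] by (auto simp: commute_def S_def)
  ultimately show ?thesis using S2 that by blast
qed

text \<open>
  The Cauchy--Schwarz inequality for the form \<open>\<langle>X u, v\<rangle>\<close>, with \<open>v = X y\<close>.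
\<close>

lemma posi_null:
  assumes X: "contr X" "symm X" "posi X" and y: "y \<in> V" "ip (X y) y = 0"
  shows "X y = 0"
proof -
  have "(ip (X y) (X y))\<^sup>2 \<le> ip (X y) y * ip (X (X y)) (X y)"
  proof (rule positive_form_Cauchy_Schwarz[where q = "\<lambda>u v. ip (X u) v"])
    fix u v assume "u \<in> V" "v \<in> V"
    then show "ip (X u) v = ip (X v) u" using symmD[OF X(2), of u v] ip_sym[of u "X v"] contr_in[OF X(1)] by simp
  qed (use X y contr_in[OF X(1)] in \<open>auto simp: contr_add contr_scale ip_simps posiD\<close>)
  then show ?thesis using y contr_in[OF X(1)] by (auto intro: ip_definite)
qed

text \<open>
  If \<open>X\<^sup>2 = W\<^sup>2\<close> and \<open>X W = W X\<close>, then \<open>(X + W) y = 0\<close> for \<open>y = (X - W) x\<close>. By positivity \<open>X y\<close> and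
  \<open>W y\<close> both vanish, and \<open>\<langle>y, y\<rangle> = \<langle>(X - W) y, x\<rangle> = 0\<close>.
\<close>

lemma positive_sqrt_unique:
  assumes X: "contr X" "symm X" "posi X" and W: "contr W" "symm W" "posi W"
    and comm: "commute X W" and eq: "\<And>x. x \<in> V \<Longrightarrow> X (X x) = W (W x)" and x: "x \<in> V"
  shows "X x = W x"
proof -
  note [simp] = contr_in[OF X(1)] contr_in[OF W(1)] x
  define y where "y = X x - W x"
  have y [simp]: "y \<in> V" by (simp add: y_def)
  have "X y + W y = 0"
    using eq[OF x] commuteD[OF comm x] by (simp add: y_def contr_diff[OF X(1)] contr_diff[OF W(1)])
  then have "ip (X y) y + ip (W y) y = 0" by (metis ip_add ip_zero(1) y \<open>\<And>x. x \<in> V \<Longrightarrow> X x \<in> V\<close> \<open>\<And>x. x \<in> V \<Longrightarrow> W x \<in> V\<close>)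
  then have "ip (X y) y = 0" "ip (W y) y = 0" using posiD[OF X(3) y] posiD[OF W(3) y] by auto
  then have "X y = 0" "W y = 0" using posi_null[OF X y] posi_null[OF W y] by auto
  moreover have "ip y y = ip (X y - W y) x"
    using symmD[OF X(2), of y x] symmD[OF W(2), of y x]
    by (subst (2) y_def) (simp add: ip_simps)
  ultimately have "y = 0" using ip_definite[OF y] by simp
  then show ?thesis by (simp add: y_def)
qed

text \<open>
  \<open>T S = Q T Q\<close> for the square root \<open>Q\<close> of \<open>S\<close>, which commutes with \<open>T\<close>.
\<close>

lemma commuting_effects_posi:
  assumes T: "effect T" and S: "effect S" "effect (\<lambda>x. x - S x)" and TS: "commute T S"
  shows "posi (\<lambda>x. T (S x))"
proof -
  have cT: "contr T" and cS: "contr S" using T S by (auto simp: effect_def)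
  obtain Q where Q: "effect Q" "\<And>x. x \<in> V \<Longrightarrow> Q (Q x) = x - (x - S x)"
      "\<And>C. contr C \<Longrightarrow> commute C (\<lambda>x. x - S x) \<Longrightarrow> commute C Q"
    by (rule effect_sqrt[OF S(2)]) blast
  have "commute T Q"
    using commuteD[OF TS] by (intro Q(3) cT) (simp add: commute_def contr_diff[OF cT] contr_in[OF cS])
  moreover have cQ: "contr Q" "symm Q" using Q by (auto simp: effect_def)
  ultimately show ?thesis unfolding posi_def
  proof (intro ballI)
    fix x assume x: "x \<in> V"
    have "T (S x) = Q (T (Q x))"
      using Q(2)[OF x] commuteD[OF \<open>commute T Q\<close>, of "Q x"] contr_in[OF cQ(1) x] by simp
    then have "ip (T (S x)) x = ip (T (Q x)) (Q x)"
      using symmD[OF cQ(2), of "T (Q x)" x] contr_in[OF cQ(1)] contr_in[OF cT] x by simp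
    then show "0 \<le> ip (T (S x)) x" using posiD[of T "Q x"] T contr_in[OF cQ(1) x] by (simp add: effect_def)
  qed
qed

text \<open>A self-adjoint graph is single-valued, because its domain is dense.\<close>

lemma sa_functional:
  assumes B: "sa B" and uf: "(u, f) \<in> B" "(u, g) \<in> B"
  shows "f = g"
proof -
  have [simp]: "u \<in> V" "f \<in> V" "g \<in> V" using uf sa_in[OF B] by auto
  have 0: "(0, f - g) \<in> B" using subspace_rel(2)[OF sa_subspace[OF B] uf] by simp
  have "ip (f - g) x = 0" if "x \<in> Domain B" for x
    using that sa_symmetric[OF B 0] sa_in[OF B] by auto
  then have "ip (f - g) (f - g) = 0"
    using B dense_dom_iff[OF sa_subspace[OF B] sa_sub[OF B]] by (simp add: sa_def)
  then show ?thesis using ip_definite[of "f - g"] by simp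
qed

text \<open>
  The range of \<open>1 + A\<close> is closed because \<open>\<parallel>u\<parallel>\<close> and \<open>\<parallel>f\<parallel>\<close> are bounded by \<open>\<parallel>u + f\<parallel>\<close> for \<open>(u, f) \<in> A\<close>. A
  vector \<open>z\<close> orthogonal to it satisfies \<open>A z = - z\<close>, hence \<open>z = 0\<close> by positivity.
\<close>

lemma one_plus_onto:
  assumes A: "sa A" "nn A" and h: "h \<in> V"
  shows "\<exists>u. (u, h - u) \<in> A"
proof -
  define M where "M = (\<lambda>x. fst x + snd x) ` A"
  have lin: "linear (\<lambda>x :: 'a \<times> 'a. fst x + snd x)"
    by (intro linear_compose_add linear_fst linear_snd)
  have M: "subspace M" unfolding M_def by (rule linear_subspace_image[OF lin sa_subspace[OF A(1)]])
  have MV: "M \<subseteq> V" using sa_in[OF A(1)] by (auto simp: M_def)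
  obtain s l where s: "\<And>n. s n \<in> M" "conv s l" "\<And>z. z \<in> M \<Longrightarrow> ip (h - l) z = 0"
    by (rule orthogonal_projection[OF M MV h]) blast
  have "\<forall>n. \<exists>u f. (u, f) \<in> A \<and> s n = u + f" using s(1) by (force simp: M_def)
  then obtain u f where uf: "\<And>n. (u n, f n) \<in> A" "\<And>n. s n = u n + f n" by metis
  have [simp]: "u n \<in> V" "f n \<in> V" for n using sa_in[OF A(1) uf(1)] by auto
  have le: "nrm (u m - u n) \<le> nrm (s m - s n)" "nrm (f m - f n) \<le> nrm (s m - s n)" for m n
  proof -
    have p: "(u m - u n, f m - f n) \<in> A" by (rule subspace_rel(2)[OF sa_subspace[OF A(1)] uf(1) uf(1)])
    then have p: "0 \<le> ip (f m - f n) (u m - u n)" using A(2) by (auto simp: nn_def)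
    have "s m - s n = (u m - u n) + (f m - f n)" using uf(2) by simp
    moreover have "ip ((u m - u n) + (f m - f n)) ((u m - u n) + (f m - f n))
      = ip (u m - u n) (u m - u n) + 2 * ip (f m - f n) (u m - u n) + ip (f m - f n) (f m - f n)"
      using ip_sym[of "f m - f n" "u m - u n"] by (simp only: ip_add ip_add_right V_add V_diff \<open>\<And>n. u n \<in> V\<close> \<open>\<And>n. f n \<in> V\<close>)
    moreover have "0 \<le> ip (u m - u n) (u m - u n)" "0 \<le> ip (f m - f n) (f m - f n)" by (auto intro: ip_nonneg)
    ultimately show "nrm (u m - u n) \<le> nrm (s m - s n)" "nrm (f m - f n) \<le> nrm (s m - s n)"
      using p by (auto simp: nrm_def)
  qed
  have C: "\<exists>N. \<forall>m\<ge>N. \<forall>n\<ge>N. nrm (u m - u n) < \<epsilon>" "\<exists>N. \<forall>m\<ge>N. \<forall>n\<ge>N. nrm (f m - f n) < \<epsilon>"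
    if "\<epsilon> > 0" for \<epsilon>
    using conv_Cauchy[OF s(2) that] le by (meson order_le_less_trans)+
  obtain v g where v: "conv u v" and g: "conv f g"
    using Cauchy_conv[of u] Cauchy_conv[of f] C by auto
  have vg: "(v, g) \<in> A" by (rule closed_relD[OF sa_closed[OF A(1)] uf(1) v g])
  have "s = (\<lambda>n. u n + f n)" using uf(2) by (rule ext)
  then have "conv s (v + g)" using conv_combine[OF v g, of 1 1] by simp
  then have l: "l = v + g" using conv_unique s(2) by blast
  have [simp]: "v \<in> V" "g \<in> V" using v g conv_in by auto
  let ?z = "h - l"
  have z: "?z \<in> V" using h l by simp
  have "(?z, - ?z) \<in> adj A" unfolding adj_def
  proof (clarsimp, intro conjI)
    show "h - l \<in> V" "l - h \<in> V" using h l by auto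
    show "\<forall>x\<in>A. case x of (u, f) \<Rightarrow> ip f (h - l) = ip u (l - h)"
    proof clarify
      fix u f assume uf: "(u, f) \<in> A"
      have [simp]: "u \<in> V" "f \<in> V" using sa_in[OF A(1) uf] by auto
      have "u + f \<in> M" using uf by (force simp: M_def)
      then have "ip ?z (u + f) = 0" using s(3) by blast
      then show "ip f (h - l) = ip u (l - h)"
        using z h l ip_sym[of f "h - l"] ip_sym[of u "h - l"] ip_neg_right[of "h - l" u]
        by (simp add: ip_add_right)
    qed
  qed
  then have "(?z, - ?z) \<in> A" using A(1) by (simp add: sa_def)
  then have "0 \<le> ip (- ?z) ?z" using A(2) unfolding nn_def by blast
  then have "ip ?z ?z = 0" using ip_nonneg[OF z] ip_neg[OF z z] by simp
  then have "h = v + g" using ip_definite[OF z] l by simp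
  with vg show ?thesis by (intro exI[of _ v]) simp
qed

lemma dense_seq:
  assumes "dense_dom A" "Domain A \<subseteq> V" "h \<in> V"
  obtains s where "\<And>n. s n \<in> Domain A" "conv s h"
proof -
  have "\<forall>n::nat. \<exists>u\<in>Domain A. nrm (h - u) < 1 / Suc n" using assms(1,3) by (simp add: dense_dom_def)
  then obtain s where s: "\<And>n. s n \<in> Domain A" "\<And>n. nrm (h - s n) < 1 / Suc n" by metis
  have sV: "s n \<in> V" for n using s(1) assms(2) by blast
  have "nrm (s n - h) \<le> 1 / Suc n" for n
    using s(2)[of n] nrm_minus_commute[OF sV assms(3), of n] by simp
  moreover have "(\<lambda>n. 1 / real (Suc n)) \<longlonglongrightarrow> 0"
    using LIMSEQ_inverse_real_of_nat by (simp add: inverse_eq_divide)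
  ultimately have "(\<lambda>n. nrm (s n - h)) \<longlonglongrightarrow> 0"
    by (intro Lim_null_comparison[of "\<lambda>n. nrm (s n - h)", OF always_eventually]) (use sV assms(3) in auto)
  then have "conv s h" using sV assms(3) by (simp add: conv_def)
  with s(1) that show ?thesis by blast
qed

section \<open>Square roots of positive self-adjoint operators\<close>

text \<open>
  Let \<open>R = (1 + A)\<^bsup>-1\<^esup>\<close> and \<open>Z = 1 - R\<close>, so that \<open>A\<close> is the graph of all \<open>(R x, Z x)\<close>. With \<open>S\<^sup>2 = R\<close> and
  \<open>T\<^sup>2 = Z\<close>, the identity \<open>S\<^sup>2 + T\<^sup>2 = 1\<close> makes \<open>h \<mapsto> (S h, T h)\<close> an isometry, which inverts as
  \<open>h = S v + T g\<close>; this gives at once that the graph \<open>B\<close> of all \<open>(S h, T h)\<close> is self-adjoint and that its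
  square is \<open>A\<close>.

  If \<open>B'\<close> is another square root, then \<open>W = B' R\<close> is a bounded positive operator that commutes with \<open>R\<close>
  and satisfies \<open>W\<^sup>2 = R Z = (T S)\<^sup>2\<close>. Hence \<open>W = T S\<close>, so that \<open>B'\<close> contains \<open>(S h, T h)\<close> for \<open>h\<close> in the
  range of \<open>S\<close>, which is dense; then \<open>B \<subseteq> B'\<close>, and self-adjoint operators have no proper self-adjoint
  extension.
\<close>

proposition positive_sa_sqrt:
  assumes A: "sa A" "nn A"
  shows "\<exists>!B. sa B \<and> nn B \<and> B O B = A"
proof -
  have fun_A: "u = v" if "(u, x - u) \<in> A" "(v, x - v) \<in> A" for u v x
  proof -
    have uv: "u - v \<in> V" using that sa_in[OF A(1)] by blast
    have "(u - v, - (u - v)) \<in> A" using subspace_rel(2)[OF sa_subspace[OF A(1)] that] by (simp add: algebra_simps)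
    then have "0 \<le> ip (- (u - v)) (u - v)" using A(2) unfolding nn_def by blast
    then have "ip (u - v) (u - v) = 0" using ip_nonneg[OF uv] ip_neg[OF uv uv] by simp
    then show "u = v" using ip_definite[OF uv] by simp
  qed
  define R where "R x = (THE u. (u, x - u) \<in> A)" for x
  define Z where "Z x = x - R x" for x
  have RA: "(R x, Z x) \<in> A" if x: "x \<in> V" for x
  proof -
    obtain u where u: "(u, x - u) \<in> A" using one_plus_onto[OF A x] by blast
    then have "R x = u" unfolding R_def using fun_A by blast
    with u show ?thesis by (simp add: Z_def)
  qed
  have Req: "R x = u" if "(u, x - u) \<in> A" for x u
    unfolding R_def using that fun_A by blast
  have Req': "R (u + f) = u" "Z (u + f) = f" if "(u, f) \<in> A" for u f
    using Req[of u "u + f"] that by (auto simp: Z_def)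
  have [simp]: "R x \<in> V" "Z x \<in> V" if "x \<in> V" for x using RA[OF that] sa_in[OF A(1)] by auto
  have RZ: "R x + Z x = x" for x by (simp add: Z_def)
  have R_add: "R (x + y) = R x + R y" if "x \<in> V" "y \<in> V" for x y
    by (rule Req) (use subspace_rel(1)[OF sa_subspace[OF A(1)] RA[OF that(1)] RA[OF that(2)]] in
      \<open>simp add: Z_def algebra_simps\<close>)
  have R_scale: "R (r *\<^sub>R x) = r *\<^sub>R R x" if "x \<in> V" for x r
    by (rule Req) (use subspace_rel(3)[OF sa_subspace[OF A(1)] RA[OF that] RA[OF that], of r] in
      \<open>simp add: Z_def algebra_simps\<close>)
  have RZ_pos: "0 \<le> ip (Z x) (R x)" if "x \<in> V" for x using RA[OF that] A(2) unfolding nn_def by blast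
  have nrm_split: "ip x x = ip (R x) (R x) + 2 * ip (Z x) (R x) + ip (Z x) (Z x)" if "x \<in> V" for x
  proof -
    have "ip x x = ip (R x + Z x) (R x + Z x)" by (simp add: RZ)
    then show ?thesis using that ip_sym[of "R x" "Z x"] by (simp add: ip_add ip_add_right)
  qed
  have symR: "symm R" unfolding symm_def
  proof (intro ballI)
    fix x y assume [simp]: "x \<in> V" "y \<in> V"
    have "ip (R x) (R y + Z y) = ip (R x + Z x) (R y)"
      using sa_symmetric[OF A(1) RA[of x] RA[of y]] by (simp add: ip_add ip_add_right)
    then show "ip (R x) y = ip x (R y)" by (simp add: RZ)
  qed
  have le: "nrm (R x) \<le> nrm x" "nrm (Z x) \<le> nrm x" if "x \<in> V" for x
    using nrm_split[OF that] RZ_pos[OF that] ip_nonneg[of "R x"] ip_nonneg[of "Z x"] that by (auto simp: nrm_def)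
  have cR: "contr R" using le R_add R_scale by (auto simp: contr_def)
  have cZ: "contr Z" unfolding contr_def using le
    by (auto simp: Z_def R_add R_scale algebra_simps)
  have symZ: "symm Z" using symmD[OF symR] by (auto simp: symm_def Z_def ip_simps)
  have posR: "posi R" unfolding posi_def
  proof
    fix x assume [simp]: "x \<in> V"
    have "ip (R x) (R x + Z x) = ip (R x) (R x) + ip (Z x) (R x)"
      using ip_sym[of "R x" "Z x"] by (simp add: ip_add_right)
    then show "0 \<le> ip (R x) x" using RZ_pos[of x] ip_nonneg[of "R x"] by (simp add: RZ)
  qed
  have posZ: "posi Z" unfolding posi_def
  proof
    fix x assume [simp]: "x \<in> V"
    have "ip (Z x) (R x + Z x) = ip (Z x) (R x) + ip (Z x) (Z x)" by (simp add: ip_add_right)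
    then show "0 \<le> ip (Z x) x" using RZ_pos[of x] ip_nonneg[of "Z x"] by (simp add: RZ)
  qed
  have eR: "effect R" and eZ: "effect Z" using cR cZ symR symZ posR posZ by (auto simp: effect_def)
  obtain S where S: "effect S" "effect (\<lambda>x. x - S x)" "\<And>x. x \<in> V \<Longrightarrow> S (S x) = x - Z x"
    and S_comm: "\<And>C. contr C \<Longrightarrow> commute C Z \<Longrightarrow> commute C S" by (rule effect_sqrt[OF eZ]) blast
  obtain T where T: "effect T" "effect (\<lambda>x. x - T x)" "\<And>x. x \<in> V \<Longrightarrow> T (T x) = x - R x"
    and T_comm: "\<And>C. contr C \<Longrightarrow> commute C R \<Longrightarrow> commute C T" by (rule effect_sqrt[OF eR]) blast
  have SS: "S (S x) = R x" and TT: "T (T x) = Z x" if "x \<in> V" for x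
    using S(3)[OF that] T(3)[OF that] by (auto simp: Z_def)
  have cS: "contr S" "symm S" and cT: "contr T" "symm T" using S T by (auto simp: effect_def)
  note [simp] = contr_in[OF cS(1)] contr_in[OF cT(1)]
  have SR: "commute S R" unfolding commute_def using SS by (metis contr_in[OF cS(1)])
  have ST: "commute S T" by (rule T_comm[OF cS(1) SR])
  have ST': "S (T x) = T (S x)" if "x \<in> V" for x by (rule commuteD[OF ST that])
  define B where "B = {(S h, T h) | h. h \<in> V}"
  have BI: "(S h, T h) \<in> B" if "h \<in> V" for h using that by (auto simp: B_def)
  have BV: "B \<subseteq> V \<times> V" by (auto simp: B_def)
  have AB: "B O B = A"
  proof
    show "A \<subseteq> B O B"
    proof safe
      fix u f assume uf: "(u, f) \<in> A"
      let ?h = "u + f"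
      have h: "?h \<in> V" using sa_in[OF A(1) uf] by simp
      have "(S (S ?h), T (S ?h)) \<in> B" "(S (T ?h), T (T ?h)) \<in> B" using h by (auto intro!: BI)
      then show "(u, f) \<in> B O B" using SS[OF h] TT[OF h] Req'[OF uf] ST'[OF h] by auto
    qed
    show "B O B \<subseteq> A"
    proof (clarsimp simp: B_def)
      fix h k assume h: "h \<in> V" and k: "k \<in> V" and hk: "T h = S k"
      \<comment> \<open>the preimage of \<open>(h, k)\<close> under \<open>g \<mapsto> (S g, T g)\<close>\<close>
      define g where "g = S h + T k"
      have g: "g \<in> V" using h k by (simp add: g_def)
      have "S g = S (S h) + T (T h)" using h k hk by (simp add: g_def contr_add[OF cS(1)] ST')
      then have "S g = h" using h by (simp add: SS TT RZ)
      have "T g = S (S k) + T (T k)" using h k ST'[OF h] by (simp add: g_def contr_add[OF cT(1)] hk[symmetric])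
      then have "T g = k" using k by (simp add: SS TT RZ)
      have "S h = R g" "T k = Z g" using SS[OF g] TT[OF g] \<open>S g = h\<close> \<open>T g = k\<close> by auto
      then show "(S h, T k) \<in> A" using RA[OF g] by simp
    qed
  qed
  have adjB: "adj B = B"
  proof safe
    fix v g assume vg: "(v, g) \<in> adj B"
    have [simp]: "v \<in> V" "g \<in> V" using vg adj_in by auto
    have "T v = S g"
    proof (rule ext_eq)
      fix z assume z: "z \<in> V"
      show "ip (T v) z = ip (S g) z"
        using adjD[OF vg BI[OF z]] symmD[OF cS(2), of g z] symmD[OF cT(2), of v z]
          ip_sym[of "T z" v] ip_sym[of g "S z"] z by simp
    qed simp_all
    let ?h = "S v + T g"
    have "S ?h = S (S v) + T (T v)" using \<open>T v = S g\<close> by (simp add: contr_add[OF cS(1)] ST')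
    then have "S ?h = v" by (simp add: SS TT RZ)
    moreover have "T ?h = S (S g) + T (T g)" using \<open>T v = S g\<close> by (simp add: contr_add[OF cT(1)] ST'[symmetric])
    then have "T ?h = g" by (simp add: SS TT RZ)
    ultimately show "(v, g) \<in> B" using BI[of ?h] by simp
  next
    fix v g assume "(v, g) \<in> B"
    then obtain h where h: "h \<in> V" "v = S h" "g = T h" by (auto simp: B_def)
    have "ip (T k) (S h) = ip (S k) (T h)" if "k \<in> V" for k
      using symmD[OF cT(2), of k "S h"] symmD[OF cS(2), of k "T h"] ST'[OF h(1)] h that by simp
    then show "(v, g) \<in> adj B" using h by (auto simp: adj_def B_def)
  qed
  have "Domain A \<subseteq> Domain B" using AB by blast
  then have "dense_dom B" using A(1) unfolding sa_def dense_dom_def by blast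
  then have saB: "sa B" using adjB by (simp add: sa_def)
  have "nn B" unfolding nn_def
  proof (clarsimp simp: B_def)
    fix h assume h: "h \<in> V"
    have "posi (\<lambda>x. T (S x))" by (rule commuting_effects_posi[OF T(1) S(1,2) commute_sym[OF ST]])
    then have "0 \<le> ip (T (S h)) h" using posiD h by blast
    then show "0 \<le> ip (T h) (S h)" using symmD[OF cS(2), of "T h" h] ST'[OF h] h by simp
  qed
  moreover have "B' = B" if B': "sa B'" "nn B'" "B' O B' = A" for B'
  proof -
    note fB = sa_functional[OF B'(1)]
    have "\<exists>g. (R x, g) \<in> B' \<and> (g, Z x) \<in> B'" if "x \<in> V" for x using RA[OF that] B'(3) by blast
    then obtain W where W: "\<And>x. x \<in> V \<Longrightarrow> (R x, W x) \<in> B'" "\<And>x. x \<in> V \<Longrightarrow> (W x, Z x) \<in> B'" by metis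
    have WV [simp]: "W x \<in> V" if "x \<in> V" for x using W(1)[OF that] sa_in[OF B'(1)] by blast
    note linB = subspace_rel[OF sa_subspace[OF B'(1)]]
    have cW: "contr W" unfolding contr_def
    proof (intro conjI ballI allI)
      fix x y :: 'a and r :: real assume x: "x \<in> V"
      show "W x \<in> V" using x by simp
      have "ip (W x) (W x) = ip (R x) (Z x)" using sa_symmetric[OF B'(1) W(1)[OF x] W(2)[OF x]] .
      also have "\<dots> \<le> nrm (R x) * nrm (Z x)" using Cauchy_Schwarz[of "R x" "Z x"] x by simp
      also have "\<dots> \<le> nrm x * nrm x" using le[OF x] x by (intro mult_mono) auto
      finally have "sqrt (ip (W x) (W x)) \<le> sqrt (ip x x)" using nrm_sq[OF x] by (simp add: power2_eq_square)
      then show "nrm (W x) \<le> nrm x" by (simp add: nrm_def)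
      show "W (r *\<^sub>R x) = r *\<^sub>R W x"
        using fB[OF W(1)[of "r *\<^sub>R x"]] linB(3)[OF W(1)[OF x] W(1)[OF x], of r] x by (simp add: R_scale)
      assume y: "y \<in> V"
      show "W (x + y) = W x + W y"
        using fB[OF W(1)[of "x + y"]] linB(1)[OF W(1)[OF x] W(1)[OF y]] x y by (simp add: R_add)
    qed
    have symW: "symm W" unfolding symm_def
    proof (intro ballI)
      fix x y assume x [simp]: "x \<in> V" and y [simp]: "y \<in> V"
      have "ip (W x) (R y) = ip (R x) (W y)" "ip (Z x) (W y) = ip (W x) (Z y)"
        using sa_symmetric[OF B'(1) W(1)[OF x] W(1)[OF y]] sa_symmetric[OF B'(1) W(2)[OF x] W(2)[OF y]] by auto
      then have "ip (W x) (R y + Z y) = ip (R x + Z x) (W y)" by (simp add: ip_add ip_add_right)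
      then show "ip (W x) y = ip x (W y)" by (simp add: RZ)
    qed
    have posW: "posi W" unfolding posi_def
    proof
      fix x assume x [simp]: "x \<in> V"
      have "0 \<le> ip (W x) (R x)" "0 \<le> ip (Z x) (W x)" using W[OF x] B'(2) unfolding nn_def by blast+
      then have "0 \<le> ip (W x) (R x + Z x)" using ip_sym[of "W x" "Z x"] by (simp add: ip_add_right)
      then show "0 \<le> ip (W x) x" by (simp add: RZ)
    qed
    \<comment> \<open>\<open>R\<close> commutes with \<open>B'\<close>\<close>
    have RB: "(R u, R f) \<in> B'" if uf: "(u, f) \<in> B'" for u f
    proof -
      have u: "u \<in> V" using uf sa_in[OF B'(1)] by blast
      have "(u - R u, f - W u) \<in> B'" by (rule linB(2)[OF uf W(1)[OF u]])
      with W(2)[OF u] have "(W u, f - W u) \<in> A" using B'(3) by (auto simp: Z_def)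
      then have "R f = W u" by (rule Req)
      with W(1)[OF u] show ?thesis by simp
    qed
    have WR: "W (R x) = R (W x)" if x: "x \<in> V" for x
      using fB[OF W(1)[of "R x"] RB[OF W(1)[OF x]]] x by simp
    have WW: "W (W x) = Z (R x)" if x: "x \<in> V" for x
      using fB[OF W(1)[of "W x"]] W(2)[of "R x"] WR[OF x] x by simp
    have cWR: "commute W R" using WR by (simp add: commute_def)
    then have "commute W Z" by (simp add: commute_def Z_def contr_diff[OF cW])
    then have WS: "commute W S" and WT: "commute W T" using S_comm T_comm cW cWR by auto
    have X: "W x = T (S x)" if x: "x \<in> V" for x
    proof (rule positive_sqrt_unique[OF cW symW posW])
      show "contr (\<lambda>x. T (S x))" by (rule contr_comp[OF cT(1) cS(1)])
      show "symm (\<lambda>x. T (S x))" unfolding symm_def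
        using symmD[OF cT(2)] symmD[OF cS(2)] ST' by simp
      show "posi (\<lambda>x. T (S x))" by (rule commuting_effects_posi[OF T(1) S(1,2) commute_sym[OF ST]])
      show "commute W (\<lambda>x. T (S x))" using commuteD[OF WS] commuteD[OF WT] by (simp add: commute_def)
      show "W (W x) = T (S (T (S x)))" if "x \<in> V" for x
        using WW[OF that] TT[of "R x"] SS[OF that] ST'[of "S x"] that by simp
    qed (rule x)
    have "B \<subseteq> B'"
    proof (clarsimp simp: B_def)
      fix h assume h: "h \<in> V"
      have DV: "Domain A \<subseteq> V" using sa_sub[OF A(1)] by auto
      have dA: "dense_dom A" using A(1) by (simp add: sa_def)
      obtain s where s: "\<And>n. s n \<in> Domain A" "conv s h" by (rule dense_seq[OF dA DV h]) blast
      have "(S (s n), T (s n)) \<in> B'" for n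
      proof -
        obtain f where f: "(s n, f) \<in> A" using s(1)[of n] by blast
        define x where "x = s n + f"
        have x: "x \<in> V" using sa_in[OF A(1) f] by (simp add: x_def)
        have sx: "s n = S (S x)" using Req'(1)[OF f] SS[OF x] by (simp add: x_def)
        have "(R (S x), T (S (S x))) \<in> B'" using W(1)[of "S x"] X[of "S x"] x by simp
        then show ?thesis using SS[of "S x"] x sx by simp
      qed
      then show "(S h, T h) \<in> B'"
        by (rule closed_relD[OF sa_closed[OF B'(1)] _ contr_conv[OF cS(1) s(2)] contr_conv[OF cT(1) s(2)]])
    qed
    moreover have "B' \<subseteq> B"
    proof -
      have "adj B' \<subseteq> adj B" using \<open>B \<subseteq> B'\<close> by (auto simp: adj_def)
      then show ?thesis using saB B'(1) by (simp add: sa_def)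
    qed
    ultimately show ?thesis by blast
  qed
  ultimately show ?thesis using saB AB by blast
qed

end

context semi_hilbert
begin

text \<open>
  A linear choice \<open>r\<close> of representatives modulo null vectors. It turns a semi-Hilbert space into a
  Hilbert space on the range of \<open>r\<close>, without passing to a quotient type.
\<close>

lemma null_complement:
  obtains r where "linear r" "\<And>x. x \<in> V \<Longrightarrow> r x \<in> V" "\<And>x. x \<in> V \<Longrightarrow> ip (x - r x) (x - r x) = 0"
    "\<And>x. x \<in> V \<Longrightarrow> ip x x = 0 \<Longrightarrow> r x = 0" "\<And>x. r (r x) = r x"
proof -
  define N where "N = {x \<in> V. ip x x = 0}"
  have N0: "ip x y = 0" if "x \<in> N" "y \<in> V" for x y using that ip_null by (auto simp: N_def)
  have NV: "x \<in> V" if "x \<in> N" for x using that by (simp add: N_def)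
  have "subspace N"
  proof (unfold subspace_def, intro conjI ballI allI)
    show "0 \<in> N" by (simp add: N_def)
    fix x :: 'a and c :: real assume x: "x \<in> N"
    show "c *\<^sub>R x \<in> N" using N0[OF x NV[OF x]] NV[OF x] by (simp add: N_def ip_simps)
    fix y assume y: "y \<in> N"
    show "x + y \<in> N" using N0[OF x NV[OF x]] N0[OF x NV[OF y]] N0[OF y NV[OF x]] N0[OF y NV[OF y]] NV[OF x] NV[OF y]
      by (simp add: N_def ip_simps)
  qed
  then obtain p where p: "range p \<subseteq> N" "linear p" "\<And>v. v \<in> N \<Longrightarrow> p v = v"
    using linear_exists_left_inverse_on[OF linear_id, of N] by auto
  have pN: "p x \<in> N" for x using p(1) by auto
  define r where "r x = x - p x" for x
  have lin: "linear r" unfolding r_def by (intro linear_compose_sub linear_id[unfolded id_def] p(2))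
  show ?thesis
  proof (rule that[OF lin])
    show "r x \<in> V" if "x \<in> V" for x using that NV[OF pN[of x]] by (simp add: r_def)
    show "ip (x - r x) (x - r x) = 0" for x using N0[OF pN NV[OF pN]] by (simp add: r_def)
    show "r x = 0" if "x \<in> V" "ip x x = 0" for x using p(3)[of x] that by (simp add: r_def N_def)
    show "r (r x) = r x" for x
      using p(3)[OF pN[of x]] linear_diff[OF p(2), of x "p x"] by (simp add: r_def)
  qed
qed

text \<open>
  Self-adjoint relations are closed under changing vectors by null vectors, so they correspond
  to self-adjoint relations on the representatives.
\<close>

theorem positive_self_adjoint_sqrt:
  assumes A: "sa A" "nn A"
  shows "\<exists>!B. sa B \<and> nn B \<and> B O B = A"
proof -
  obtain r where r: "linear r" "\<And>x. x \<in> V \<Longrightarrow> r x \<in> V" "\<And>x. x \<in> V \<Longrightarrow> ip (x - r x) (x - r x) = 0"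
    "\<And>x. x \<in> V \<Longrightarrow> ip x x = 0 \<Longrightarrow> r x = 0" "\<And>x. r (r x) = r x" by (rule null_complement) blast
  define W where "W = r ` V"
  have WV: "x \<in> V" if "x \<in> W" for x using that r(2) by (auto simp: W_def)
  have rW: "r x = x" if "x \<in> W" for x using that r(5) by (auto simp: W_def)
  have rI: "r x \<in> W" if "x \<in> V" for x using that by (simp add: W_def)
  have ipr: "ip (r x) y = ip x y" "ip y (r x) = ip y x" if "x \<in> V" "y \<in> V" for x y
  proof -
    have "ip (x - r x) y = 0" by (rule ip_null) (use that r in auto)
    then show 1: "ip (r x) y = ip x y" using that r(2) by (simp add: ip_diff)
    show "ip y (r x) = ip y x" using 1 that r(2) ip_sym[of y x] ip_sym[of y "r x"] by simp
  qed
  interpret W: hilbert W ip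
  proof
    show "subspace W" unfolding W_def by (rule linear_subspace_image[OF r(1) subspace_V])
    show "x = 0" if "x \<in> W" "ip x x = 0" for x using r(4)[of x] rW[OF that(1)] WV that by simp
    fix s :: "nat \<Rightarrow> 'a" assume s: "\<And>n. s n \<in> W"
      and c: "\<And>\<epsilon>. \<epsilon> > 0 \<Longrightarrow> \<exists>N. \<forall>m\<ge>N. \<forall>n\<ge>N. ip (s m - s n) (s m - s n) < \<epsilon>"
    obtain l where l: "l \<in> V" "(\<lambda>n. ip (s n - l) (s n - l)) \<longlonglongrightarrow> 0"
      using ip_complete[OF WV[OF s] c] by blast
    have "ip (s n - r l) (s n - r l) = ip (s n - l) (s n - l)" for n
      using l(1) WV[OF s[of n]] r(2)[OF l(1)] ipr[OF l(1), of "s n"] ipr[OF l(1) l(1)] ipr[OF l(1), of "r l"]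
      by (simp add: ip_simps)
    then show "\<exists>l\<in>W. (\<lambda>n. ip (s n - l) (s n - l)) \<longlonglongrightarrow> 0"
      using l rI[OF l(1)] by (intro bexI[of _ "r l"]) simp_all
  qed (use WV in \<open>auto simp: ip_simps ip_nonneg intro: ip_sym\<close>)
  have nrmr: "nrm (r x) = nrm x" if "x \<in> V" for x
    using ipr[OF that that] ipr(1)[OF that r(2)[OF that]] by (simp add: nrm_def)
  have r_diff: "r (x - y) = r x - r y" for x y by (rule linear_diff[OF r(1)])
  define restr where "restr A = A \<inter> W \<times> W" for A
  define lift where "lift B = {(x, y). x \<in> V \<and> y \<in> V \<and> (r x, r y) \<in> B}" for B
  have saE: "(x, y) \<in> A \<longleftrightarrow> x \<in> V \<and> y \<in> V \<and> (r x, r y) \<in> A" if "sa A" for A x y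
  proof -
    have n: "ip (r x - x) (r x - x) = 0" if "x \<in> V" for x
      using r(3)[OF that] nrm_minus_commute[of x "r x"] r(2)[OF that] that by (simp add: nrm_def)
    show ?thesis
    proof (intro iffI conjI)
      assume xy: "(x, y) \<in> A"
      then show V: "x \<in> V" "y \<in> V" using sa_in[OF that] by auto
      show "(r x, r y) \<in> A" by (rule closed_rel_cong[OF sa_closed[OF that] xy]) (use V r(2,3) in auto)
    next
      assume xy: "x \<in> V \<and> y \<in> V \<and> (r x, r y) \<in> A"
      show "(x, y) \<in> A" by (rule closed_rel_cong[OF sa_closed[OF that], of "r x" "r y"]) (use xy r(2) n in auto)
    qed
  qed
  have saI: "(r x, r y) \<in> restr A" if A: "sa A" and "(x, y) \<in> A" for A x y
    using saE[OF A, of x y] that(2) rI[of x] rI[of y] by (simp add: restr_def)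
  have lift_restr: "lift (restr A) = A" if "sa A" for A
  proof safe
    show "(x, y) \<in> A" if "(x, y) \<in> lift (restr A)" for x y
      using that by (subst saE[OF \<open>sa A\<close>]) (simp add: lift_def restr_def)
    show "(x, y) \<in> lift (restr A)" if "(x, y) \<in> A" for x y
      using saI[OF \<open>sa A\<close> that] sa_in[OF \<open>sa A\<close> that] by (simp add: lift_def)
  qed
  have restr_lift: "restr (lift B) = B" if "B \<subseteq> W \<times> W" for B
    using that WV rW by (auto simp: lift_def restr_def subset_iff)
  have lift_comp: "lift (B O C) = lift B O lift C" if "B \<subseteq> W \<times> W" for B C
  proof -
    have "(r x, z) \<in> B \<Longrightarrow> z \<in> V \<and> r z = z" for x z using that WV rW by auto
    then show ?thesis by (fastforce simp: lift_def relcomp_unfold)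
  qed
  have sa_lift: "sa (lift B)" if B: "W.sa B" for B
    unfolding sa_def
  proof
    show "dense_dom (lift B)" unfolding dense_dom_def
    proof (intro ballI allI impI)
      fix v and \<epsilon> :: real assume v: "v \<in> V" and "\<epsilon> > 0"
      then obtain u where u: "u \<in> Domain B" "nrm (r v - u) < \<epsilon>"
        using B rI[OF v] unfolding W.sa_def W.dense_dom_def by blast
      then obtain f where f: "(u, f) \<in> B" by blast
      have uf: "u \<in> W" "f \<in> W" using W.sa_in[OF B f] by auto
      have "(u, f) \<in> lift B" using f uf rW WV by (simp add: lift_def)
      moreover have "nrm (v - u) < \<epsilon>" using u(2) nrmr[of "v - u"] rW[OF uf(1)] v WV[OF uf(1)] by (simp add: r_diff)
      ultimately show "\<exists>u\<in>Domain (lift B). nrm (v - u) < \<epsilon>" by blast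
    qed
    have "(v, g) \<in> adj (lift B) \<longleftrightarrow> (v, g) \<in> lift B" for v g
    proof (cases "v \<in> V \<and> g \<in> V")
      case vg: True
      have "(v, g) \<in> adj (lift B) \<longleftrightarrow> (\<forall>x y. (x, y) \<in> B \<longrightarrow> ip y (r v) = ip x (r g))"
      proof
        assume *: "(v, g) \<in> adj (lift B)"
        show "\<forall>x y. (x, y) \<in> B \<longrightarrow> ip y (r v) = ip x (r g)"
        proof (intro allI impI)
          fix x y assume xy: "(x, y) \<in> B"
          then have w: "x \<in> W" "y \<in> W" using W.sa_in[OF B] by auto
          then have "(x, y) \<in> lift B" using xy WV rW by (simp add: lift_def)
          from adjD[OF * this] show "ip y (r v) = ip x (r g)" using ipr vg WV w by simp
        qed
      next
        assume *: "\<forall>x y. (x, y) \<in> B \<longrightarrow> ip y (r v) = ip x (r g)"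
        have "ip y v = ip x g" if "x \<in> V" "y \<in> V" "(r x, r y) \<in> B" for x y
          using * that ipr vg r(2) by metis
        then show "(v, g) \<in> adj (lift B)" using vg by (auto simp: adj_def lift_def)
      qed
      also have "\<dots> \<longleftrightarrow> (r v, r g) \<in> W.adj B" using vg rI by (auto simp: W.adj_def)
      also have "\<dots> \<longleftrightarrow> (v, g) \<in> lift B" using B vg by (simp add: W.sa_def lift_def)
      finally show ?thesis .
    qed (auto simp: adj_def lift_def)
    then show "adj (lift B) = lift B" by auto
  qed
  have sa_restr: "W.sa (restr A)" if A: "sa A" for A
    unfolding W.sa_def
  proof
    show "W.dense_dom (restr A)" unfolding W.dense_dom_def
    proof (intro ballI allI impI)
      fix v and \<epsilon> :: real assume v: "v \<in> W" and "\<epsilon> > 0"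
      then obtain u f where uf: "(u, f) \<in> A" "nrm (v - u) < \<epsilon>"
        using A WV[OF v] unfolding sa_def dense_dom_def by blast
      then have V: "u \<in> V" "f \<in> V" using sa_in[OF A] by auto
      have "(r u, r f) \<in> restr A" by (rule saI[OF A uf(1)])
      moreover have "nrm (v - r u) < \<epsilon>" using uf(2) nrmr[of "v - u"] rW[OF v] V WV[OF v] by (simp add: r_diff)
      ultimately show "\<exists>u\<in>Domain (restr A). nrm (v - u) < \<epsilon>" by blast
    qed
    have "W.adj (restr A) \<subseteq> adj A"
    proof (clarsimp simp: W.adj_def adj_def WV)
      fix v g x y assume vg: "v \<in> W" "g \<in> W" and *: "\<forall>x\<in>restr A. case x of (u, f) \<Rightarrow> ip f v = ip u g"
        and xy: "(x, y) \<in> A"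
      then have V: "x \<in> V" "y \<in> V" using sa_in[OF A] by auto
      have "(r x, r y) \<in> restr A" by (rule saI[OF A xy])
      then have "ip (r y) v = ip (r x) g" using * by blast
      then show "ip y v = ip x g" using ipr V WV vg by simp
    qed
    moreover have "W.adj (restr A) \<subseteq> W \<times> W" by (auto simp: W.adj_def)
    moreover have "restr A \<subseteq> W.adj (restr A)"
      using sa_symmetric[OF A] by (auto simp: W.adj_def restr_def)
    ultimately show "W.adj (restr A) = restr A" using A by (auto simp: sa_def restr_def)
  qed
  have nn_lift: "nn (lift B)" if "W.nn B" for B
  proof -
    have "0 \<le> ip y x" if "x \<in> V" "y \<in> V" "(r x, r y) \<in> B" for x y
    proof -
      have "0 \<le> ip (r y) (r x)" using \<open>W.nn B\<close> that(3) by (auto simp: W.nn_def)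
      then show ?thesis using ipr that(1,2) r(2) by simp
    qed
    then show ?thesis by (auto simp: nn_def lift_def)
  qed
  have nn_restr: "W.nn (restr A)" if "nn A" for A using that by (auto simp: nn_def W.nn_def restr_def)
  have W_sub: "restr A \<subseteq> W \<times> W" for A by (auto simp: restr_def)
  obtain B where B: "W.sa B" "W.nn B" "B O B = restr A"
    and uniq: "\<And>C. W.sa C \<and> W.nn C \<and> C O C = restr A \<Longrightarrow> C = B"
    using W.positive_sa_sqrt[OF sa_restr[OF A(1)] nn_restr[OF A(2)]] by blast
  show ?thesis
  proof (rule ex1I[of _ "lift B"])
    show "sa (lift B) \<and> nn (lift B) \<and> lift B O lift B = A"
      using sa_lift[OF B(1)] nn_lift[OF B(2)] lift_comp[OF W.sa_sub[OF B(1)], of B] B(3) lift_restr[OF A(1)] by simp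
  next
    fix C assume C: "sa C \<and> nn C \<and> C O C = A"
    then have "lift (restr C O restr C) = A" using lift_comp[OF W_sub] lift_restr by simp
    then have "restr C O restr C = restr A" using restr_lift[of "restr C O restr C"] W_sub[of C] by blast
    then have "restr C = B" using uniq sa_restr nn_restr C by blast
    then show "C = lift B" using lift_restr C by blast
  qed
qed

text \<open>Uses \<open>B\<^sup>2 - l\<^sup>2 = (B + l) (B - l)\<close> and the injectivity of \<open>B + l\<close>.\<close>

lemma sqrt_eigenvector:
  assumes B: "sa B" "nn B" and u: "(u, l\<^sup>2 *\<^sub>R u) \<in> B O B" and l: "l > 0"
  shows "(u, l *\<^sub>R u) \<in> B"
proof -
  obtain g where g: "(u, g) \<in> B" "(g, l\<^sup>2 *\<^sub>R u) \<in> B" using u by blast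
  have [simp]: "u \<in> V" "g \<in> V" using g sa_in[OF B(1)] by auto
  let ?w = "g - l *\<^sub>R u"
  note S = sa_subspace[OF B(1)]
  have "(?w, l\<^sup>2 *\<^sub>R u - l *\<^sub>R g) \<in> B" by (rule subspace_rel(2)[OF S g(2) subspace_rel(3)[OF S g(1) g(1)]])
  moreover have "l\<^sup>2 *\<^sub>R u - l *\<^sub>R g = - l *\<^sub>R ?w" by (simp add: algebra_simps power2_eq_square)
  ultimately have "(?w, - l *\<^sub>R ?w) \<in> B" by simp
  then have "0 \<le> ip (- l *\<^sub>R ?w) ?w" using B(2) unfolding nn_def by blast
  also have "\<dots> = - l * ip ?w ?w" by (rule ip_scale) auto
  finally have "ip ?w ?w \<le> 0" using l by (simp add: mult_le_0_iff)
  moreover have "0 \<le> ip ?w ?w" by (rule ip_nonneg) auto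
  ultimately have "ip ?w ?w = 0" by simp
  then show ?thesis by (intro closed_rel_cong[OF sa_closed[OF B(1)] g(1)]) auto
qed

text \<open>
  The rotated relation \<open>J\<^sup>-\<^sup>1 B J\<close> is again a square root, hence equal to \<open>B\<close> by uniqueness.
\<close>

lemma sqrt_commutes_rotation:
  assumes JV: "\<And>x. x \<in> V \<Longrightarrow> J x \<in> V" and JJ: "\<And>x. J (J x) = - x"
    and J_neg: "\<And>x. J (- x) = - J x" and J_add: "\<And>x y. J (x + y) = J x + J y"
    and J_ip: "\<And>x y. x \<in> V \<Longrightarrow> y \<in> V \<Longrightarrow> ip (J x) y = - ip x (J y)"
    and A: "sa A" "nn A" and JA: "\<And>u f. (u, f) \<in> A \<Longrightarrow> (J u, J f) \<in> A"
    and B: "sa B" "nn B" "B O B = A" and uf: "(u, f) \<in> B"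
  shows "(J u, J f) \<in> B"
proof -
  define B' where "B' = {(u, f). (J u, J f) \<in> B}"
  have JV': "x \<in> V" if "J x \<in> V" for x using V_neg[OF JV[OF that]] by (simp add: JJ)
  have J_ip2: "ip (J x) (J y) = ip x y" if "x \<in> V" "y \<in> V" for x y
    using J_ip[OF that(1) JV[OF that(2)]] that by (simp add: JJ ip_neg_right)
  have J_inv: "J (- J x) = x" for x by (simp add: J_neg JJ)
  have B'I: "(- J w, - J h) \<in> B'" if "(w, h) \<in> B" for w h using that by (simp add: B'_def J_inv)
  have B'V: "u \<in> V \<and> f \<in> V" if "(u, f) \<in> B'" for u f
    using that sa_in[OF B(1)] JV' by (auto simp: B'_def)
  have "sa B'" unfolding sa_def
  proof
    show "dense_dom B'" unfolding dense_dom_def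
    proof (intro ballI allI impI)
      fix v and \<epsilon> :: real assume v: "v \<in> V" and "\<epsilon> > 0"
      then obtain w where w: "w \<in> Domain B" "nrm (J v - w) < \<epsilon>"
        using B(1) JV[OF v] unfolding sa_def dense_dom_def by blast
      then obtain h where h: "(w, h) \<in> B" by blast
      have wV: "w \<in> V" using sa_in[OF B(1) h] by simp
      have "J (v + J w) = J v - w" by (simp add: J_add JJ)
      then have "nrm (v - (- J w)) = nrm (J v - w)"
        using J_ip2[of "v + J w" "v + J w"] v JV[OF wV] by (simp add: nrm_def)
      then show "\<exists>u\<in>Domain B'. nrm (v - u) < \<epsilon>" using DomainI[OF B'I[OF h]] w(2)
        by (intro bexI[of _ "- J w"]) simp_all
    qed
    have "(v, g) \<in> adj B' \<longleftrightarrow> (v, g) \<in> B'" for v g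
    proof (cases "v \<in> V \<and> g \<in> V")
      case vg: True
      have "(v, g) \<in> adj B' \<longleftrightarrow> (\<forall>w h. (w, h) \<in> B \<longrightarrow> ip h (J v) = ip w (J g))"
      proof
        assume *: "(v, g) \<in> adj B'"
        show "\<forall>w h. (w, h) \<in> B \<longrightarrow> ip h (J v) = ip w (J g)"
        proof (intro allI impI)
          fix w h assume wh: "(w, h) \<in> B"
          have V: "w \<in> V" "h \<in> V" using sa_in[OF B(1) wh] by auto
          show "ip h (J v) = ip w (J g)"
            using adjD[OF * B'I[OF wh]] J_ip[of h v] J_ip[of w g] vg V JV by (simp add: ip_neg)
        qed
      next
        assume *: "\<forall>w h. (w, h) \<in> B \<longrightarrow> ip h (J v) = ip w (J g)"
        have "ip f v = ip u g" if "(u, f) \<in> B'" for u f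
        proof -
          have "ip (J f) (J v) = ip (J u) (J g)" using * that by (simp add: B'_def)
          then show ?thesis using J_ip2 vg B'V[OF that] by simp
        qed
        then show "(v, g) \<in> adj B'" using vg by (auto simp: adj_def)
      qed
      also have "\<dots> \<longleftrightarrow> (J v, J g) \<in> adj B" using vg JV by (auto simp: adj_def)
      also have "\<dots> \<longleftrightarrow> (v, g) \<in> B'" using B(1) by (simp add: sa_def B'_def)
      finally show ?thesis .
    qed (use B'V in \<open>auto simp: adj_def\<close>)
    then show "adj B' = B'" by auto
  qed
  moreover have "nn B'"
  proof -
    have "0 \<le> ip f u" if "(u, f) \<in> B'" for u f
    proof -
      have "0 \<le> ip (J f) (J u)" using that B(2) by (auto simp: B'_def nn_def)
      then show ?thesis using J_ip2 B'V[OF that] by simp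
    qed
    then show ?thesis by (auto simp: nn_def)
  qed
  moreover have "B' O B' = A"
  proof
    show "B' O B' \<subseteq> A"
    proof safe
      fix x y z assume "(x, y) \<in> B'" "(y, z) \<in> B'"
      then have "(J x, J z) \<in> A" using B(3) by (auto simp: B'_def)
      from JA[OF this] have "(- x, - z) \<in> A" by (simp add: JJ)
      from subspace_rel(3)[OF sa_subspace[OF A(1)] this this, of "-1"] show "(x, z) \<in> A" by simp
    qed
    show "A \<subseteq> B' O B'"
    proof safe
      fix x z assume "(x, z) \<in> A"
      then have "(J x, J z) \<in> B O B" using JA B(3) by simp
      then obtain y where "(J x, y) \<in> B" "(y, J z) \<in> B" by blast
      then have "(x, - J y) \<in> B'" "(- J y, z) \<in> B'" by (auto simp: B'_def J_inv)
      then show "(x, z) \<in> B' O B'" by blast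
    qed
  qed
  ultimately have "B' = B" using positive_self_adjoint_sqrt[OF A] B by blast
  then show ?thesis using uf by (auto simp: B'_def)
qed

end

section \<open>Functions as a real vector space\<close>

instantiation "fun" :: (type, real_vector) real_vector
begin

definition scaleR_fun :: "real \<Rightarrow> ('a \<Rightarrow> 'b) \<Rightarrow> 'a \<Rightarrow> 'b" where
  "scaleR_fun r f = (\<lambda>x. r *\<^sub>R f x)"

instance
  by standard (simp_all add: scaleR_fun_def fun_eq_iff scaleR_add_right scaleR_add_left)

end

lemma scaleR_fun_apply [simp]: "(r *\<^sub>R f) x = r *\<^sub>R f x"
  by (simp add: scaleR_fun_def)

section \<open>Square-integrable functions\<close>

text \<open>
  Square-integrability over an arbitrary measure; the values lie in a Euclidean space, so that both
  spinors and their components are covered.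
\<close>

definition sq_integrable :: "'a measure \<Rightarrow> ('a \<Rightarrow> 'b::euclidean_space) \<Rightarrow> bool" where
  "sq_integrable M f \<longleftrightarrow> f \<in> borel_measurable M \<and> integrable M (\<lambda>x. (norm (f x))\<^sup>2)"

lemma sq_integrableD [measurable_dest]: "sq_integrable M f \<Longrightarrow> f \<in> borel_measurable M"
  by (simp add: sq_integrable_def)

lemma sq_integrable_square: "sq_integrable M f \<Longrightarrow> integrable M (\<lambda>x. (norm (f x))\<^sup>2)"
  by (simp add: sq_integrable_def)

lemma two_mult_le_squares: "2 * (a * b) \<le> a\<^sup>2 + (b::real)\<^sup>2"
  using zero_le_power2[of "a - b"] by (simp add: power2_eq_square algebra_simps)

lemma sq_integrable_zero: "sq_integrable M (\<lambda>x. 0)"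
  by (simp add: sq_integrable_def)

lemma sq_integrable_add:
  assumes "sq_integrable M f" "sq_integrable M g"
  shows "sq_integrable M (\<lambda>x. f x + g x)"
proof -
  have [measurable]: "f \<in> borel_measurable M" "g \<in> borel_measurable M" using assms by (auto simp: sq_integrable_def)
  have "(norm (f x + g x))\<^sup>2 \<le> 2 * (norm (f x))\<^sup>2 + 2 * (norm (g x))\<^sup>2" for x
  proof -
    have "(norm (f x + g x))\<^sup>2 \<le> (norm (f x) + norm (g x))\<^sup>2" by (intro power_mono norm_triangle_ineq) simp
    then show ?thesis using two_mult_le_squares[of "norm (f x)" "norm (g x)"] by (simp add: power2_sum)
  qed
  then have "integrable M (\<lambda>x. (norm (f x + g x))\<^sup>2)"
    by (intro Bochner_Integration.integrable_bound[where g = "\<lambda>x. (norm (f x + g x))\<^sup>2"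
          and f = "\<lambda>x. 2 * (norm (f x))\<^sup>2 + 2 * (norm (g x))\<^sup>2"])
       (use assms in \<open>auto simp: sq_integrable_def\<close>)
  then show ?thesis by (simp add: sq_integrable_def)
qed

lemma sq_integrable_bounded_linear:
  fixes h :: "'b::euclidean_space \<Rightarrow> 'c::euclidean_space"
  assumes "bounded_linear h" "sq_integrable M f"
  shows "sq_integrable M (\<lambda>x. h (f x))"
proof -
  obtain K where K: "\<And>x. norm (h x) \<le> norm x * K" using bounded_linear.bounded[OF assms(1)] by blast
  have [measurable]: "f \<in> borel_measurable M" "h \<in> borel_measurable borel"
    using assms by (auto simp: sq_integrable_def intro: borel_measurable_continuous_onI linear_continuous_on)
  have "(norm (h (f x)))\<^sup>2 \<le> K\<^sup>2 * (norm (f x))\<^sup>2" for x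
    using power_mono[OF K[of "f x"], of 2] by (simp add: power_mult_distrib mult.commute)
  then have "integrable M (\<lambda>x. (norm (h (f x)))\<^sup>2)"
    by (intro Bochner_Integration.integrable_bound[where g = "\<lambda>x. (norm (h (f x)))\<^sup>2" and f = "\<lambda>x. K\<^sup>2 * (norm (f x))\<^sup>2"])
       (use assms in \<open>auto simp: sq_integrable_def\<close>)
  then show ?thesis by (simp add: sq_integrable_def)
qed

lemma sq_integrable_scaleR: "sq_integrable M f \<Longrightarrow> sq_integrable M (\<lambda>x. r *\<^sub>R f x)"
  by (rule sq_integrable_bounded_linear[OF bounded_linear_scaleR_right])

lemma sq_integrable_diff:
  "sq_integrable M f \<Longrightarrow> sq_integrable M g \<Longrightarrow> sq_integrable M (\<lambda>x. f x - g x)"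
  using sq_integrable_add[OF _ sq_integrable_scaleR[of M g "-1"]] by simp

lemma sq_integrable_bilinear:
  fixes b :: "'b::euclidean_space \<Rightarrow> 'c::euclidean_space \<Rightarrow> 'd::euclidean_space"
  assumes b: "\<And>x y. norm (b x y) \<le> norm x * norm y"
    and [measurable]: "(\<lambda>x. b (f x) (g x)) \<in> borel_measurable M"
    and fg: "sq_integrable M f" "sq_integrable M g"
  shows "integrable M (\<lambda>x. b (f x) (g x))"
proof (rule Bochner_Integration.integrable_bound)
  show "integrable M (\<lambda>x. (norm (f x))\<^sup>2 + (norm (g x))\<^sup>2)" using fg by (simp add: sq_integrable_def)
  have "norm (b (f x) (g x)) \<le> (norm (f x))\<^sup>2 + (norm (g x))\<^sup>2" for x
    using b[of "f x" "g x"] two_mult_le_squares[of "norm (f x)" "norm (g x)"]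
      mult_nonneg_nonneg[OF norm_ge_zero[of "f x"] norm_ge_zero[of "g x"]] by linarith
  then show "AE x in M. norm (b (f x) (g x)) \<le> norm ((norm (f x))\<^sup>2 + (norm (g x))\<^sup>2)" by simp
qed simp

lemma sq_integrable_inner:
  assumes "sq_integrable M f" "sq_integrable M g"
  shows "integrable M (\<lambda>x. inner (f x) (g x))"
proof (rule sq_integrable_bilinear[OF _ _ assms])
  show "norm (inner x y) \<le> norm x * norm y" for x y :: 'b by (simp add: Cauchy_Schwarz_ineq2)
  have [measurable]: "f \<in> borel_measurable M" "g \<in> borel_measurable M" using assms by (auto simp: sq_integrable_def)
  show "(\<lambda>x. inner (f x) (g x)) \<in> borel_measurable M" by measurable
qed

text \<open>
  Riesz--Fischer. Along a fast Cauchy subsequence the weighted sum of the squared increments has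
  finite integral, so the increments are summable almost everywhere; Fatou's lemma identifies the
  pointwise limit as the limit in mean.
\<close>

proposition sq_integrable_complete:
  fixes f :: "nat \<Rightarrow> 'a \<Rightarrow> 'b::euclidean_space"
  assumes f: "\<And>n. sq_integrable M (f n)"
    and Cauchy: "\<And>\<epsilon>. \<epsilon> > 0 \<Longrightarrow> \<exists>N. \<forall>m\<ge>N. \<forall>n\<ge>N. (LINT x|M. (norm (f m x - f n x))\<^sup>2) < \<epsilon>"
  obtains g where "sq_integrable M g" "(\<lambda>n. LINT x|M. (norm (f n x - g x))\<^sup>2) \<longlonglongrightarrow> 0"
proof -
  have [measurable]: "f n \<in> borel_measurable M" for n using f by (simp add: sq_integrable_def)
  have int: "integrable M (\<lambda>x. (norm (f m x - f n x))\<^sup>2)" for m n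
    using sq_integrable_diff[OF f f] by (simp add: sq_integrable_def)
  have "\<exists>N. \<forall>m\<ge>N. \<forall>n\<ge>N. (LINT x|M. (norm (f m x - f n x))\<^sup>2) < (1/4)^k" for k :: nat
    by (rule Cauchy) simp
  then obtain N where N: "\<And>k m n. m \<ge> N k \<Longrightarrow> n \<ge> N k \<Longrightarrow> (LINT x|M. (norm (f m x - f n x))\<^sup>2) < (1/4)^k"
    by metis
  \<comment> \<open>a monotone sequence of indices that dominates \<open>N\<close>\<close>
  define r where "r k = (\<Sum>i\<le>k. N i)" for k
  have rN: "N k \<le> r k" for k unfolding r_def by (rule member_le_sum) auto
  have r_mono: "r j \<le> r k" if "j \<le> k" for j k unfolding r_def by (rule sum_mono2) (use that in auto)
  define h where "h k x = f (r (Suc k)) x - f (r k) x" for k x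
  have [measurable]: "h k \<in> borel_measurable M" for k unfolding h_def by measurable
  have hint: "(LINT x|M. (norm (h k x))\<^sup>2) \<le> (1/4)^k" for k
    unfolding h_def using N[of k "r (Suc k)" "r k"] rN[of k] r_mono[of k "Suc k"] by simp
  have "(\<integral>\<^sup>+x. (\<Sum>k. ennreal (2^k * (norm (h k x))\<^sup>2)) \<partial>M) = (\<Sum>k. \<integral>\<^sup>+x. ennreal (2^k * (norm (h k x))\<^sup>2) \<partial>M)"
    by (rule nn_integral_suminf) simp
  also have "\<dots> \<le> (\<Sum>k. ennreal ((1/2)^k))"
  proof (rule suminf_le)
    fix k
    have "(\<integral>\<^sup>+x. ennreal (2^k * (norm (h k x))\<^sup>2) \<partial>M) = ennreal (LINT x|M. 2^k * (norm (h k x))\<^sup>2)"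
      using int by (intro nn_integral_eq_integral) (auto simp: h_def)
    also have "\<dots> \<le> ennreal ((1/2)^k)"
    proof (rule ennreal_leI)
      have "(LINT x|M. 2^k * (norm (h k x))\<^sup>2) \<le> 2^k * (1/4)^k" using hint[of k] by simp
      also have "\<dots> = (1/2::real)^k" by (simp add: power_mult_distrib[symmetric])
      finally show "(LINT x|M. 2^k * (norm (h k x))\<^sup>2) \<le> (1/2)^k" .
    qed
    finally show "(\<integral>\<^sup>+x. ennreal (2^k * (norm (h k x))\<^sup>2) \<partial>M) \<le> ennreal ((1/2)^k)" .
  qed auto
  also have "(\<Sum>k. ennreal ((1/2)^k)) = ennreal (\<Sum>k. (1/2)^k)"
    by (rule suminf_ennreal2) (simp_all add: summable_geometric)
  also have "\<dots> < \<infinity>" by simp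
  finally have "(\<integral>\<^sup>+x. (\<Sum>k. ennreal (2^k * (norm (h k x))\<^sup>2)) \<partial>M) \<noteq> \<infinity>" by simp
  then have "AE x in M. (\<Sum>k. ennreal (2^k * (norm (h k x))\<^sup>2)) \<noteq> \<infinity>"
    by (intro nn_integral_noteq_infinite) auto
  then have conv: "AE x in M. convergent (\<lambda>k. f (r k) x)"
  proof eventually_elim
    fix x assume *: "(\<Sum>k. ennreal (2^k * (norm (h k x))\<^sup>2)) \<noteq> \<infinity>"
    have "summable (\<lambda>k. 2^k * (norm (h k x))\<^sup>2)" by (rule summable_suminf_not_top) (use * in auto)
    moreover have "summable (\<lambda>k. (1/2::real)^k)" by (simp add: summable_geometric)
    ultimately have s: "summable (\<lambda>k. 2^k * (norm (h k x))\<^sup>2 + (1/2)^k)" by (rule summable_add)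
    have "norm (h k x) \<le> 2^k * (norm (h k x))\<^sup>2 + (1/2)^k" for k
    proof -
      have s1: "sqrt (2^k) * sqrt ((1/2)^k) = 1"
        by (subst real_sqrt_mult[symmetric], subst power_mult_distrib[symmetric]) simp
      have "sqrt (2^k) * norm (h k x) * sqrt ((1/2)^k) = norm (h k x) * (sqrt (2^k) * sqrt ((1/2)^k))"
        by (simp only: mult_ac)
      then have "2 * norm (h k x) = 2 * (sqrt (2^k) * norm (h k x) * sqrt ((1/2)^k))"
        by (simp only: s1 mult_1_right)
      also have "\<dots> \<le> (sqrt (2^k) * norm (h k x))\<^sup>2 + (sqrt ((1/2)^k))\<^sup>2"
        by (rule two_mult_le_squares)
      also have "\<dots> = 2^k * (norm (h k x))\<^sup>2 + (1/2)^k" by (simp add: power_mult_distrib)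
      finally show ?thesis using norm_ge_zero[of "h k x"] by linarith
    qed
    then have "summable (\<lambda>k. h k x)" by (intro summable_comparison_test'[OF s]) auto
    then have "convergent (\<lambda>n. (\<Sum>k<n. h k x) + f (r 0) x)"
      by (intro convergent_add convergent_const) (simp add: summable_iff_convergent)
    moreover have "(\<Sum>k<n. h k x) + f (r 0) x = f (r n) x" for n
      using sum_lessThan_telescope[of "\<lambda>n. f (r n) x" n] by (simp add: h_def)
    ultimately show "convergent (\<lambda>k. f (r k) x)" by simp
  qed
  define g where "g x = lim (\<lambda>k. f (r k) x)" for x
  have g_meas [measurable]: "g \<in> borel_measurable M"
    unfolding g_def by (rule borel_measurable_lim_metric) simp
  have bound: "(\<integral>\<^sup>+x. ennreal ((norm (f n x - g x))\<^sup>2) \<partial>M) \<le> ennreal ((1/4)^k)" if n: "n \<ge> N k" for n k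
  proof -
    have "(\<integral>\<^sup>+x. ennreal ((norm (f n x - g x))\<^sup>2) \<partial>M)
        = (\<integral>\<^sup>+x. liminf (\<lambda>j. ennreal ((norm (f n x - f (r j) x))\<^sup>2)) \<partial>M)"
    proof (rule nn_integral_cong_AE, use conv in eventually_elim)
      fix x assume "convergent (\<lambda>k. f (r k) x)"
      then have "(\<lambda>k. f (r k) x) \<longlonglongrightarrow> g x" by (simp add: g_def convergent_LIMSEQ_iff)
      then have "(\<lambda>j. ennreal ((norm (f n x - f (r j) x))\<^sup>2)) \<longlonglongrightarrow> ennreal ((norm (f n x - g x))\<^sup>2)"
        by (intro tendsto_intros)
      then show "ennreal ((norm (f n x - g x))\<^sup>2) = liminf (\<lambda>j. ennreal ((norm (f n x - f (r j) x))\<^sup>2))"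
        by (intro lim_imp_Liminf[symmetric]) auto
    qed
    also have "\<dots> \<le> liminf (\<lambda>j. \<integral>\<^sup>+x. ennreal ((norm (f n x - f (r j) x))\<^sup>2) \<partial>M)"
      by (rule nn_integral_liminf) simp
    also have "\<dots> \<le> ennreal ((1/4)^k)"
    proof (rule Liminf_le)
      show "\<forall>\<^sub>F j in sequentially. (\<integral>\<^sup>+x. ennreal ((norm (f n x - f (r j) x))\<^sup>2) \<partial>M) \<le> ennreal ((1/4)^k)"
      proof (rule eventually_sequentiallyI[of k])
        fix j assume "k \<le> j"
        then have "N k \<le> r j" using rN[of k] r_mono[of k j] by simp
        then show "(\<integral>\<^sup>+x. ennreal ((norm (f n x - f (r j) x))\<^sup>2) \<partial>M) \<le> ennreal ((1/4)^k)"
          using N[OF n, of "r j"] by (subst nn_integral_eq_integral[OF int]) (auto intro!: ennreal_leI)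
      qed
    qed simp
    finally show ?thesis .
  qed
  have int_g: "integrable M (\<lambda>x. (norm (f n x - g x))\<^sup>2)" if "n \<ge> N k" for n k
    using bound[OF that] by (intro integrableI_bounded) (auto simp: le_less_trans)
  have "sq_integrable M (\<lambda>x. f (N 0) x - g x)" using int_g[of 0 "N 0"] by (simp add: sq_integrable_def)
  from sq_integrable_diff[OF f[of "N 0"] this] have g: "sq_integrable M g" by simp
  have "(\<lambda>n. LINT x|M. (norm (f n x - g x))\<^sup>2) \<longlonglongrightarrow> 0"
  proof (rule LIMSEQ_I)
    fix \<epsilon> :: real assume "\<epsilon> > 0"
    then obtain k where k: "(1/4::real)^k < \<epsilon>" using real_arch_pow_inv[of \<epsilon> "1/4"] by auto
    have "norm ((LINT x|M. (norm (f n x - g x))\<^sup>2) - 0) < \<epsilon>" if n: "n \<ge> N k" for n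
    proof -
      have "ennreal (LINT x|M. (norm (f n x - g x))\<^sup>2) \<le> ennreal ((1/4)^k)"
        using bound[OF n] nn_integral_eq_integral[OF int_g[OF n]] by simp
      then have "(LINT x|M. (norm (f n x - g x))\<^sup>2) \<le> (1/4)^k" by (simp add: ennreal_le_iff)
      moreover have "0 \<le> (LINT x|M. (norm (f n x - g x))\<^sup>2)" by (rule Bochner_Integration.integral_nonneg) simp
      ultimately show ?thesis using k by simp
    qed
    then show "\<exists>N. \<forall>n\<ge>N. norm ((LINT x|M. (norm (f n x - g x))\<^sup>2) - 0) < \<epsilon>" by blast
  qed
  with g that show ?thesis by blast
qed

section \<open>The Hilbert space of spinors\<close>

lemma L2_iff: "u \<in> L2 G \<longleftrightarrow> (\<forall>e\<in>edges G. sq_integrable (edge_measure G e) (u e))"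
  by (simp add: L2_def sq_integrable_def)


definition rip :: "('v, 'e) mgraph \<Rightarrow> 'e spinor \<Rightarrow> 'e spinor \<Rightarrow> real" where
  "rip G u v = (\<Sum>e\<in>edges G. LINT x|edge_measure G e. inner (u e x) (v e x))"

lemma rip_self: "rip G u u = mass G u"
  by (simp add: rip_def mass_def dot_square_norm)

lemma L2_norm_rip: "L2_norm G (\<lambda>e x. u e x - v e x) = sqrt (rip G (u - v) (u - v))"
  by (simp add: rip_self L2_norm_def fun_diff_def)

lemma semi_hilbert_L2:
  fixes G :: "('v, 'e) mgraph"
  assumes fin: "finite (edges G)"
  shows "semi_hilbert (L2 G) (rip G)"
proof
  show "subspace (L2 G)" unfolding subspace_def
    by (auto simp: L2_iff zero_fun_def plus_fun_def scaleR_fun_def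
        intro: sq_integrable_zero sq_integrable_add sq_integrable_scaleR)
next
  fix x y z :: "'e spinor" assume "x \<in> L2 G" "y \<in> L2 G" "z \<in> L2 G"
  then show "rip G (x + y) z = rip G x z + rip G y z"
    unfolding rip_def sum.distrib[symmetric]
    by (intro sum.cong refl) (simp add: L2_iff inner_add_left sq_integrable_inner)
next
  fix x :: "'e spinor"
  show "0 \<le> rip G x x" unfolding rip_def by (intro sum_nonneg Bochner_Integration.integral_nonneg) simp
next
  fix s :: "nat \<Rightarrow> 'e spinor" assume s: "\<And>n. s n \<in> L2 G"
    and c: "\<And>\<epsilon>. \<epsilon> > 0 \<Longrightarrow> \<exists>N. \<forall>m\<ge>N. \<forall>n\<ge>N. rip G (s m - s n) (s m - s n) < \<epsilon>"
  have "\<exists>g. sq_integrable (edge_measure G e) g \<and> (\<lambda>n. LINT x|edge_measure G e. (norm (s n e x - g x))\<^sup>2) \<longlonglongrightarrow> 0"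
    if e: "e \<in> edges G" for e
  proof (rule sq_integrable_complete)
    show "sq_integrable (edge_measure G e) (s n e)" for n using s e by (simp add: L2_iff)
    fix \<epsilon> :: real assume "\<epsilon> > 0"
    have "(LINT x|edge_measure G e. (norm (s m e x - s n e x))\<^sup>2) \<le> rip G (s m - s n) (s m - s n)" for m n
      unfolding rip_self mass_def
      by (rule order_trans[OF _ member_le_sum[OF e]]) (auto intro!: Bochner_Integration.integral_nonneg fin)
    with c[OF \<open>\<epsilon> > 0\<close>]
    show "\<exists>N. \<forall>m\<ge>N. \<forall>n\<ge>N. (LINT x|edge_measure G e. (norm (s m e x - s n e x))\<^sup>2) < \<epsilon>"
      by (meson order_le_less_trans)
  qed blast
  then have "\<forall>e\<in>edges G. \<exists>g. sq_integrable (edge_measure G e) g \<and> (\<lambda>n. LINT x|edge_measure G e. (norm (s n e x - g x))\<^sup>2) \<longlonglongrightarrow> 0"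
    by blast
  from bchoice[OF this] obtain g where "\<forall>e\<in>edges G. sq_integrable (edge_measure G e) (g e)
      \<and> (\<lambda>n. LINT x|edge_measure G e. (norm (s n e x - g e x))\<^sup>2) \<longlonglongrightarrow> 0" ..
  then have g: "\<And>e. e \<in> edges G \<Longrightarrow> sq_integrable (edge_measure G e) (g e)"
    "\<And>e. e \<in> edges G \<Longrightarrow> (\<lambda>n. LINT x|edge_measure G e. (norm (s n e x - g e x))\<^sup>2) \<longlonglongrightarrow> 0" by auto
  have "(\<lambda>n. \<Sum>e\<in>edges G. LINT x|edge_measure G e. (norm (s n e x - g e x))\<^sup>2) \<longlonglongrightarrow> (\<Sum>e\<in>edges G. 0)"
    by (intro tendsto_sum g(2))
  then have "(\<lambda>n. rip G (s n - g) (s n - g)) \<longlonglongrightarrow> 0" by (simp add: rip_self mass_def)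
  then show "\<exists>l\<in>L2 G. (\<lambda>n. rip G (s n - l) (s n - l)) \<longlonglongrightarrow> 0" using g(1) by (auto simp: L2_iff)
next
  fix r and x y :: "'e spinor"
  show "rip G (r *\<^sub>R x) y = r * rip G x y"
    unfolding rip_def sum_distrib_left by (intro sum.cong refl) simp
  show "rip G x y = rip G y x"
    unfolding rip_def
    by (rule sum.cong[OF refl], rule Bochner_Integration.integral_cong[OF refl], rule inner_commute)
qed

text \<open>The complex structure of the real Hilbert space of spinors.\<close>

definition rot :: "'e spinor \<Rightarrow> 'e spinor" where
  "rot u = (\<lambda>e x. \<i> *s u e x)"

lemma rot_rot: "rot (rot u) = - u"
  by (auto simp: rot_def fun_eq_iff vec_eq_iff simp flip: mult.assoc)

lemma rot_neg: "rot (- u) = - rot u"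
  by (auto simp: rot_def fun_eq_iff vec_eq_iff)

lemma rot_add: "rot (u + v) = rot u + rot v"
  by (auto simp: rot_def fun_eq_iff vec_eq_iff algebra_simps)

lemma norm_cvec2: "(norm (z :: complex ^ 2))\<^sup>2 = (cmod (z $ 1))\<^sup>2 + (cmod (z $ 2))\<^sup>2"
  by (simp add: norm_vec_def L2_set_def sum_2)

lemma bounded_linear_vec_scale: "bounded_linear (\<lambda>z :: complex ^ 2. a *s z)"
proof (rule bounded_linear_intro[where K = "cmod a"])
  fix z :: "complex ^ 2"
  have "(norm (a *s z))\<^sup>2 = (norm z * cmod a)\<^sup>2"
    by (simp add: norm_cvec2 norm_mult power_mult_distrib algebra_simps)
  then have "(norm (a *s z))\<^sup>2 \<le> (norm z * cmod a)\<^sup>2" by simp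
  then show "norm (a *s z) \<le> norm z * cmod a" by (rule power2_le_imp_le) simp
qed (auto simp: vec_eq_iff algebra_simps)

lemma rot_L2: "u \<in> L2 G \<Longrightarrow> rot u \<in> L2 G"
  by (simp add: L2_iff rot_def sq_integrable_bounded_linear[OF bounded_linear_vec_scale])

lemma L2_inner_rot: "L2_inner G (rot u) v = \<i> * L2_inner G u v" "L2_inner G u (rot v) = - \<i> * L2_inner G u v"
proof -
  have *: "(\<Sum>i\<in>UNIV. (\<i> * a i) * cnj (b i)) = \<i> * (\<Sum>i\<in>UNIV. a i * cnj (b i))"
     "(\<Sum>i\<in>UNIV. a i * cnj (\<i> * b i)) = - \<i> * (\<Sum>i\<in>UNIV. a i * cnj (b i))" for a b :: "2 \<Rightarrow> complex"
    by (simp_all add: sum_2 algebra_simps)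
  show "L2_inner G (rot u) v = \<i> * L2_inner G u v" "L2_inner G u (rot v) = - \<i> * L2_inner G u v"
    unfolding L2_inner_def rot_def vector_smult_component * integral_mult_right_zero
    by (simp_all only: sum_distrib_left)
qed

lemma L2_inner_integrable:
  fixes u v :: "'a \<Rightarrow> complex ^ 2"
  assumes "sq_integrable M u" "sq_integrable M v"
  shows "integrable M (\<lambda>x. \<Sum>i\<in>UNIV. u x $ i * cnj (v x $ i))"
proof -
  have c: "sq_integrable M (\<lambda>x. u x $ i)" "sq_integrable M (\<lambda>x. cnj (v x $ i))" for i
    using assms by (auto intro!: sq_integrable_bounded_linear[OF bounded_linear_vec_nth]
      sq_integrable_bounded_linear[OF bounded_linear_cnj])
  show ?thesis
  proof (intro Bochner_Integration.integrable_sum sq_integrable_bilinear[of "(*)", OF _ _ c])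
    fix i
    have [measurable]: "(\<lambda>x. u x $ i) \<in> borel_measurable M" "(\<lambda>x. cnj (v x $ i)) \<in> borel_measurable M"
      using c by (auto simp: sq_integrable_def)
    show "(\<lambda>x. u x $ i * cnj (v x $ i)) \<in> borel_measurable M" by measurable
  qed (simp add: norm_mult)
qed

lemma Re_L2_inner:
  assumes "u \<in> L2 G" "v \<in> L2 G"
  shows "Re (L2_inner G u v) = rip G u v"
proof -
  have "Re (\<Sum>i\<in>UNIV. a $ i * cnj (b $ i)) = inner a b" for a b :: "complex ^ 2"
    by (simp add: inner_vec_def inner_complex_def sum_2)
  then show ?thesis unfolding L2_inner_def rip_def Re_sum
    using assms by (intro sum.cong refl) (simp add: L2_iff L2_inner_integrable flip: integral_Re)
qed

lemma Im_L2_inner: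
  assumes "u \<in> L2 G" "v \<in> L2 G"
  shows "Im (L2_inner G u v) = rip G u (rot v)"
  using Re_L2_inner[OF assms(1) rot_L2[OF assms(2)]] by (simp add: L2_inner_rot)

lemma rip_rot:
  assumes "u \<in> L2 G" "v \<in> L2 G"
  shows "rip G (rot u) v = - rip G u (rot v)"
  using Re_L2_inner[OF rot_L2[OF assms(1)] assms(2)] Im_L2_inner[OF assms] by (simp add: L2_inner_rot)

locale finite_graph =
  fixes G :: "('v, 'e) mgraph"
  assumes finite_edges: "finite (edges G)"

sublocale finite_graph \<subseteq> H: semi_hilbert "L2 G" "rip G"
  by (rule semi_hilbert_L2[OF finite_edges])

context finite_graph
begin

definition rot_closed :: "'e spinor rel \<Rightarrow> bool" where
  "rot_closed A \<longleftrightarrow> (\<forall>(u, f)\<in>A. (rot u, rot f) \<in> A)"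

text \<open>
  The real adjoint condition for \<open>(\<i>u, \<i>f)\<close> is the imaginary part of the complex condition for \<open>(u, f)\<close>.
\<close>

lemma op_adjoint_eq_adj:
  assumes A: "A \<subseteq> L2 G \<times> L2 G" "rot_closed A"
  shows "op_adjoint G A = H.adj A"
proof -
  have "(\<forall>(u, f)\<in>A. L2_inner G f v = L2_inner G u g) \<longleftrightarrow> (\<forall>(u, f)\<in>A. rip G f v = rip G u g)"
    if vg: "v \<in> L2 G" "g \<in> L2 G" for v g
  proof
    assume *: "\<forall>(u, f)\<in>A. L2_inner G f v = L2_inner G u g"
    show "\<forall>(u, f)\<in>A. rip G f v = rip G u g"
    proof clarify
      fix u f assume uf: "(u, f) \<in> A"
      then have "u \<in> L2 G" "f \<in> L2 G" "L2_inner G f v = L2_inner G u g" using A * by auto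
      then show "rip G f v = rip G u g" using Re_L2_inner vg by metis
    qed
  next
    assume *: "\<forall>(u, f)\<in>A. rip G f v = rip G u g"
    show "\<forall>(u, f)\<in>A. L2_inner G f v = L2_inner G u g"
    proof clarify
      fix u f assume uf: "(u, f) \<in> A"
      then have V: "u \<in> L2 G" "f \<in> L2 G" using A by auto
      have "(rot u, rot f) \<in> A" using A(2) uf by (auto simp: rot_closed_def)
      then have "rip G (rot f) v = rip G (rot u) g" "rip G f v = rip G u g" using * uf by auto
      then show "L2_inner G f v = L2_inner G u g"
        using V vg by (simp add: complex_eq_iff Re_L2_inner Im_L2_inner rip_rot)
    qed
  qed
  then have "(v, g) \<in> op_adjoint G A \<longleftrightarrow> (v, g) \<in> H.adj A" for v g
    unfolding op_adjoint_def H.adj_def mem_Collect_eq prod.case by blast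
  then show ?thesis by auto
qed

lemma rot_closed_op_adjoint: "rot_closed (op_adjoint G A)"
  by (auto simp: rot_closed_def op_adjoint_def rot_L2 L2_inner_rot)

lemma densely_defined_iff: "densely_defined G A \<longleftrightarrow> H.dense_dom A"
  by (simp add: densely_defined_def H.dense_dom_def L2_norm_rip H.nrm_def)

lemma self_adjoint_iff: "self_adjoint G A \<longleftrightarrow> H.sa A \<and> rot_closed A"
proof
  assume A: "self_adjoint G A"
  then have r: "rot_closed A" and s: "A \<subseteq> L2 G \<times> L2 G"
    using rot_closed_op_adjoint[of A] by (auto simp: self_adjoint_def op_adjoint_def)
  then show "H.sa A \<and> rot_closed A"
    using A op_adjoint_eq_adj[OF s r] by (simp add: self_adjoint_def H.sa_def densely_defined_iff)
next
  assume A: "H.sa A \<and> rot_closed A"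
  then show "self_adjoint G A"
    using op_adjoint_eq_adj[OF H.sa_sub] by (simp add: self_adjoint_def H.sa_def densely_defined_iff)
qed

lemma nonneg_op_iff: "A \<subseteq> L2 G \<times> L2 G \<Longrightarrow> nonneg_op G A \<longleftrightarrow> H.nn A"
  unfolding nonneg_op_def H.nn_def by (intro ball_cong refl) (auto simp: Re_L2_inner)

text \<open>
  The definite description of the square root denotes: the unique real square root commutes with
  the multiplication by \<open>\<i>\<close> and hence is the unique complex one.
\<close>

theorem op_sqrt_works:
  assumes A: "self_adjoint G A" "nonneg_op G A"
  shows "self_adjoint G (op_sqrt G A)" "nonneg_op G (op_sqrt G A)" "op_sqrt G A O op_sqrt G A = A"
proof -
  have sA: "H.sa A" and rA: "rot_closed A" using A by (auto simp: self_adjoint_iff)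
  have nA: "H.nn A" using A nonneg_op_iff[OF H.sa_sub[OF sA]] by simp
  note ex1 = H.positive_self_adjoint_sqrt[OF sA nA]
  define B where "B = (THE B. H.sa B \<and> H.nn B \<and> B O B = A)"
  have B: "H.sa B" "H.nn B" "B O B = A" using theI'[OF ex1] by (auto simp: B_def)
  have uniq: "C = B" if "H.sa C \<and> H.nn C \<and> C O C = A" for C
    unfolding B_def by (rule the1_equality[OF ex1 that, symmetric])
  have "rot_closed B" unfolding rot_closed_def
  proof clarify
    fix u f assume uf: "(u, f) \<in> B"
    show "(rot u, rot f) \<in> B"
      by (rule H.sqrt_commutes_rotation[OF rot_L2 rot_rot rot_neg rot_add rip_rot sA nA _ B uf])
         (use rA in \<open>auto simp: rot_closed_def\<close>)
  qed
  then have *: "self_adjoint G B \<and> nonneg_op G B \<and> B O B = A"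
    using B nonneg_op_iff[OF H.sa_sub[OF B(1)]] by (simp add: self_adjoint_iff)
  have "op_sqrt G A = B" unfolding op_sqrt_def
  proof (rule the_equality[where P = "\<lambda>B. self_adjoint G B \<and> nonneg_op G B \<and> B O B = A", OF *])
    fix C assume C: "self_adjoint G C \<and> nonneg_op G C \<and> C O C = A"
    then have "H.sa C" by (simp add: self_adjoint_iff)
    then show "C = B" using uniq C nonneg_op_iff[OF H.sa_sub] by blast
  qed
  with * show "self_adjoint G (op_sqrt G A)" "nonneg_op G (op_sqrt G A)" "op_sqrt G A O op_sqrt G A = A" by auto
qed

lemma op_sqrt_eigenvector:
  assumes A: "self_adjoint G A" "nonneg_op G A" and u: "(u, l\<^sup>2 *\<^sub>R u) \<in> A" and l: "l > 0"
  shows "(u, l *\<^sub>R u) \<in> op_sqrt G A"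
proof (rule H.sqrt_eigenvector[OF _ _ _ l])
  show s: "H.sa (op_sqrt G A)" using op_sqrt_works[OF A] by (simp add: self_adjoint_iff)
  show "H.nn (op_sqrt G A)" using op_sqrt_works[OF A] nonneg_op_iff[OF H.sa_sub[OF s]] by simp
  show "(u, l\<^sup>2 *\<^sub>R u) \<in> op_sqrt G A O op_sqrt G A" using op_sqrt_works(3)[OF A] u by simp
qed

end

section \<open>Smooth steps\<close>

definition smooth :: "(real \<Rightarrow> real) \<Rightarrow> bool" where
  "smooth f \<longleftrightarrow> (\<forall>n x. (deriv ^^ n) f differentiable (at x))"

text \<open>All derivatives of \<open>exp (-1/x)\<close>, extended by zero, have this form.\<close>

definition flat :: "real poly \<Rightarrow> real \<Rightarrow> real" where
  "flat P x = (if x > 0 then poly P (1 / x) * exp (- (1 / x)) else 0)"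

lemma flat_tendsto_0: "(flat P \<longlongrightarrow> 0) (at 0)"
proof -
  have "((\<lambda>y. \<Sum>i\<le>degree P. coeff P i * (y ^ i / exp y)) \<longlongrightarrow> (\<Sum>i\<le>degree P. coeff P i * 0)) at_top"
    by (intro tendsto_sum tendsto_mult tendsto_const tendsto_power_div_exp_0)
  moreover have "(\<lambda>y. \<Sum>i\<le>degree P. coeff P i * (y ^ i / exp y)) = (\<lambda>y. poly P y * exp (- y))"
    by (simp add: fun_eq_iff poly_altdef exp_minus field_simps sum_distrib_left sum_distrib_right)
  ultimately have "((\<lambda>y. poly P y * exp (- y)) \<longlongrightarrow> 0) at_top" by simp
  moreover have "filterlim (\<lambda>x::real. 1 / x) at_top (at_right 0)"
    using filterlim_inverse_at_top_right by (simp add: inverse_eq_divide)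
  ultimately have "((\<lambda>x. poly P (1 / x) * exp (- (1 / x))) \<longlongrightarrow> 0) (at_right 0)"
    by (rule filterlim_compose)
  then have "(flat P \<longlongrightarrow> 0) (at_right 0)"
    by (rule Lim_transform_eventually)
       (auto simp: flat_def eventually_at_filter intro!: always_eventually)
  moreover have "(flat P \<longlongrightarrow> 0) (at_left 0)"
    by (rule Lim_transform_eventually[OF tendsto_const])
       (auto simp: flat_def eventually_at_filter intro!: always_eventually)
  ultimately show ?thesis by (simp add: filterlim_split_at)
qed

lemma flat_has_derivative:
  "(flat P has_real_derivative flat ([:0, 0, 1:] * (P - pderiv P)) x) (at x)"
proof -
  consider "x > 0" | "x < 0" | "x = 0" by linarith
  then show ?thesis
  proof cases
    case 1
    have "((\<lambda>x. poly P (1 / x) * exp (- (1 / x))) has_real_derivative flat ([:0, 0, 1:] * (P - pderiv P)) x) (at x)"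
      using 1 by (auto intro!: derivative_eq_intros poly_DERIV[THEN DERIV_chain2]
          simp: flat_def field_simps power2_eq_square)
    then show ?thesis
      by (rule has_field_derivative_transform_within_open[where S = "{0<..}"]) (use 1 in \<open>auto simp: flat_def\<close>)
  next
    case 2
    have "((\<lambda>x. 0) has_real_derivative flat ([:0, 0, 1:] * (P - pderiv P)) x) (at x)"
      using 2 by (simp add: flat_def)
    then show ?thesis
      by (rule has_field_derivative_transform_within_open[where S = "{..<0}"]) (use 2 in \<open>auto simp: flat_def\<close>)
  next
    case 3
    have "(\<lambda>h. (flat P h - flat P 0) / (h - 0)) = flat ([:0, 1:] * P)"
      by (auto simp: flat_def fun_eq_iff)
    then have "((\<lambda>h. (flat P h - flat P 0) / (h - 0)) \<longlongrightarrow> 0) (at 0)" using flat_tendsto_0 by simp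
    then show ?thesis using 3 by (simp add: has_field_derivative_iff flat_def)
  qed
qed

text \<open>
  A class of explicit functions that is closed under differentiation. Smoothness of products and of
  rescaled functions then follows without Leibniz or chain rules for higher derivatives.
\<close>

inductive explicit_smooth :: "(real \<Rightarrow> real) \<Rightarrow> bool" where
  flat: "explicit_smooth (flat P)"
| const: "explicit_smooth (\<lambda>x. c)"
| affine: "explicit_smooth f \<Longrightarrow> explicit_smooth (\<lambda>x. f (a * x + b))"
| add: "explicit_smooth f \<Longrightarrow> explicit_smooth g \<Longrightarrow> explicit_smooth (\<lambda>x. f x + g x)"
| mult: "explicit_smooth f \<Longrightarrow> explicit_smooth g \<Longrightarrow> explicit_smooth (\<lambda>x. f x * g x)"

lemma explicit_smooth_derivative:
  "explicit_smooth f \<Longrightarrow> \<exists>f'. explicit_smooth f' \<and> (\<forall>x. (f has_real_derivative f' x) (at x))"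
proof (induction rule: explicit_smooth.induct)
  case (flat P)
  show ?case using flat_has_derivative explicit_smooth.flat by blast
next
  case (const c)
  show ?case by (intro exI[of _ "\<lambda>x. 0"]) (simp add: explicit_smooth.const)
next
  case (affine f a b)
  then obtain f' where f': "explicit_smooth f'" "\<And>x. (f has_real_derivative f' x) (at x)" by blast
  have "((\<lambda>x. f (a * x + b)) has_real_derivative f' (a * x + b) * a) (at x)" for x
    by (rule DERIV_chain2[OF f'(2)]) (auto intro!: derivative_eq_intros)
  moreover have "explicit_smooth (\<lambda>x. f' (a * x + b) * a)"
    by (intro explicit_smooth.mult explicit_smooth.const explicit_smooth.affine f'(1))
  ultimately show ?case by blast
next
  case (add f g)
  then obtain f' g' where "explicit_smooth f'" "\<And>x. (f has_real_derivative f' x) (at x)"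
    "explicit_smooth g'" "\<And>x. (g has_real_derivative g' x) (at x)" by blast
  then show ?case by (intro exI[of _ "\<lambda>x. f' x + g' x"]) (auto intro: explicit_smooth.add DERIV_add)
next
  case (mult f g)
  then obtain f' g' where *: "explicit_smooth f'" "\<And>x. (f has_real_derivative f' x) (at x)"
    "explicit_smooth g'" "\<And>x. (g has_real_derivative g' x) (at x)" by blast
  with mult.hyps have "explicit_smooth (\<lambda>x. f' x * g x + f x * g' x)"
    by (intro explicit_smooth.add explicit_smooth.mult)
  moreover have "((\<lambda>x. f x * g x) has_real_derivative f' x * g x + f x * g' x) (at x)" for x
    using DERIV_mult[OF *(2,4)] by (simp add: algebra_simps)
  ultimately show ?case by blast
qed

lemma explicit_smooth_deriv_funpow: "explicit_smooth f \<Longrightarrow> explicit_smooth ((deriv ^^ n) f)"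
proof (induction n)
  case (Suc n)
  then obtain f' where f': "explicit_smooth f'" "\<And>x. ((deriv ^^ n) f has_real_derivative f' x) (at x)"
    using explicit_smooth_derivative by blast
  then have "deriv ((deriv ^^ n) f) = f'" by (auto intro: DERIV_imp_deriv)
  then show ?case using f' by simp
qed simp

lemma explicit_smooth_differentiable: "explicit_smooth f \<Longrightarrow> f differentiable (at x)"
  using explicit_smooth_derivative real_differentiable_def by blast

lemma smooth_antiderivative:
  assumes "explicit_smooth f" "\<And>x. (F has_real_derivative f x) (at x)"
  shows "smooth F"
  unfolding smooth_def
proof (intro allI)
  fix n x
  have d: "deriv F = f" using assms(2) by (auto intro: DERIV_imp_deriv)
  show "(deriv ^^ n) F differentiable (at x)"
  proof (cases n)
    case 0
    then show ?thesis using assms(2) real_differentiable_def by auto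
  next
    case (Suc m)
    then show ?thesis using explicit_smooth_differentiable[OF explicit_smooth_deriv_funpow[OF assms(1)]]
      by (simp add: funpow_Suc_right d del: funpow.simps)
  qed
qed

text \<open>
  The step is the normalized antiderivative of the bump \<open>exp (-1/x) exp (-1/(1 - x))\<close> on \<open>(0, 1)\<close>.
  Smoothness is recorded for differences of two steps only, as these have compact support.
\<close>

proposition smooth_step_exists:
  obtains s s' :: "real \<Rightarrow> real"
  where "\<And>x. (s has_real_derivative s' x) (at x)" "\<And>x. x \<le> 0 \<Longrightarrow> s x = 0" "\<And>x. x \<ge> 1 \<Longrightarrow> s x = 1"
    "\<And>x. 0 \<le> s x" "\<And>x. s x \<le> 1" "\<And>x. 0 \<le> s' x" "\<And>x. x \<le> 0 \<Longrightarrow> s' x = 0" "\<And>x. x \<ge> 1 \<Longrightarrow> s' x = 0"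
    "continuous_on UNIV s'" "\<And>n a b. smooth (\<lambda>x. s (n * (x - a)) - s (n * (x - b)))"
proof -
  define g where "g x = flat 1 x * flat 1 (-1 * x + 1)" for x
  have g: "explicit_smooth g" unfolding g_def[abs_def]
    by (intro explicit_smooth.mult explicit_smooth.affine explicit_smooth.flat)
  have g_out: "g x = 0" if "x \<le> 0 \<or> x \<ge> 1" for x using that by (auto simp: g_def flat_def)
  have g_nn: "0 \<le> g x" for x by (simp add: g_def flat_def)
  have g_cont: "continuous_on A g" for A
    using explicit_smooth_differentiable[OF g]
    by (meson continuous_at_imp_continuous_on differentiable_imp_continuous_within)
  have g_int: "g integrable_on {a..b}" for a b by (rule integrable_continuous_interval[OF g_cont])
  define F where "F x = integral {-1..x} g" for x
  have F0: "F x = 0" if "x \<le> 0" for x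
    unfolding F_def using that g_out by (subst integral_cong[of _ _ "\<lambda>x. 0"]) auto
  have F': "(F has_real_derivative g x) (at x)" for x
  proof (cases "x < 0")
    case True
    have "((\<lambda>x. 0) has_real_derivative g x) (at x)" using True g_out by simp
    then show ?thesis
      by (rule has_field_derivative_transform_within_open[where S = "{..<0}"]) (use True F0 in auto)
  next
    case False
    have "(F has_real_derivative g x) (at x within {-1..x + 1})"
      unfolding F_def by (rule integral_has_real_derivative[OF g_cont]) (use False in auto)
    then have "(F has_real_derivative g x) (at x within {-1<..<x + 1})"
      by (rule DERIV_subset) auto
    then show ?thesis using False by (subst (asm) at_within_open) auto
  qed
  have F_mono: "F x \<le> F y" if "x \<le> y" for x y
    by (rule DERIV_nonneg_imp_nondecreasing[OF that]) (use F' g_nn in blast)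
  define c where "c = F 1"
  have F1: "F x = c" if "x \<ge> 1" for x
  proof (cases "x = 1")
    case False
    then have "1 < x" using that by simp
    then obtain z where "1 < z" "F x - F 1 = (x - 1) * g z" using MVT2[of 1 x F g] F' by blast
    then show ?thesis using g_out by (simp add: c_def)
  qed (simp add: c_def)
  have "c > 0"
  proof -
    have g_pos: "0 < g x" if "0 < x" "x < 1" for x using that by (simp add: g_def flat_def)
    have F_cont: "continuous_on {0..1} F"
      by (intro continuous_at_imp_continuous_on ballI DERIV_isCont[OF F'])
    have "\<exists>y. (F has_real_derivative y) (at x) \<and> 0 < y" if "0 < x" "x < 1" for x
      using F' g_pos[OF that] by blast
    then have "F 0 < F 1" using DERIV_pos_imp_increasing_open[of 0 1 F] F_cont by simp
    then show ?thesis using F0 by (simp add: c_def)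
  qed
  define s where "s x = F x / c" for x
  define s' where "s' x = g x / c" for x
  have sd: "(s has_real_derivative s' x) (at x)" for x
    unfolding s_def s'_def by (rule DERIV_cdivide[OF F'])
  have F_ub: "F x \<le> c" for x using F_mono[of x 1] F1[of x] by (cases "x \<le> 1") (auto simp: c_def)
  have F_lb: "0 \<le> F x" for x using F_mono[of 0 x] F0[of 0] F0[of x] by (cases "x \<le> 0") auto
  have es': "explicit_smooth s'"
    using explicit_smooth.mult[OF g explicit_smooth.const[of "inverse c"]] by (simp add: s'_def[abs_def] divide_inverse)
  show ?thesis
  proof (rule that[of s s'])
    show "continuous_on UNIV s'" unfolding s'_def using \<open>c > 0\<close> by (intro continuous_intros g_cont) auto
    fix n a b :: real
    have "explicit_smooth (\<lambda>x. s' (n * x + - n * a) * n + s' (n * x + - n * b) * - n)"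
      by (intro explicit_smooth.add explicit_smooth.mult explicit_smooth.const explicit_smooth.affine[OF es'])
    then show "smooth (\<lambda>x. s (n * (x - a)) - s (n * (x - b)))"
    proof (rule smooth_antiderivative)
      fix x
      have "((\<lambda>x. s (n * (x - a))) has_real_derivative s' (n * (x - a)) * n) (at x)" for a
        by (rule DERIV_chain2[OF sd]) (auto intro!: derivative_eq_intros)
      then show "((\<lambda>x. s (n * (x - a)) - s (n * (x - b))) has_real_derivative
          s' (n * x + - n * a) * n + s' (n * x + - n * b) * - n) (at x)"
        by (auto intro!: derivative_eq_intros simp: algebra_simps)
    qed
  qed (use sd \<open>c > 0\<close> F0 F1 F_lb F_ub g_nn g_out in \<open>auto simp: s_def s'_def\<close>)
qed

section \<open>Weak derivatives on an interval\<close>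

text \<open>
  Integrals over an edge of functions supported in a compact interval are integrals over that interval.
\<close>

lemma lebesgue_on_support:
  fixes f :: "real \<Rightarrow> 'b::euclidean_space"
  assumes "J \<subseteq> I" "J \<in> sets lebesgue" "I \<in> sets lebesgue" "\<And>x. x \<in> I \<Longrightarrow> x \<notin> J \<Longrightarrow> f x = 0"
  shows "integrable (lebesgue_on I) f \<longleftrightarrow> integrable (lebesgue_on J) f"
    and "integral\<^sup>L (lebesgue_on I) f = integral\<^sup>L (lebesgue_on J) f"
proof -
  have "indicator I x *\<^sub>R f x = indicator J x *\<^sub>R f x" for x
    using assms(1,4) by (auto simp: indicator_def)
  then have eq: "(\<lambda>x. indicator I x *\<^sub>R f x) = (\<lambda>x. indicator J x *\<^sub>R f x)" by (rule ext)
  have m: "I \<inter> space lebesgue \<in> sets lebesgue" "J \<inter> space lebesgue \<in> sets lebesgue" using assms by auto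
  show "integrable (lebesgue_on I) f \<longleftrightarrow> integrable (lebesgue_on J) f"
    unfolding integrable_restrict_space[OF m(1)] integrable_restrict_space[OF m(2)] eq ..
  show "integral\<^sup>L (lebesgue_on I) f = integral\<^sup>L (lebesgue_on J) f"
    unfolding integral_restrict_space[OF m(1)] integral_restrict_space[OF m(2)] eq ..
qed

lemma integrable_lebesgue_on_subset:
  fixes f :: "real \<Rightarrow> 'b::euclidean_space"
  assumes "integrable (lebesgue_on I) f" "J \<subseteq> I" "J \<in> sets lebesgue" "I \<in> sets lebesgue"
  shows "integrable (lebesgue_on J) f"
proof -
  have "integrable lebesgue (\<lambda>x. indicator I x *\<^sub>R f x)" using assms by (simp add: integrable_restrict_space)
  from integrable_mult_indicator[OF assms(3) this]
  have "integrable lebesgue (\<lambda>x. indicator J x *\<^sub>R (indicator I x *\<^sub>R f x))" .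
  moreover have "(\<lambda>x. indicator J x *\<^sub>R (indicator I x *\<^sub>R f x)) = (\<lambda>x. indicator J x *\<^sub>R f x)"
    using assms(2) by (intro ext) (auto simp: indicator_def)
  ultimately have "integrable lebesgue (\<lambda>x. indicator J x *\<^sub>R f x)" by (simp only:)
  then show ?thesis using assms by (simp add: integrable_restrict_space)
qed

lemma sq_integrable_subset:
  fixes f :: "real \<Rightarrow> 'b::euclidean_space"
  assumes "sq_integrable (lebesgue_on I) f" "J \<subseteq> I" "J \<in> sets lebesgue" "I \<in> sets lebesgue"
  shows "sq_integrable (lebesgue_on J) f"
  using assms integrable_lebesgue_on_subset[of I "\<lambda>x. (norm (f x))\<^sup>2" J]
  by (auto simp: sq_integrable_def intro: measurable_restrict_mono)

lemma sq_integrable_imp_integrable: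
  fixes f :: "real \<Rightarrow> 'b::euclidean_space"
  assumes "sq_integrable (lebesgue_on {p..q}) f"
  shows "integrable (lebesgue_on {p..q}) f"
proof (rule Bochner_Integration.integrable_bound)
  show "integrable (lebesgue_on {p..q}) (\<lambda>x. 1 + (norm (f x))\<^sup>2)"
    using assms continuous_imp_integrable_real[of p q "\<lambda>x. 1::real"]
    by (intro Bochner_Integration.integrable_add) (auto simp: sq_integrable_def)
  have "norm (f x) \<le> 1 + (norm (f x))\<^sup>2" for x
  proof -
    have "2 * norm (f x) \<le> 1 + (norm (f x))\<^sup>2" using two_mult_le_squares[of 1 "norm (f x)"] by simp
    then show ?thesis using norm_ge_zero[of "f x"] by linarith
  qed
  then show "AE x in lebesgue_on {p..q}. norm (f x) \<le> norm (1 + (norm (f x))\<^sup>2)" by simp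
qed (use assms in \<open>simp add: sq_integrable_def\<close>)

lemma sq_integrable_continuous:
  fixes f :: "real \<Rightarrow> 'b::euclidean_space"
  assumes "continuous_on {p..q} f"
  shows "sq_integrable (lebesgue_on {p..q}) f"
  using assms by (auto simp: sq_integrable_def intro!: continuous_imp_measurable_on_sets_lebesgue
      continuous_imp_integrable_real continuous_intros)

text \<open>
  Test functions that tend to the indicator function of \<open>(a, b]\<close>, and whose derivatives tend to the
  difference of the Dirac measures at \<open>a\<close> and \<open>b\<close>.
\<close>

lemma bump_sequence:
  fixes a b d :: real
  assumes ab: "a < b" "d > 0"
  obtains \<phi> \<phi>' :: "nat \<Rightarrow> real \<Rightarrow> real"
  where "\<And>n x. (\<phi> n has_real_derivative \<phi>' n x) (at x)" "\<And>n. smooth (\<phi> n)"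
    "\<And>n x. x \<le> a \<or> b + d \<le> x \<Longrightarrow> \<phi> n x = 0 \<and> \<phi>' n x = 0" "\<And>n x. \<bar>\<phi> n x\<bar> \<le> 1"
    "\<And>x. (\<lambda>n. \<phi> n x) \<longlonglongrightarrow> indicator {a<..b} x" "\<And>n. continuous_on UNIV (\<phi>' n)"
    "\<And>w :: real \<Rightarrow> 'b::euclidean_space. continuous_on {a..b + d} w \<Longrightarrow>
       (\<lambda>n. LINT x|lebesgue_on {a..b + d}. \<phi>' n x *\<^sub>R w x) \<longlonglongrightarrow> w a - w b"
proof -
  obtain s s' where s: "\<And>x. (s has_real_derivative s' x) (at x)" "\<And>x. x \<le> 0 \<Longrightarrow> s x = 0" "\<And>x. x \<ge> 1 \<Longrightarrow> s x = 1"
    "\<And>x. 0 \<le> s x" "\<And>x. s x \<le> 1" "\<And>x. 0 \<le> s' x" "\<And>x. x \<le> 0 \<Longrightarrow> s' x = 0" "\<And>x. x \<ge> 1 \<Longrightarrow> s' x = 0"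
    "continuous_on UNIV s'" "\<And>n a b. smooth (\<lambda>x. s (n * (x - a)) - s (n * (x - b)))"
    by (rule smooth_step_exists) (rule that; assumption)
  \<comment> \<open>the steps have width \<open>1 / k n \<le> d\<close>, so that the bumps vanish from \<open>b + d\<close> on\<close>
  define k where "k n = real (Suc n) / d" for n
  have k_pos: "k n > 0" for n using ab by (simp add: k_def)
  have kd: "k n * x \<ge> 1" if "x \<ge> d" for n x
  proof -
    have "1 \<le> real (Suc n) * 1" by simp
    also have "\<dots> \<le> real (Suc n) * (x / d)" using that ab by (intro mult_left_mono) auto
    finally show ?thesis by (simp add: k_def)
  qed
  have k_lim: "\<forall>\<^sub>F n in sequentially. k n * x \<ge> 1" if "x > 0" for x
  proof -
    have "filterlim (\<lambda>n. real (Suc n)) at_top sequentially"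
      using filterlim_real_sequentially filterlim_sequentially_Suc by blast
    then have "\<forall>\<^sub>F n in sequentially. real (Suc n) \<ge> d / x" by (simp add: filterlim_at_top)
    then show ?thesis by eventually_elim (use that ab in \<open>simp add: k_def field_simps\<close>)
  qed
  define \<phi> where "\<phi> n x = s (k n * (x - a)) - s (k n * (x - b))" for n x
  define \<kappa> where "\<kappa> c n x = k n * s' (k n * (x - c))" for c n x
  define \<phi>' where "\<phi>' n x = \<kappa> a n x - \<kappa> b n x" for n x
  have sd: "((\<lambda>x. s (k n * (x - c))) has_real_derivative \<kappa> c n x) (at x)" for c n x
  proof -
    have "((\<lambda>x. s (k n * (x - c))) has_real_derivative s' (k n * (x - c)) * k n) (at x)"
      by (rule DERIV_chain2[OF s(1)]) (auto intro!: derivative_eq_intros)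
    then show ?thesis by (simp add: \<kappa>_def mult.commute)
  qed
  have \<kappa>_cont: "continuous_on A (\<kappa> c n)" for A c n
    unfolding \<kappa>_def by (intro continuous_intros continuous_on_compose2[OF s(9)]) auto
  have \<kappa>_nn: "0 \<le> \<kappa> c n x" for c n x using s(6) k_pos[of n] by (simp add: \<kappa>_def)
  have lim_\<kappa>: "(\<lambda>n. LINT x|lebesgue_on {a..b + d}. \<kappa> c n x *\<^sub>R w x) \<longlonglongrightarrow> w c"
    if w: "continuous_on {a..b + d} w" and c: "a \<le> c" "c \<le> b" for w :: "real \<Rightarrow> 'b" and c
  proof (rule LIMSEQ_I)
    let ?M = "lebesgue_on {a..b + d}"
    fix \<epsilon> :: real assume "\<epsilon> > 0"
    have cJ: "c \<in> {a..b + d}" using c ab by simp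
    obtain \<delta> where \<delta>: "\<delta> > 0" "\<And>x. x \<in> {a..b + d} \<Longrightarrow> dist x c < \<delta> \<Longrightarrow> dist (w x) (w c) < \<epsilon> / 2"
      using w cJ \<open>\<epsilon> > 0\<close> unfolding continuous_on_iff by (metis half_gt_zero)
    obtain N where N: "\<And>n. n \<ge> N \<Longrightarrow> k n * \<delta> \<ge> 1" using k_lim[OF \<delta>(1)] by (auto simp: eventually_sequentially)
    have "norm ((LINT x|?M. \<kappa> c n x *\<^sub>R w x) - w c) < \<epsilon>" if n: "n \<ge> N" for n
    proof -
      have i1: "integrable ?M (\<kappa> c n)" "integrable ?M (\<lambda>x. \<kappa> c n x *\<^sub>R w x)"
        by (intro continuous_imp_integrable_real continuous_intros \<kappa>_cont w)+
      have "((\<kappa> c n) has_integral (s (k n * (b + d - c)) - s (k n * (a - c)))) {a..b + d}"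
        by (rule fundamental_theorem_of_calculus)
           (use ab sd in \<open>auto simp: has_real_derivative_iff_has_vector_derivative intro: has_vector_derivative_at_within\<close>)
      moreover have "s (k n * (b + d - c)) = 1" by (rule s(3), rule kd) (use c in simp)
      moreover have "s (k n * (a - c)) = 0"
        by (rule s(2)) (use c k_pos[of n] in \<open>simp add: mult_le_0_iff\<close>)
      ultimately have "((\<kappa> c n) has_integral 1) {a..b + d}" by simp
      then have one: "(LINT x|?M. \<kappa> c n x) = 1"
        using lebesgue_integral_eq_integral[OF i1(1)] by (simp add: integral_unique)
      have "(LINT x|?M. \<kappa> c n x *\<^sub>R w x) - w c = (LINT x|?M. \<kappa> c n x *\<^sub>R w x) - (LINT x|?M. \<kappa> c n x *\<^sub>R w c)"
        using one i1(1) by simp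
      also have "\<dots> = (LINT x|?M. \<kappa> c n x *\<^sub>R (w x - w c))"
        using i1 by (simp add: scaleR_diff_right)
      finally have eq: "(LINT x|?M. \<kappa> c n x *\<^sub>R w x) - w c = (LINT x|?M. \<kappa> c n x *\<^sub>R (w x - w c))" .
      have "norm ((LINT x|?M. \<kappa> c n x *\<^sub>R w x) - w c) \<le> (LINT x|?M. norm (\<kappa> c n x *\<^sub>R (w x - w c)))"
        unfolding eq by (rule integral_norm_bound)
      also have "\<dots> \<le> (LINT x|?M. \<kappa> c n x * (\<epsilon> / 2))"
      proof (rule Bochner_Integration.integral_mono)
        show "integrable ?M (\<lambda>x. norm (\<kappa> c n x *\<^sub>R (w x - w c)))"
          by (intro continuous_imp_integrable_real continuous_intros \<kappa>_cont w)
        show "integrable ?M (\<lambda>x. \<kappa> c n x * (\<epsilon> / 2))" using i1 by simp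
        fix x assume "x \<in> space ?M"
        then have x: "x \<in> {a..b + d}" by simp
        show "norm (\<kappa> c n x *\<^sub>R (w x - w c)) \<le> \<kappa> c n x * (\<epsilon> / 2)"
        proof (cases "c < x \<and> x < c + \<delta>")
          case True
          then have "norm (w x - w c) \<le> \<epsilon> / 2" using \<delta>(2)[OF x] by (simp add: dist_norm dist_real_def)
          from mult_left_mono[OF this \<kappa>_nn] show ?thesis using \<kappa>_nn[of c n x] by simp
        next
          case False
          then consider "x \<le> c" | "\<delta> \<le> x - c" by linarith
          then have "s' (k n * (x - c)) = 0"
          proof cases
            case 1
            then show ?thesis using k_pos[of n] by (intro s(7)) (simp add: mult_le_0_iff)
          next
            case 2
            then have "k n * \<delta> \<le> k n * (x - c)" using k_pos[of n] by (intro mult_left_mono) auto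
            then show ?thesis using N[OF n] by (intro s(8)) linarith
          qed
          then show ?thesis by (simp add: \<kappa>_def)
        qed
      qed
      also have "\<dots> = \<epsilon> / 2" using one by simp
      finally show ?thesis using \<open>\<epsilon> > 0\<close> by simp
    qed
    then show "\<exists>N. \<forall>n\<ge>N. norm ((LINT x|?M. \<kappa> c n x *\<^sub>R w x) - w c) < \<epsilon>" by blast
  qed
  show ?thesis
  proof (rule that[of \<phi> \<phi>'])
    fix n x
    show "(\<phi> n has_real_derivative \<phi>' n x) (at x)"
      unfolding \<phi>_def \<phi>'_def by (intro DERIV_diff sd)
    show "smooth (\<phi> n)" unfolding \<phi>_def by (rule s(10))
    show "continuous_on UNIV (\<phi>' n)" unfolding \<phi>'_def by (intro continuous_intros \<kappa>_cont)
    show "\<bar>\<phi> n x\<bar> \<le> 1"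
      using s(4)[of "k n * (x - a)"] s(5)[of "k n * (x - a)"] s(4)[of "k n * (x - b)"] s(5)[of "k n * (x - b)"]
      by (simp add: \<phi>_def abs_le_iff)
    show "\<phi> n x = 0 \<and> \<phi>' n x = 0" if x: "x \<le> a \<or> b + d \<le> x"
    proof (cases "x \<le> a")
      case True
      then have "k n * (x - a) \<le> 0" "k n * (x - b) \<le> 0" using k_pos[of n] ab by (simp_all add: mult_le_0_iff)
      then show ?thesis using s(2,7) by (simp add: \<phi>_def \<phi>'_def \<kappa>_def)
    next
      case False
      then have "1 \<le> k n * (x - a)" "1 \<le> k n * (x - b)" using x ab by (auto intro!: kd)
      then show ?thesis using s(3,8) by (simp add: \<phi>_def \<phi>'_def \<kappa>_def)
    qed
    show "(\<lambda>n. \<phi> n x) \<longlonglongrightarrow> indicator {a<..b} x"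
    proof -
      have z: "s (k n * (x - c)) = 0" if "x \<le> c" for n c
        using that k_pos[of n] by (intro s(2)) (simp add: mult_le_0_iff)
      have o: "(\<lambda>n. s (k n * (x - c))) \<longlonglongrightarrow> 1" if "c < x" for c
        by (rule tendsto_eventually) (use k_lim[of "x - c"] that s(3) in \<open>auto elim!: eventually_mono\<close>)
      consider "x \<le> a" | "a < x" "x \<le> b" | "b < x" by linarith
      then show ?thesis
      proof cases
        case 1
        then show ?thesis using z[of a] z[of b] ab by (simp add: \<phi>_def)
      next
        case 2
        then show ?thesis using z[of b] o[of a] by (simp add: \<phi>_def)
      next
        case 3
        then show ?thesis using tendsto_diff[OF o[of a] o[of b]] ab by (simp add: \<phi>_def)
      qed
    qed
  next
    fix w :: "real \<Rightarrow> 'b" assume w: "continuous_on {a..b + d} w"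
    have "integrable (lebesgue_on {a..b + d}) (\<lambda>x. \<kappa> c n x *\<^sub>R w x)" for c n
      by (intro continuous_imp_integrable_real continuous_intros \<kappa>_cont w)
    then have "(LINT x|lebesgue_on {a..b + d}. \<phi>' n x *\<^sub>R w x)
        = (LINT x|lebesgue_on {a..b + d}. \<kappa> a n x *\<^sub>R w x) - (LINT x|lebesgue_on {a..b + d}. \<kappa> b n x *\<^sub>R w x)" for n
      by (simp add: \<phi>'_def scaleR_diff_left)
    then show "(\<lambda>n. LINT x|lebesgue_on {a..b + d}. \<phi>' n x *\<^sub>R w x) \<longlonglongrightarrow> w a - w b"
      using tendsto_diff[OF lim_\<kappa>[OF w, of a] lim_\<kappa>[OF w, of b]] ab by simp
  qed
qed

lemma bump_integral_limit:
  fixes v :: "real \<Rightarrow> 'b::euclidean_space"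
  assumes ab: "a < b" "d > 0" and J: "{a..b + d} \<subseteq> I" "I \<in> sets lebesgue"
    and v: "sq_integrable (lebesgue_on I) v"
    and \<phi>: "\<And>n. \<phi> n \<in> borel_measurable borel" "\<And>n x. x \<le> a \<or> b + d \<le> x \<Longrightarrow> \<phi> n x = 0" "\<And>n x. \<bar>\<phi> n x\<bar> \<le> 1"
      "\<And>x. (\<lambda>n. \<phi> n x) \<longlonglongrightarrow> indicator {a<..b} x"
  shows "(\<lambda>n. LINT x|lebesgue_on I. \<phi> n x *\<^sub>R v x) \<longlonglongrightarrow> integral {a..b} v"
proof -
  let ?J = "{a..b + d}"
  have vJ: "integrable (lebesgue_on ?J) v"
    by (rule sq_integrable_imp_integrable[OF sq_integrable_subset[OF v J(1) _ J(2)]]) simp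
  have [measurable]: "v \<in> borel_measurable (lebesgue_on ?J)" using vJ by simp
  have [measurable]: "\<phi> n \<in> borel_measurable (lebesgue_on ?J)" for n
    by (rule measurable_restrict_space1, rule measurable_completion) (use \<phi>(1) in simp)
  have [measurable]: "indicator {a<..b} \<in> borel_measurable (lebesgue_on ?J)"
    by (rule measurable_restrict_space1, rule measurable_completion) simp
  have "(\<lambda>n. LINT x|lebesgue_on ?J. \<phi> n x *\<^sub>R v x) \<longlonglongrightarrow> (LINT x|lebesgue_on ?J. indicator {a<..b} x *\<^sub>R v x)"
  proof (rule integral_dominated_convergence)
    show "integrable (lebesgue_on ?J) (\<lambda>x. norm (v x))" using vJ by simp
    show "AE x in lebesgue_on ?J. (\<lambda>n. \<phi> n x *\<^sub>R v x) \<longlonglongrightarrow> indicator {a<..b} x *\<^sub>R v x"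
      by (intro AE_I2 tendsto_intros \<phi>(4))
    show "AE x in lebesgue_on ?J. norm (\<phi> n x *\<^sub>R v x) \<le> norm (v x)" for n
      using \<phi>(3)[of n] by (intro AE_I2) (simp add: mult_left_le_one_le)
  qed measurable
  moreover have "(LINT x|lebesgue_on ?J. indicator {a<..b} x *\<^sub>R v x) = (LINT x|lebesgue_on {a<..b}. indicator {a<..b} x *\<^sub>R v x)"
    by (rule lebesgue_on_support(2)) (use ab in auto)
  moreover have "(LINT x|lebesgue_on {a<..b}. indicator {a<..b} x *\<^sub>R v x) = (LINT x|lebesgue_on {a<..b}. v x)"
    by (rule Bochner_Integration.integral_cong) auto
  moreover have "(LINT x|lebesgue_on {a<..b}. v x) = integral {a<..b} v"
    by (rule lebesgue_integral_eq_integral[OF integrable_lebesgue_on_subset[OF vJ]]) (use ab in auto)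
  moreover have "integral {a<..b} v = integral {a..b} v"
    by (rule integral_spike_set) (rule negligible_subset[OF negligible_sing[of a]], auto)+
  moreover have "(LINT x|lebesgue_on I. \<phi> n x *\<^sub>R v x) = (LINT x|lebesgue_on ?J. \<phi> n x *\<^sub>R v x)" for n
    by (rule lebesgue_on_support(2)[OF J(1) _ J(2)]) (use \<phi>(2)[of _ n] in auto)
  ultimately show ?thesis by simp
qed

definition weak_pair :: "real set \<Rightarrow> (real \<Rightarrow> 'b::euclidean_space) \<Rightarrow> (real \<Rightarrow> 'b) \<Rightarrow> bool" where
  "weak_pair I u du \<longleftrightarrow> (\<forall>\<phi>. test_function I \<phi> \<longrightarrow>
     (LINT x|lebesgue_on I. deriv \<phi> x *\<^sub>R u x) = - (LINT x|lebesgue_on I. \<phi> x *\<^sub>R du x))"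

lemma weak_deriv_iff: "weak_deriv G u du \<longleftrightarrow> (\<forall>e\<in>edges G. weak_pair (edge_interval G e) (u e) (du e))"
  by (simp add: weak_deriv_def weak_pair_def)

lemma test_functionI:
  assumes "smooth \<phi>" "compact K" "K \<subseteq> interior I" "\<And>x. x \<notin> K \<Longrightarrow> \<phi> x = 0"
  shows "test_function I \<phi>"
  using assms by (auto simp: test_function_def smooth_def)

text \<open>
  The weak derivative is tested against the bump functions for \<open>(a, b]\<close>: one side converges to
  \<open>w a - w b\<close> because \<open>w\<close> is continuous, the other to minus the integral of \<open>du\<close> over \<open>(a, b]\<close>.
\<close>

lemma weak_FTC_interior:
  fixes w :: "real \<Rightarrow> 'b::euclidean_space"
  assumes I: "is_interval I" "I \<in> sets lebesgue"
    and u: "sq_integrable (lebesgue_on I) u" and du: "sq_integrable (lebesgue_on I) du"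
    and wp: "weak_pair I u du"
    and w: "continuous_on I w" "AE x in lebesgue_on I. w x = u x"
    and ab: "a \<in> interior I" "b \<in> interior I" "a < b"
  shows "w b - w a = integral {a..b} du"
proof -
  obtain e where e: "e > 0" "cball b e \<subseteq> interior I" using ab(2) open_contains_cball[of "interior I"] by auto
  define d where "d = e"
  have d: "d > 0" "b + d \<in> interior I" using e by (auto simp: d_def dist_real_def subset_iff)
  have "is_interval (interior I)" using I(1) by (simp add: is_interval_convex_1 convex_interior)
  then have JI: "{a..b + d} \<subseteq> interior I"
    using ab(1) d(2) unfolding is_interval_1 by (meson atLeastAtMost_iff subsetI)
  then have JI': "{a..b + d} \<subseteq> I" using interior_subset by blast
  obtain \<phi> \<phi>' :: "nat \<Rightarrow> real \<Rightarrow> real" where \<phi>: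
    "\<And>n x. (\<phi> n has_real_derivative \<phi>' n x) (at x)" "\<And>n. smooth (\<phi> n)"
    "\<And>n x. x \<le> a \<or> b + d \<le> x \<Longrightarrow> \<phi> n x = 0 \<and> \<phi>' n x = 0" "\<And>n x. \<bar>\<phi> n x\<bar> \<le> 1"
    "\<And>x. (\<lambda>n. \<phi> n x) \<longlonglongrightarrow> indicator {a<..b} x" "\<And>n. continuous_on UNIV (\<phi>' n)"
    "\<And>w :: real \<Rightarrow> 'b. continuous_on {a..b + d} w \<Longrightarrow>
       (\<lambda>n. LINT x|lebesgue_on {a..b + d}. \<phi>' n x *\<^sub>R w x) \<longlonglongrightarrow> w a - w b"
    by (rule bump_sequence[OF ab(3) d(1), where 'b = 'b]) (rule that; assumption)
  have deriv: "deriv (\<phi> n) = \<phi>' n" for n using \<phi>(1) by (auto intro: DERIV_imp_deriv)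
  have meas': "\<phi>' n \<in> borel_measurable (lebesgue_on I)" for n
    by (rule measurable_restrict_space1, rule measurable_completion)
       (use borel_measurable_continuous_onI[OF \<phi>(6)[of n]] in simp)
  have meas: "\<phi> n \<in> borel_measurable borel" for n
    by (intro borel_measurable_continuous_onI continuous_at_imp_continuous_on ballI DERIV_isCont[OF \<phi>(1)])
  have eq: "(LINT x|lebesgue_on {a..b + d}. \<phi>' n x *\<^sub>R w x) = - (LINT x|lebesgue_on I. \<phi> n x *\<^sub>R du x)" for n
  proof -
    have "(LINT x|lebesgue_on {a..b + d}. \<phi>' n x *\<^sub>R w x) = (LINT x|lebesgue_on I. \<phi>' n x *\<^sub>R w x)"
      by (rule lebesgue_on_support(2)[symmetric, OF JI' _ I(2)]) (use \<phi>(3)[of _ n] in auto)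
    also have "\<dots> = (LINT x|lebesgue_on I. \<phi>' n x *\<^sub>R u x)"
    proof (rule integral_cong_AE)
      have [measurable]: "w \<in> borel_measurable (lebesgue_on I)"
        by (rule continuous_imp_measurable_on_sets_lebesgue[OF w(1) I(2)])
      have [measurable]: "u \<in> borel_measurable (lebesgue_on I)" using u by (simp add: sq_integrable_def)
      note [measurable] = meas'
      show "(\<lambda>x. \<phi>' n x *\<^sub>R w x) \<in> borel_measurable (lebesgue_on I)"
        "(\<lambda>x. \<phi>' n x *\<^sub>R u x) \<in> borel_measurable (lebesgue_on I)" by measurable
      show "AE x in lebesgue_on I. \<phi>' n x *\<^sub>R w x = \<phi>' n x *\<^sub>R u x" using w(2) by eventually_elim simp
    qed
    also have "test_function I (\<phi> n)"
      by (rule test_functionI[OF \<phi>(2) _ JI]) (use \<phi>(3)[of _ n] in auto)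
    then have "(LINT x|lebesgue_on I. \<phi>' n x *\<^sub>R u x) = - (LINT x|lebesgue_on I. \<phi> n x *\<^sub>R du x)"
      using wp deriv by (auto simp: weak_pair_def)
    finally show ?thesis .
  qed
  have "(\<lambda>n. - (LINT x|lebesgue_on I. \<phi> n x *\<^sub>R du x)) \<longlonglongrightarrow> - integral {a..b} du"
    by (intro tendsto_minus bump_integral_limit[OF ab(3) d(1) JI' I(2) du meas _ \<phi>(4,5)]) (use \<phi>(3) in auto)
  moreover have "(\<lambda>n. - (LINT x|lebesgue_on I. \<phi> n x *\<^sub>R du x)) \<longlonglongrightarrow> w a - w b"
    using \<phi>(7)[OF continuous_on_subset[OF w(1) JI']] by (simp add: eq)
  ultimately have "w a - w b = - integral {a..b} du" by (rule LIMSEQ_unique[rotated])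
  then show ?thesis by (simp add: algebra_simps)
qed

text \<open>The fundamental theorem of calculus for the continuous representative of a weakly
  differentiable function.\<close>

proposition weak_FTC:
  fixes w :: "real \<Rightarrow> 'b::euclidean_space"
  assumes I: "is_interval I" "I \<in> sets lebesgue"
    and u: "sq_integrable (lebesgue_on I) u" and du: "sq_integrable (lebesgue_on I) du"
    and wp: "weak_pair I u du"
    and w: "continuous_on I w" "AE x in lebesgue_on I. w x = u x"
    and xy: "x \<in> I" "y \<in> I" "x \<le> y"
  shows "w y - w x = integral {x..y} du" "integrable (lebesgue_on {x..y}) du" "du integrable_on {x..y}"
proof -
  have sub: "{x..y} \<subseteq> I" using I(1) xy unfolding is_interval_1 by (meson atLeastAtMost_iff subsetI)
  show int: "integrable (lebesgue_on {x..y}) du"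
    by (rule sq_integrable_imp_integrable[OF sq_integrable_subset[OF du sub _ I(2)]]) simp
  then show HK: "du integrable_on {x..y}" by (rule integrable_on_lebesgue_on) simp
  show "w y - w x = integral {x..y} du"
  proof (cases "x = y")
    case False
    then have "x < y" using xy by simp
    define m where "m = (x + y) / 2"
    have m: "x < m" "m < y" using \<open>x < y\<close> by (auto simp: m_def)
    define H where "H t = w t - integral {x..t} du" for t
    have Hc: "continuous_on {x..y} H" unfolding H_def
      by (intro continuous_intros continuous_on_subset[OF w(1) sub] indefinite_integral_continuous_1[OF HK])
    have int_sub: "{x<..<y} \<subseteq> interior I"
      by (rule interior_maximal) (use sub in \<open>auto simp: subset_iff\<close>)
    have eq: "H a = H b" if "x < a" "a < b" "b < y" for a b
    proof -
      have "w b - w a = integral {a..b} du"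
        by (rule weak_FTC_interior[OF I u du wp w]) (use int_sub that in auto)
      moreover have "du integrable_on {x..b}" by (rule integrable_subinterval_real[OF HK]) (use that in auto)
      then have "integral {x..a} du + integral {a..b} du = integral {x..b} du"
        by (intro Henstock_Kurzweil_Integration.integral_combine) (use that in auto)
      ultimately show ?thesis by (simp add: H_def algebra_simps)
    qed
    have "H t = H m" if "t \<in> {x<..<y}" for t
    proof (cases t m rule: linorder_cases)
      case less
      then show ?thesis using eq[of t m] m that by simp
    next
      case greater
      then show ?thesis using eq[of m t] m that by simp
    qed simp
    then have "H t = H m" if "t \<in> {x..y}" for t
      using continuous_constant_on_closure[of "{x<..<y}" H "H m" t] Hc that \<open>x < y\<close> by auto
    from this[of x] this[of y] have "H x = H y" using \<open>x < y\<close> by simp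
    then show ?thesis by (simp add: H_def algebra_simps)
  qed simp
qed

section \<open>Calculus of weak derivatives\<close>

lemma test_function_derivative:
  assumes "test_function I \<phi>"
  shows "(\<phi> has_real_derivative deriv \<phi> x) (at x)" "continuous_on A \<phi>" "continuous_on A (deriv \<phi>)"
proof -
  have d: "(deriv ^^ n) \<phi> differentiable (at x)" for n x using assms by (simp add: test_function_def)
  show "(\<phi> has_real_derivative deriv \<phi> x) (at x)"
    using d[of 0 x] by (simp add: DERIV_deriv_iff_real_differentiable)
  show "continuous_on A \<phi>"
    by (intro continuous_at_imp_continuous_on ballI differentiable_imp_continuous_within) (use d[of 0] in simp)
  show "continuous_on A (deriv \<phi>)"
    by (intro continuous_at_imp_continuous_on ballI differentiable_imp_continuous_within) (use d[of 1] in simp)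
qed

lemma test_function_support:
  assumes "test_function I \<phi>"
  obtains K where "compact K" "K \<subseteq> interior I" "\<And>x. x \<notin> K \<Longrightarrow> \<phi> x = 0" "\<And>x. x \<notin> K \<Longrightarrow> deriv \<phi> x = 0"
proof -
  obtain K where K: "compact K" "K \<subseteq> interior I" "\<And>x. x \<notin> K \<Longrightarrow> \<phi> x = 0"
    using assms by (auto simp: test_function_def)
  have "deriv \<phi> x = 0" if "x \<notin> K" for x
  proof (rule DERIV_imp_deriv, rule has_field_derivative_transform_within_open[where f = "\<lambda>x. 0" and S = "- K"])
    show "open (- K)" using compact_imp_closed[OF K(1)] by (simp add: open_Compl)
  qed (use that K(3) in auto)
  with K that show ?thesis by blast
qed

lemma compact_support_sq_integrable:
  fixes f :: "real \<Rightarrow> 'b::euclidean_space"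
  assumes f: "continuous_on UNIV f" and K: "compact K" "K \<subseteq> I" "\<And>x. x \<notin> K \<Longrightarrow> f x = 0" and I: "I \<in> sets lebesgue"
  shows "sq_integrable (lebesgue_on I) f"
proof -
  obtain a where pq: "K \<subseteq> {- a..a}" using bounded_subset_cbox_symmetric[OF compact_imp_bounded[OF K(1)]] by auto
  have mK: "K \<in> sets lebesgue" using K(1) by (simp add: compact_imp_closed lebesgue_closedin)
  have "integrable (lebesgue_on {- a..a}) (\<lambda>x. (norm (f x))\<^sup>2)"
    by (intro continuous_imp_integrable_real continuous_intros continuous_on_subset[OF f]) simp
  then have "integrable (lebesgue_on K) (\<lambda>x. (norm (f x))\<^sup>2)"
    by (rule integrable_lebesgue_on_subset[OF _ pq mK]) simp
  then have "integrable (lebesgue_on I) (\<lambda>x. (norm (f x))\<^sup>2)"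
    by (subst lebesgue_on_support(1)[OF K(2) mK I]) (use K(3) in auto)
  moreover have "f \<in> borel_measurable (lebesgue_on I)"
    by (rule continuous_imp_measurable_on_sets_lebesgue[OF continuous_on_subset[OF f] I]) simp
  ultimately show ?thesis by (simp add: sq_integrable_def)
qed

lemma test_function_sq_integrable:
  assumes "test_function I \<phi>" "I \<in> sets lebesgue"
  shows "sq_integrable (lebesgue_on I) \<phi>" "sq_integrable (lebesgue_on I) (deriv \<phi>)"
proof -
  obtain K where K: "compact K" "K \<subseteq> interior I" "\<And>x. x \<notin> K \<Longrightarrow> \<phi> x = 0" "\<And>x. x \<notin> K \<Longrightarrow> deriv \<phi> x = 0"
    by (rule test_function_support[OF assms(1)]) (rule that; assumption)
  have KI: "K \<subseteq> I" using K(2) interior_subset by blast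
  show "sq_integrable (lebesgue_on I) \<phi>" "sq_integrable (lebesgue_on I) (deriv \<phi>)"
    using compact_support_sq_integrable[OF test_function_derivative(2)[OF assms(1)] K(1) KI K(3) assms(2)]
      compact_support_sq_integrable[OF test_function_derivative(3)[OF assms(1)] K(1) KI K(4) assms(2)] by auto
qed

lemma sq_integrable_scaleR_product:
  fixes v :: "'a \<Rightarrow> 'b::euclidean_space"
  assumes "sq_integrable M \<psi>" "sq_integrable M v"
  shows "integrable M (\<lambda>x. \<psi> x *\<^sub>R v x)"
proof (rule sq_integrable_bilinear[OF _ _ assms])
  have [measurable]: "\<psi> \<in> borel_measurable M" "v \<in> borel_measurable M" using assms by (auto simp: sq_integrable_def)
  show "(\<lambda>x. \<psi> x *\<^sub>R v x) \<in> borel_measurable M" by measurable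
qed simp

text \<open>
  The interval of integration may be enlarged beyond \<open>I\<close>, up to points where \<open>h\<close> vanishes.
\<close>

lemma compact_support_integral_deriv:
  fixes h h' :: "real \<Rightarrow> real"
  assumes h: "\<And>x. (h has_real_derivative h' x) (at x)" and K: "compact K" "K \<subseteq> I" "\<And>x. x \<notin> K \<Longrightarrow> h x = 0" "\<And>x. x \<notin> K \<Longrightarrow> h' x = 0"
    and I: "I \<in> sets lebesgue" and h': "continuous_on UNIV h'"
  shows "(LINT x|lebesgue_on I. h' x) = 0"
proof -
  obtain a where a: "K \<subseteq> {-a..a}" using bounded_subset_cbox_symmetric[OF compact_imp_bounded[OF K(1)]] by auto
  define b where "b = max a 0 + 1"
  have b: "b > 0" "K \<subseteq> {-b..b}" "b \<notin> K" "- b \<notin> K" using a by (auto simp: b_def subset_iff)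
  have mK: "K \<in> sets lebesgue" using K(1) by (simp add: compact_imp_closed lebesgue_closedin)
  have "(LINT x|lebesgue_on I. h' x) = (LINT x|lebesgue_on {-b..b}. h' x)"
    using lebesgue_on_support(2)[OF K(2) mK I, of h'] lebesgue_on_support(2)[OF b(2) mK, of h'] K(4) by simp
  also have "\<dots> = integral {-b..b} h'"
    by (intro lebesgue_integral_eq_integral continuous_imp_integrable_real continuous_on_subset[OF h']) auto
  also have "(h' has_integral (h b - h (- b))) {-b..b}"
    by (rule fundamental_theorem_of_calculus)
       (use b h in \<open>auto simp: has_real_derivative_iff_has_vector_derivative intro: has_vector_derivative_at_within\<close>)
  then have "integral {-b..b} h' = 0" using b K(3) by (simp add: integral_unique)
  finally show ?thesis .
qed

text \<open>
  Integration by parts: the integral of the derivative of \<open>\<psi> \<phi>\<close> vanishes for every test function \<open>\<psi>\<close>.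
\<close>

lemma weak_pair_test_function:
  assumes \<phi>: "smooth \<phi>" "continuous_on UNIV (deriv \<phi>)" and I: "I \<in> sets lebesgue"
  shows "weak_pair I (\<lambda>x. \<phi> x *\<^sub>R z) (\<lambda>x. deriv \<phi> x *\<^sub>R (z :: 'b::euclidean_space))"
  unfolding weak_pair_def
proof (intro allI impI)
  fix \<psi> assume \<psi>: "test_function I \<psi>"
  have d\<phi>: "(\<phi> has_real_derivative deriv \<phi> x) (at x)" for x
    using \<phi>(1)[unfolded smooth_def, rule_format, of 0 x] by (simp add: DERIV_deriv_iff_real_differentiable)
  have \<phi>_cont: "continuous_on UNIV \<phi>" by (intro continuous_at_imp_continuous_on ballI DERIV_isCont[OF d\<phi>])
  note \<psi>' = test_function_derivative[OF \<psi>]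
  obtain K where K: "compact K" "K \<subseteq> interior I" "\<And>x. x \<notin> K \<Longrightarrow> \<psi> x = 0" "\<And>x. x \<notin> K \<Longrightarrow> deriv \<psi> x = 0"
    by (rule test_function_support[OF \<psi>]) (rule that; assumption)
  have KI: "K \<subseteq> I" using K(2) interior_subset by blast
  have int: "integrable (lebesgue_on I) (\<lambda>x. f x)" if "continuous_on UNIV f" "\<And>x. x \<notin> K \<Longrightarrow> f x = 0" for f :: "real \<Rightarrow> real"
  proof -
    obtain a where pq: "K \<subseteq> {- a..a}" using bounded_subset_cbox_symmetric[OF compact_imp_bounded[OF K(1)]] by auto
    have mK: "K \<in> sets lebesgue" using K(1) by (simp add: compact_imp_closed lebesgue_closedin)
    have "integrable (lebesgue_on {- a..a}) f"
      by (intro continuous_imp_integrable_real continuous_on_subset[OF that(1)]) simp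
    then have "integrable (lebesgue_on K) f" by (rule integrable_lebesgue_on_subset[OF _ pq mK]) simp
    then show ?thesis by (subst lebesgue_on_support(1)[OF KI mK I]) (use that(2) in auto)
  qed
  have i: "integrable (lebesgue_on I) (\<lambda>x. deriv \<psi> x * \<phi> x)" "integrable (lebesgue_on I) (\<lambda>x. \<psi> x * deriv \<phi> x)"
    by (rule int, intro continuous_intros \<psi>' \<phi>_cont \<phi>(2), simp add: K)+
  have "(LINT x|lebesgue_on I. deriv \<psi> x * \<phi> x + \<psi> x * deriv \<phi> x) = 0"
  proof (rule compact_support_integral_deriv[OF _ K(1) KI _ _ I])
    show "((\<lambda>x. \<psi> x * \<phi> x) has_real_derivative deriv \<psi> x * \<phi> x + \<psi> x * deriv \<phi> x) (at x)" for x
      using DERIV_mult[OF \<psi>'(1) d\<phi>] by (simp add: algebra_simps)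
    show "continuous_on UNIV (\<lambda>x. deriv \<psi> x * \<phi> x + \<psi> x * deriv \<phi> x)"
      by (intro continuous_intros \<psi>' \<phi>_cont \<phi>(2))
  qed (use K in auto)
  then have eq: "(LINT x|lebesgue_on I. deriv \<psi> x * \<phi> x) = - (LINT x|lebesgue_on I. \<psi> x * deriv \<phi> x)"
    using i by (simp add: add_eq_0_iff)
  then show "(LINT x|lebesgue_on I. deriv \<psi> x *\<^sub>R \<phi> x *\<^sub>R z) = - (LINT x|lebesgue_on I. \<psi> x *\<^sub>R deriv \<phi> x *\<^sub>R z)"
    using i by (simp add: eq)
qed

lemma weak_pair_const: "I \<in> sets lebesgue \<Longrightarrow> weak_pair I (\<lambda>x. z) (\<lambda>x. 0 :: 'b::euclidean_space)"
proof -
  assume I: "I \<in> sets lebesgue"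
  have 0: "deriv (\<lambda>x::real. k::real) = (\<lambda>x. 0)" for k by auto
  have "(deriv ^^ n) (\<lambda>x::real. 1::real) = (\<lambda>x. if n = 0 then 1 else 0)" for n
    by (induction n) (auto simp: 0)
  then have "smooth (\<lambda>x. 1)" by (simp add: smooth_def)
  from weak_pair_test_function[OF this _ I, of z] show ?thesis by (simp add: 0)
qed

lemma weak_pair_add:
  assumes "weak_pair I u du" "weak_pair I v dv" and I: "I \<in> sets lebesgue"
    and s: "sq_integrable (lebesgue_on I) u" "sq_integrable (lebesgue_on I) du"
       "sq_integrable (lebesgue_on I) v" "sq_integrable (lebesgue_on I) dv"
  shows "weak_pair I (\<lambda>x. u x + v x) (\<lambda>x. du x + dv x)"
  unfolding weak_pair_def
proof (intro allI impI)
  fix \<phi> assume \<phi>: "test_function I \<phi>"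
  note sq = test_function_sq_integrable[OF \<phi> I]
  show "(LINT x|lebesgue_on I. deriv \<phi> x *\<^sub>R (u x + v x)) = - (LINT x|lebesgue_on I. \<phi> x *\<^sub>R (du x + dv x))"
    using assms(1,2) \<phi> sq s by (simp add: weak_pair_def scaleR_add_right sq_integrable_scaleR_product)
qed

lemma weak_pair_linear:
  fixes h :: "'b::euclidean_space \<Rightarrow> 'c::euclidean_space"
  assumes "weak_pair I u du" "bounded_linear h" and I: "I \<in> sets lebesgue"
    and s: "sq_integrable (lebesgue_on I) u" "sq_integrable (lebesgue_on I) du"
  shows "weak_pair I (\<lambda>x. h (u x)) (\<lambda>x. h (du x))"
  unfolding weak_pair_def
proof (intro allI impI)
  fix \<phi> assume \<phi>: "test_function I \<phi>"
  note sq = test_function_sq_integrable[OF \<phi> I]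
  interpret h: bounded_linear h by (rule assms(2))
  have "(LINT x|lebesgue_on I. deriv \<phi> x *\<^sub>R h (u x)) = h (LINT x|lebesgue_on I. deriv \<phi> x *\<^sub>R u x)"
    using integral_bounded_linear[OF assms(2) sq_integrable_scaleR_product[OF sq(2) s(1)]] by (simp add: h.scaleR)
  moreover have "(LINT x|lebesgue_on I. \<phi> x *\<^sub>R h (du x)) = h (LINT x|lebesgue_on I. \<phi> x *\<^sub>R du x)"
    using integral_bounded_linear[OF assms(2) sq_integrable_scaleR_product[OF sq(1) s(2)]] by (simp add: h.scaleR)
  ultimately show "(LINT x|lebesgue_on I. deriv \<phi> x *\<^sub>R h (u x)) = - (LINT x|lebesgue_on I. \<phi> x *\<^sub>R h (du x))"
    using assms(1) \<phi> by (simp add: weak_pair_def h.neg)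
qed

text \<open>
  The product of norms is estimated by the arithmetic mean of \<open>\<delta> \<parallel>\<psi>\<parallel>\<^sup>2\<close> and \<open>\<parallel>v n - l\<parallel>\<^sup>2 / \<delta>\<close>.
\<close>

lemma sq_integrable_mean_limit:
  fixes v :: "nat \<Rightarrow> 'a \<Rightarrow> 'b::euclidean_space"
  assumes \<psi>: "sq_integrable M \<psi>" and v: "\<And>n. sq_integrable M (v n)" "sq_integrable M l"
    and lim: "(\<lambda>n. LINT x|M. (norm (v n x - l x))\<^sup>2) \<longlonglongrightarrow> 0"
  shows "(\<lambda>n. LINT x|M. \<psi> x *\<^sub>R v n x) \<longlonglongrightarrow> (LINT x|M. \<psi> x *\<^sub>R l x)"
proof (rule LIMSEQ_I)
  fix \<epsilon> :: real assume "\<epsilon> > 0"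
  define P where "P = (LINT x|M. (norm (\<psi> x))\<^sup>2)"
  have P: "0 \<le> P" unfolding P_def by (rule Bochner_Integration.integral_nonneg) simp
  define \<delta> where "\<delta> = \<epsilon> / (P + 1)"
  have \<delta>: "\<delta> > 0" using \<open>\<epsilon> > 0\<close> P by (simp add: \<delta>_def)
  obtain N where N: "\<And>n. n \<ge> N \<Longrightarrow> (LINT x|M. (norm (v n x - l x))\<^sup>2) < \<delta>\<^sup>2"
    using order_tendstoD(2)[OF lim, of "\<delta>\<^sup>2"] \<delta> by (auto simp: eventually_sequentially)
  have "norm ((LINT x|M. \<psi> x *\<^sub>R v n x) - (LINT x|M. \<psi> x *\<^sub>R l x)) < \<epsilon>" if "n \<ge> N" for n
  proof -
    have sd: "sq_integrable M (\<lambda>x. v n x - l x)" by (intro sq_integrable_diff v)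
    have "(LINT x|M. \<psi> x *\<^sub>R v n x) - (LINT x|M. \<psi> x *\<^sub>R l x) = (LINT x|M. \<psi> x *\<^sub>R (v n x - l x))"
      using sq_integrable_scaleR_product[OF \<psi> v(1)[of n]] sq_integrable_scaleR_product[OF \<psi> v(2)]
      by (simp add: scaleR_diff_right)
    also have "norm \<dots> \<le> (LINT x|M. norm (\<psi> x *\<^sub>R (v n x - l x)))" by (rule integral_norm_bound)
    also have "\<dots> \<le> (LINT x|M. (\<delta> * (norm (\<psi> x))\<^sup>2 + (norm (v n x - l x))\<^sup>2 / \<delta>) / 2)"
    proof (rule Bochner_Integration.integral_mono)
      show "integrable M (\<lambda>x. norm (\<psi> x *\<^sub>R (v n x - l x)))"
        using sq_integrable_scaleR_product[OF \<psi> sd] by (rule integrable_norm)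
      show "integrable M (\<lambda>x. (\<delta> * (norm (\<psi> x))\<^sup>2 + (norm (v n x - l x))\<^sup>2 / \<delta>) / 2)"
        using sq_integrable_square[OF \<psi>] sq_integrable_square[OF sd] by simp
      fix x
      have "2 * ((\<delta> * norm (\<psi> x)) * norm (v n x - l x)) \<le> (\<delta> * norm (\<psi> x))\<^sup>2 + (norm (v n x - l x))\<^sup>2"
        by (rule two_mult_le_squares)
      then show "norm (\<psi> x *\<^sub>R (v n x - l x)) \<le> (\<delta> * (norm (\<psi> x))\<^sup>2 + (norm (v n x - l x))\<^sup>2 / \<delta>) / 2"
        unfolding norm_scaleR using \<delta> by (simp add: field_simps power2_eq_square)
    qed
    also have "\<dots> = (\<delta> * P + (LINT x|M. (norm (v n x - l x))\<^sup>2) / \<delta>) / 2"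
      using sq_integrable_square[OF \<psi>] sq_integrable_square[OF sd] by (simp add: P_def)
    also have "\<dots> \<le> (\<delta> * P + \<delta>\<^sup>2 / \<delta>) / 2"
      using N[OF that] \<delta> by (intro divide_right_mono add_left_mono) auto
    also have "\<dots> = \<delta> * (P + 1) / 2" using \<delta> by (simp add: power2_eq_square algebra_simps)
    also have "\<delta> * (P + 1) = \<epsilon>" using P by (simp add: \<delta>_def)
    finally show ?thesis using \<open>\<epsilon> > 0\<close> by simp
  qed
  then show "\<exists>N. \<forall>n\<ge>N. norm ((LINT x|M. \<psi> x *\<^sub>R v n x) - (LINT x|M. \<psi> x *\<^sub>R l x)) < \<epsilon>" by blast
qed

lemma weak_pair_limit:
  assumes wp: "\<And>n. weak_pair I (u n) (du n)" and I: "I \<in> sets lebesgue"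
    and s: "\<And>n. sq_integrable (lebesgue_on I) (u n)" "\<And>n. sq_integrable (lebesgue_on I) (du n)"
      "sq_integrable (lebesgue_on I) v" "sq_integrable (lebesgue_on I) dv"
    and lim: "(\<lambda>n. LINT x|lebesgue_on I. (norm (u n x - v x))\<^sup>2) \<longlonglongrightarrow> 0"
      "(\<lambda>n. LINT x|lebesgue_on I. (norm (du n x - dv x))\<^sup>2) \<longlonglongrightarrow> 0"
  shows "weak_pair I v dv"
  unfolding weak_pair_def
proof (intro allI impI)
  fix \<phi> assume \<phi>: "test_function I \<phi>"
  note sq = test_function_sq_integrable[OF \<phi> I]
  have "(\<lambda>n. LINT x|lebesgue_on I. deriv \<phi> x *\<^sub>R u n x) \<longlonglongrightarrow> (LINT x|lebesgue_on I. deriv \<phi> x *\<^sub>R v x)"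
    by (rule sq_integrable_mean_limit[OF sq(2) s(1,3) lim(1)])
  moreover have "(\<lambda>n. - (LINT x|lebesgue_on I. \<phi> x *\<^sub>R du n x)) \<longlonglongrightarrow> - (LINT x|lebesgue_on I. \<phi> x *\<^sub>R dv x)"
    by (intro tendsto_minus sq_integrable_mean_limit[OF sq(1) s(2,4) lim(2)])
  moreover have "(LINT x|lebesgue_on I. deriv \<phi> x *\<^sub>R u n x) = - (LINT x|lebesgue_on I. \<phi> x *\<^sub>R du n x)" for n
    using wp \<phi> by (simp add: weak_pair_def)
  ultimately show "(LINT x|lebesgue_on I. deriv \<phi> x *\<^sub>R v x) = - (LINT x|lebesgue_on I. \<phi> x *\<^sub>R dv x)"
    using LIMSEQ_unique by auto
qed

text \<open>
  A Sobolev inequality: the mean of \<open>w\<close> and its oscillation on \<open>[p, q]\<close> are controlled by the mean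
  squares of \<open>u\<close> and \<open>du\<close>.
\<close>

lemma weak_sup_bound:
  fixes w :: "real \<Rightarrow> 'b::euclidean_space"
  assumes I: "is_interval I" "I \<in> sets lebesgue"
    and u: "sq_integrable (lebesgue_on I) u" and du: "sq_integrable (lebesgue_on I) du"
    and wp: "weak_pair I u du"
    and w: "continuous_on I w" "AE x in lebesgue_on I. w x = u x"
    and pq: "p < q" "{p..q} \<subseteq> I" and \<epsilon>: "\<epsilon> > 0"
    and le: "(LINT x|lebesgue_on I. (norm (u x))\<^sup>2) \<le> \<epsilon>\<^sup>2" "(LINT x|lebesgue_on I. (norm (du x))\<^sup>2) \<le> \<epsilon>\<^sup>2"
    and x: "x \<in> {p..q}"
  shows "norm (w x) \<le> (q - p + 1) / 2 * (1 / (q - p) + 1) * \<epsilon>"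
proof -
  let ?J = "{p..q}"
  let ?M = "lebesgue_on ?J"
  have mean: "integrable ?M v \<and> (LINT x|?M. norm (v x)) \<le> (q - p + 1) / 2 * \<epsilon>"
    if v: "sq_integrable (lebesgue_on I) v" and vle: "(LINT x|lebesgue_on I. (norm (v x))\<^sup>2) \<le> \<epsilon>\<^sup>2" for v :: "real \<Rightarrow> 'b"
  proof
    have vJ: "sq_integrable ?M v" by (rule sq_integrable_subset[OF v pq(2) _ I(2)]) simp
    show vi: "integrable ?M v" by (rule sq_integrable_imp_integrable[OF vJ])
    have const: "(LINT x|?M. k) = k * (q - p)" for k :: real
      using lebesgue_integral_eq_integral[OF continuous_imp_integrable_real[of p q "\<lambda>x. k"]] pq(1)
      by (simp add: mult.commute)
    have ci: "integrable ?M (\<lambda>x. k)" for k :: real by (intro continuous_imp_integrable_real continuous_intros)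
    have "(LINT x|?M. (norm (v x))\<^sup>2) = (LINT x|lebesgue_on I. indicator ?J x *\<^sub>R (norm (v x))\<^sup>2)"
    proof -
      have "(LINT x|lebesgue_on I. indicator ?J x *\<^sub>R (norm (v x))\<^sup>2) = (LINT x|?M. indicator ?J x *\<^sub>R (norm (v x))\<^sup>2)"
        by (rule lebesgue_on_support(2)[OF pq(2) _ I(2)]) auto
      also have "\<dots> = (LINT x|?M. (norm (v x))\<^sup>2)" by (rule Bochner_Integration.integral_cong) auto
      finally show ?thesis ..
    qed
    also have "\<dots> \<le> (LINT x|lebesgue_on I. (norm (v x))\<^sup>2)"
      using sq_integrable_square[OF v]
      by (intro integral_mono_AE' AE_I2) (auto simp: indicator_def)
    finally have vle': "(LINT x|?M. (norm (v x))\<^sup>2) \<le> \<epsilon>\<^sup>2" using vle by simp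
    have "(LINT x|?M. norm (v x)) \<le> (LINT x|?M. (\<epsilon> + (norm (v x))\<^sup>2 / \<epsilon>) / 2)"
    proof (rule Bochner_Integration.integral_mono)
      show "integrable ?M (\<lambda>x. norm (v x))" using vi by simp
      show "integrable ?M (\<lambda>x. (\<epsilon> + (norm (v x))\<^sup>2 / \<epsilon>) / 2)" using sq_integrable_square[OF vJ] ci by simp
      show "norm (v x) \<le> (\<epsilon> + (norm (v x))\<^sup>2 / \<epsilon>) / 2" for x
        using two_mult_le_squares[of \<epsilon> "norm (v x)"] \<epsilon> by (simp add: field_simps power2_eq_square)
    qed
    also have "\<dots> = (\<epsilon> * (q - p) + (LINT x|?M. (norm (v x))\<^sup>2) / \<epsilon>) / 2"
      using sq_integrable_square[OF vJ] ci const by simp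
    also have "\<dots> \<le> (\<epsilon> * (q - p) + \<epsilon>\<^sup>2 / \<epsilon>) / 2"
      using vle' \<epsilon> by (intro divide_right_mono add_left_mono) auto
    also have "\<dots> = (q - p + 1) / 2 * \<epsilon>" using \<epsilon> by (simp add: power2_eq_square field_simps)
    finally show "(LINT x|?M. norm (v x)) \<le> (q - p + 1) / 2 * \<epsilon>" .
  qed
  note mu = mean[OF u le(1)] and mdu = mean[OF du le(2)]
  have osc: "norm (w b - w a) \<le> (LINT x|?M. norm (du x))" if "a \<in> ?J" "b \<in> ?J" "a \<le> b" for a b
  proof -
    have ab: "a \<in> I" "b \<in> I" using that pq by auto
    note F = weak_FTC[OF I u du wp w ab that(3)]
    have "norm (w b - w a) = norm (LINT x|lebesgue_on {a..b}. du x)"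
      using F lebesgue_integral_eq_integral[OF F(2)] by simp
    also have "\<dots> \<le> (LINT x|lebesgue_on {a..b}. norm (du x))" by (rule integral_norm_bound)
    also have "\<dots> = (LINT x|lebesgue_on {a..b}. indicator {a..b} x *\<^sub>R norm (du x))"
      by (rule Bochner_Integration.integral_cong) auto
    also have "\<dots> = (LINT x|?M. indicator {a..b} x *\<^sub>R norm (du x))"
      by (rule lebesgue_on_support(2)[symmetric]) (use that in auto)
    also have "\<dots> \<le> (LINT x|?M. norm (du x))"
      using mdu by (intro integral_mono_AE' AE_I2) (auto simp: indicator_def)
    finally show ?thesis .
  qed
  have osc': "norm (w x) \<le> norm (w y) + (LINT x|?M. norm (du x))" if "y \<in> ?J" for y
  proof -
    have "norm (w x - w y) \<le> (LINT x|?M. norm (du x))"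
      using osc[OF x that] osc[OF that x] by (cases "x \<le> y") (auto simp: norm_minus_commute)
    then show ?thesis using norm_triangle_ineq2[of "w x" "w y"] by linarith
  qed
  have wJ: "continuous_on ?J w" by (rule continuous_on_subset[OF w(1) pq(2)])
  have wi: "integrable ?M (\<lambda>y. norm (w y))" by (intro continuous_imp_integrable_real continuous_intros wJ)
  have ci: "integrable ?M (\<lambda>x. k)" for k :: real by (intro continuous_imp_integrable_real continuous_intros)
  have const: "(LINT x|?M. k) = k * (q - p)" for k :: real
    using lebesgue_integral_eq_integral[OF ci] pq(1) by (simp add: mult.commute)
  have "norm (w x) * (q - p) = (LINT y|?M. norm (w x))" by (simp only: const)
  also have "\<dots> \<le> (LINT y|?M. norm (w y) + (LINT x|?M. norm (du x)))"
    by (rule Bochner_Integration.integral_mono[OF ci Bochner_Integration.integrable_add[OF wi ci]]) (use osc' in auto)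
  also have "\<dots> = (LINT y|?M. norm (w y)) + (LINT x|?M. norm (du x)) * (q - p)"
    by (subst Bochner_Integration.integral_add[OF wi ci]) (simp only: const)
  also have "(LINT y|?M. norm (w y)) = (LINT y|?M. norm (u y))"
  proof (rule integral_cong_AE)
    have "AE x in lebesgue. x \<in> I \<longrightarrow> w x = u x" using w(2) I(2) by (simp add: AE_restrict_space_iff)
    then have "AE x in lebesgue. x \<in> ?J \<longrightarrow> norm (w x) = norm (u x)" by eventually_elim (use pq in auto)
    then show "AE x in ?M. norm (w x) = norm (u x)" by (simp add: AE_restrict_space_iff)
  qed (use wi mu in auto)
  also have "(LINT y|?M. norm (u y)) + (LINT x|?M. norm (du x)) * (q - p)
      \<le> (q - p + 1) / 2 * \<epsilon> + (q - p + 1) / 2 * \<epsilon> * (q - p)"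
    using mu mdu pq by (intro add_mono mult_right_mono) auto
  also have "\<dots> = (q - p + 1) / 2 * (1 / (q - p) + 1) * \<epsilon> * (q - p)"
  proof -
    have "(L + 1) / 2 * \<epsilon> + (L + 1) / 2 * \<epsilon> * L = (L + 1) / 2 * (1 / L + 1) * \<epsilon> * L" if "L > 0" for L :: real
      using that by (simp add: field_simps)
    then show ?thesis using pq(1) by simp
  qed
  finally show ?thesis by (rule mult_right_le_imp_le) (use pq in simp)
qed

text \<open>
  Lebesgue differentiation at the points of the interior; the boundary of an interval is negligible.
\<close>

lemma AE_zero_if_integrals_zero:
  fixes v :: "real \<Rightarrow> real"
  assumes I: "is_interval I" "I \<in> sets lebesgue" and v: "sq_integrable (lebesgue_on I) v"
    and zero: "\<And>a b. a \<in> interior I \<Longrightarrow> b \<in> interior I \<Longrightarrow> a < b \<Longrightarrow> integral {a..b} v = 0"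
  shows "AE x in lebesgue_on I. v x = 0"
proof -
  define h where "h x = indicator I x *\<^sub>R v x" for x
  have "integrable lebesgue (\<lambda>x. indicator I x *\<^sub>R (norm (v x))\<^sup>2)"
    using v I(2) by (simp add: sq_integrable_def integrable_restrict_space)
  moreover have "(\<lambda>x. indicator I x *\<^sub>R (norm (v x))\<^sup>2) = (\<lambda>x. (norm (h x))\<^sup>2)"
    by (intro ext) (auto simp: h_def indicator_def)
  moreover have "h \<in> borel_measurable lebesgue"
    using v I(2) unfolding h_def by (simp add: sq_integrable_def borel_measurable_restrict_space_iff)
  ultimately have sq: "sq_integrable (lebesgue_on UNIV) h" by (simp add: sq_integrable_def lebesgue_on_UNIV_eq)
  have "h integrable_on cbox a b" for a b
    unfolding cbox_interval
    by (rule integrable_on_lebesgue_on[OF sq_integrable_imp_integrable[OF sq_integrable_subset[OF sq]]]) auto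
  then obtain N where N: "negligible N" "\<And>x e. x \<notin> N \<Longrightarrow> 0 < e \<Longrightarrow>
      \<exists>d>0. \<forall>t. 0 < t \<and> t < d \<longrightarrow> norm (integral (cbox x (x + t *\<^sub>R One)) h /\<^sub>R t ^ DIM(real) - h x) < e"
    by (rule integrable_ccontinuous_explicit) (rule that; assumption)
  have zero_v: "v x = 0" if x: "x \<in> interior I" "x \<notin> N" for x
  proof -
    have xI: "x \<in> I" using x interior_subset by blast
    have "\<bar>v x\<bar> \<le> \<epsilon>" if e: "\<epsilon> > 0" for \<epsilon>
    proof -
      obtain d where d: "d > 0" "\<And>t. 0 < t \<Longrightarrow> t < d \<Longrightarrow> norm (integral (cbox x (x + t *\<^sub>R One)) h /\<^sub>R t ^ DIM(real) - h x) < \<epsilon>"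
        using N(2)[OF x(2) e] by blast
      obtain r where r: "r > 0" "cball x r \<subseteq> interior I" using x(1) open_contains_cball[of "interior I"] by auto
      define t where "t = min r (d / 2)"
      have t: "0 < t" "t < d" "t \<le> r" using d(1) r(1) by (auto simp: t_def)
      have sub: "{x..x + t} \<subseteq> interior I" using r(2) t by (auto simp: dist_real_def subset_iff)
      have "integral {x..x + t} h = integral {x..x + t} v"
        by (rule integral_cong) (use sub interior_subset[of I] in \<open>auto simp: h_def indicator_def subset_iff\<close>)
      also have "\<dots> = 0" by (rule zero) (use sub t in auto)
      finally have "norm (0 - h x) < \<epsilon>" using d(2)[OF t(1,2)] by simp
      then show ?thesis using xI by (simp add: h_def)
    qed
    then have "\<bar>v x\<bar> \<le> 0" by (rule dense_ge)
    then show ?thesis by simp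
  qed
  have "negligible (frontier I)" using I(1) by (simp add: is_interval_convex negligible_convex_frontier)
  then have "negligible (N \<union> frontier I)" using N(1) by simp
  then have "AE x in lebesgue. x \<in> I \<longrightarrow> v x = 0"
  proof (intro AE_I'[of "N \<union> frontier I"])
    show "{x \<in> space lebesgue. \<not> (x \<in> I \<longrightarrow> v x = 0)} \<subseteq> N \<union> frontier I"
      using zero_v closure_subset[of I] by (auto simp: frontier_def)
  qed (simp add: negligible_iff_null_sets)
  then show ?thesis using I(2) by (simp add: AE_restrict_space_iff)
qed

section \<open>The Dirac operator is closed and densely defined\<close>

lemma edge_interval_bounded:
  assumes "metric_graph G" "e \<in> bounded_edges G"
  obtains l where "l > 0" "len G e = ereal l" "edge_interval G e = {0..l}"
proof -
  have "0 < len G e" "len G e < \<infinity>" using assms by (auto simp: metric_graph_def bounded_edges_def)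
  then obtain l where "len G e = ereal l" "l > 0" by (cases "len G e") auto
  moreover from this have "edge_interval G e = {0..l}" by (auto simp: edge_interval_def)
  ultimately show ?thesis using that by blast
qed

lemma edge_interval_half_line: "e \<in> half_lines G \<Longrightarrow> edge_interval G e = {0..}"
  by (auto simp: half_lines_def edge_interval_def)

lemma edges_cases: "e \<in> edges G \<Longrightarrow> e \<in> bounded_edges G \<or> e \<in> half_lines G"
  by (auto simp: bounded_edges_def half_lines_def)

lemma bounded_edges_sub: "e \<in> bounded_edges G \<Longrightarrow> e \<in> edges G"
  by (simp add: bounded_edges_def)

lemma edge_interval_props:
  assumes G: "metric_graph G" and e: "e \<in> edges G"
  shows edge_is_interval: "is_interval (edge_interval G e)"
    and edge_lebesgue [measurable]: "edge_interval G e \<in> sets lebesgue"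
    and edge_0: "0 \<in> edge_interval G e" and edge_0_not_interior: "0 \<notin> interior (edge_interval G e)"
    and edge_local: "x \<in> edge_interval G e \<Longrightarrow>
      \<exists>q S. 0 < q \<and> {0..q} \<subseteq> edge_interval G e \<and> x \<in> {0..q} \<and> open S \<and> x \<in> S \<and> edge_interval G e \<inter> S \<subseteq> {0..q}"
proof -
  consider l where "l > 0" "edge_interval G e = {0..l}" | "edge_interval G e = {0..}"
    using edges_cases[OF e] edge_interval_bounded[OF G] edge_interval_half_line by metis
  then have "is_interval (edge_interval G e) \<and> edge_interval G e \<in> sets lebesgue \<and> 0 \<in> edge_interval G e
    \<and> 0 \<notin> interior (edge_interval G e) \<and> (x \<in> edge_interval G e \<longrightarrow>
      (\<exists>q S. 0 < q \<and> {0..q} \<subseteq> edge_interval G e \<and> x \<in> {0..q} \<and> open S \<and> x \<in> S \<and> edge_interval G e \<inter> S \<subseteq> {0..q}))"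
  proof cases
    case 1
    have "x \<in> {0..l} \<longrightarrow> (\<exists>q S. 0 < q \<and> {0..q} \<subseteq> {0..l} \<and> x \<in> {0..q} \<and> open S \<and> x \<in> S \<and> {0..l} \<inter> S \<subseteq> {0..q})"
      using 1(1) by (intro impI exI[of _ l] exI[of _ UNIV]) auto
    then show ?thesis using 1 by (simp add: is_interval_cc)
  next
    case 2
    have "x \<in> {0..} \<longrightarrow> (\<exists>q S. 0 < q \<and> {0..q} \<subseteq> {0..} \<and> x \<in> {0..q} \<and> open S \<and> x \<in> S \<and> {0..} \<inter> S \<subseteq> {0..q})"
      by (intro impI exI[of _ "x + 1"] exI[of _ "{..<x + 1}"]) auto
    then show ?thesis using 2 by (simp add: is_interval_ci)
  qed
  then show "is_interval (edge_interval G e)" "edge_interval G e \<in> sets lebesgue" "0 \<in> edge_interval G e"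
    "0 \<notin> interior (edge_interval G e)"
    "x \<in> edge_interval G e \<Longrightarrow>
      \<exists>q S. 0 < q \<and> {0..q} \<subseteq> edge_interval G e \<and> x \<in> {0..q} \<and> open S \<and> x \<in> S \<and> edge_interval G e \<inter> S \<subseteq> {0..q}"
    by blast+
qed

lemma ends_at_props:
  assumes G: "metric_graph G" and p: "p \<in> ends_at G v"
  shows "fst p \<in> edges G" "snd p \<in> edge_interval G (fst p)" "snd p \<notin> interior (edge_interval G (fst p))"
proof -
  have "fst p \<in> edges G \<and> snd p \<in> edge_interval G (fst p) \<and> snd p \<notin> interior (edge_interval G (fst p))"
  proof (cases "snd p = 0 \<and> fst p \<in> edges G")
    case True
    then show ?thesis using edge_0[OF G] edge_0_not_interior[OF G] by simp
  next
    case False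
    then have e: "fst p \<in> bounded_edges G" and x: "snd p = real_of_ereal (len G (fst p))"
      using p by (auto simp: ends_at_def)
    obtain l where l: "l > 0" "len G (fst p) = ereal l" "edge_interval G (fst p) = {0..l}"
      by (rule edge_interval_bounded[OF G e])
    then show ?thesis using e x by (simp add: bounded_edges_sub)
  qed
  then show "fst p \<in> edges G" "snd p \<in> edge_interval G (fst p)" "snd p \<notin> interior (edge_interval G (fst p))" by auto
qed

text \<open>
  The vertex conditions with edge ends as pairs, a form in which sums and limits distribute.
\<close>

lemma kirchhoff_iff:
  "kirchhoff G w \<longleftrightarrow> (\<forall>v\<in>verts G.
     (\<forall>p\<in>ends_at G v. \<forall>q\<in>ends_at G v. w (fst p) (snd p) $ 1 = w (fst q) (snd q) $ 1) \<and>
     (\<Sum>p\<in>ends_at G v. if snd p = 0 then w (fst p) (snd p) $ 2 else - (w (fst p) (snd p) $ 2)) = 0)"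
  by (simp add: kirchhoff_def case_prod_beta)

lemma kirchhoffI:
  assumes "\<And>v p q. v \<in> verts G \<Longrightarrow> p \<in> ends_at G v \<Longrightarrow> q \<in> ends_at G v \<Longrightarrow> w (fst p) (snd p) $ 1 = w (fst q) (snd q) $ 1"
    and "\<And>v. v \<in> verts G \<Longrightarrow>
     (\<Sum>p\<in>ends_at G v. if snd p = 0 then w (fst p) (snd p) $ 2 else - (w (fst p) (snd p) $ 2)) = 0"
  shows "kirchhoff G w"
  unfolding kirchhoff_iff using assms by blast

lemma kirchhoffD:
  assumes "kirchhoff G w" "v \<in> verts G"
  shows "p \<in> ends_at G v \<Longrightarrow> q \<in> ends_at G v \<Longrightarrow> w (fst p) (snd p) $ 1 = w (fst q) (snd q) $ 1"
    and "(\<Sum>p\<in>ends_at G v. if snd p = 0 then w (fst p) (snd p) $ 2 else - (w (fst p) (snd p) $ 2)) = 0"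
  using assms unfolding kirchhoff_iff by blast+

lemma kirchhoff_zero:
  assumes "\<And>v p. p \<in> ends_at G v \<Longrightarrow> w (fst p) (snd p) = 0"
  shows "kirchhoff G w"
proof (rule kirchhoffI)
  show "w (fst p) (snd p) $ 1 = w (fst q) (snd q) $ 1" if "p \<in> ends_at G v" "q \<in> ends_at G v" for v p q
    by (simp add: assms[OF that(1)] assms[OF that(2)])
  show "(\<Sum>p\<in>ends_at G v. if snd p = 0 then w (fst p) (snd p) $ 2 else - (w (fst p) (snd p) $ 2)) = 0" for v
  proof (intro sum.neutral ballI)
    fix p assume p: "p \<in> ends_at G v"
    show "(if snd p = 0 then w (fst p) (snd p) $ 2 else - (w (fst p) (snd p) $ 2)) = 0"
      unfolding assms[OF p] by simp
  qed
qed

lemma kirchhoff_add: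
  assumes "kirchhoff G w" "kirchhoff G w'"
  shows "kirchhoff G (\<lambda>e x. w e x + w' e x)"
proof (rule kirchhoffI)
  fix v assume v: "v \<in> verts G"
  note k = kirchhoffD[OF assms(1) v] kirchhoffD[OF assms(2) v]
  show "(w (fst p) (snd p) + w' (fst p) (snd p)) $ 1 = (w (fst q) (snd q) + w' (fst q) (snd q)) $ 1"
    if "p \<in> ends_at G v" "q \<in> ends_at G v" for p q
    using k(1)[OF that] k(3)[OF that] by simp
  have "(\<Sum>p\<in>ends_at G v. if snd p = 0 then (w (fst p) (snd p) + w' (fst p) (snd p)) $ 2 else - ((w (fst p) (snd p) + w' (fst p) (snd p)) $ 2))
    = (\<Sum>p\<in>ends_at G v. (if snd p = 0 then w (fst p) (snd p) $ 2 else - (w (fst p) (snd p) $ 2))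
        + (if snd p = 0 then w' (fst p) (snd p) $ 2 else - (w' (fst p) (snd p) $ 2)))"
    by (intro sum.cong refl) simp
  then show "(\<Sum>p\<in>ends_at G v. if snd p = 0 then (w (fst p) (snd p) + w' (fst p) (snd p)) $ 2 else - ((w (fst p) (snd p) + w' (fst p) (snd p)) $ 2)) = 0"
    unfolding sum.distrib k(2) k(4) by simp
qed

lemma kirchhoff_scale:
  assumes "kirchhoff G w"
  shows "kirchhoff G (\<lambda>e x. a *s w e x)"
proof (rule kirchhoffI)
  fix v assume v: "v \<in> verts G"
  note k = kirchhoffD[OF assms v]
  show "(a *s w (fst p) (snd p)) $ 1 = (a *s w (fst q) (snd q)) $ 1"
    if "p \<in> ends_at G v" "q \<in> ends_at G v" for p q
    using k(1)[OF that] by simp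
  have "(\<Sum>p\<in>ends_at G v. if snd p = 0 then (a *s w (fst p) (snd p)) $ 2 else - ((a *s w (fst p) (snd p)) $ 2))
    = (\<Sum>p\<in>ends_at G v. a * (if snd p = 0 then w (fst p) (snd p) $ 2 else - (w (fst p) (snd p) $ 2)))"
    by (intro sum.cong refl) simp
  then show "(\<Sum>p\<in>ends_at G v. if snd p = 0 then (a *s w (fst p) (snd p)) $ 2 else - ((a *s w (fst p) (snd p)) $ 2)) = 0"
    unfolding sum_distrib_left[symmetric] k(2) by simp
qed

lemma kirchhoff_limit:
  assumes G: "metric_graph G" and k: "\<And>n. kirchhoff G (w n)"
    and lim: "\<And>e x. e \<in> edges G \<Longrightarrow> x \<in> edge_interval G e \<Longrightarrow> (\<lambda>n. w n e x) \<longlonglongrightarrow> l e x"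
  shows "kirchhoff G l"
  unfolding kirchhoff_iff
proof (intro ballI conjI)
  fix v assume v: "v \<in> verts G"
  have L: "(\<lambda>n. w n (fst p) (snd p) $ i) \<longlonglongrightarrow> l (fst p) (snd p) $ i" if "p \<in> ends_at G v" for p i
    by (rule tendsto_vec_nth[OF lim]) (use ends_at_props[OF G that] in auto)
  show "l (fst p) (snd p) $ 1 = l (fst q) (snd q) $ 1" if p: "p \<in> ends_at G v" and q: "q \<in> ends_at G v" for p q
  proof (rule LIMSEQ_unique[OF L[OF p]])
    have "w n (fst p) (snd p) $ 1 = w n (fst q) (snd q) $ 1" for n
      using k[of n] v p q unfolding kirchhoff_iff by blast
    then show "(\<lambda>n. w n (fst p) (snd p) $ 1) \<longlonglongrightarrow> l (fst q) (snd q) $ 1" using L[OF q, of 1] by simp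
  qed
  have "(\<lambda>n. \<Sum>p\<in>ends_at G v. if snd p = 0 then w n (fst p) (snd p) $ 2 else - (w n (fst p) (snd p) $ 2))
     \<longlonglongrightarrow> (\<Sum>p\<in>ends_at G v. if snd p = 0 then l (fst p) (snd p) $ 2 else - (l (fst p) (snd p) $ 2))"
  proof (rule tendsto_sum)
    fix p assume "p \<in> ends_at G v"
    then show "(\<lambda>n. if snd p = 0 then w n (fst p) (snd p) $ 2 else - (w n (fst p) (snd p) $ 2))
      \<longlonglongrightarrow> (if snd p = 0 then l (fst p) (snd p) $ 2 else - (l (fst p) (snd p) $ 2))"
      using L[of p 2] by (auto intro: tendsto_minus)
  qed
  moreover have "(\<Sum>p\<in>ends_at G v. if snd p = 0 then w n (fst p) (snd p) $ 2 else - (w n (fst p) (snd p) $ 2)) = 0" for n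
    using k[of n] v unfolding kirchhoff_iff by blast
  ultimately show "(\<Sum>p\<in>ends_at G v. if snd p = 0 then l (fst p) (snd p) $ 2 else - (l (fst p) (snd p) $ 2)) = 0"
    by (simp add: LIMSEQ_const_iff)
qed

text \<open>The Dirac expression is \<open>dirac_kin du + dirac_mass u\<close>, and \<open>dirac_kin_inv\<close> inverts its first part.\<close>

definition dirac_kin :: "real \<Rightarrow> complex ^ 2 \<Rightarrow> complex ^ 2" where
  "dirac_kin c z = (- \<i> * of_real c) *s (pauli1 *v z)"

definition dirac_kin_inv :: "real \<Rightarrow> complex ^ 2 \<Rightarrow> complex ^ 2" where
  "dirac_kin_inv c z = (\<i> / of_real c) *s (pauli1 *v z)"

definition dirac_mass :: "real \<Rightarrow> real \<Rightarrow> complex ^ 2 \<Rightarrow> complex ^ 2" where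
  "dirac_mass m c z = (m * c\<^sup>2) *\<^sub>R (pauli3 *v z)"

lemma dirac_edge_split: "dirac_edge m c u du = dirac_kin c du + dirac_mass m c u"
  by (simp add: dirac_edge_def dirac_kin_def dirac_mass_def)

lemma pauli_nth [simp]:
  "(pauli1 *v z) $ 1 = z $ 2" "(pauli1 *v z) $ 2 = z $ 1"
  "(pauli3 *v z) $ 1 = z $ 1" "(pauli3 *v z) $ 2 = - (z $ 2)"
  by (simp_all add: pauli1_def pauli3_def matrix_vector_mult_def sum_2)

lemma dirac_kin_nth [simp]:
  "dirac_kin c z $ 1 = - \<i> * of_real c * z $ 2" "dirac_kin c z $ 2 = - \<i> * of_real c * z $ 1"
  "dirac_kin_inv c z $ 1 = \<i> / of_real c * z $ 2" "dirac_kin_inv c z $ 2 = \<i> / of_real c * z $ 1"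
  "dirac_mass m c z $ 1 = of_real (m * c\<^sup>2) * z $ 1" "dirac_mass m c z $ 2 = - of_real (m * c\<^sup>2) * z $ 2"
  by (simp_all add: dirac_kin_def dirac_kin_inv_def dirac_mass_def scaleR_conv_of_real[where 'a = complex] del: of_real_mult of_real_power)

lemma bounded_linear_vec2I:
  fixes h :: "complex ^ 2 \<Rightarrow> complex ^ 2"
  assumes "\<And>x y. h (x + y) = h x + h y" "\<And>a x. h (a *s x) = a *s h x"
  shows "bounded_linear h"
proof -
  have r: "r *\<^sub>R x = of_real r *s x" for r and x :: "complex ^ 2" by (simp add: vec_eq_iff scaleR_conv_of_real[where 'a = complex])
  have "linear h" by (rule linearI) (auto simp: assms r)
  then show ?thesis by (simp add: linear_conv_bounded_linear)
qed

lemma dirac_kin_scale: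
  "dirac_kin c (a *s z) = a *s dirac_kin c z" "dirac_kin_inv c (a *s z) = a *s dirac_kin_inv c z"
  "dirac_mass m c (a *s z) = a *s dirac_mass m c z"
  by (auto simp: vec_eq_iff forall_2)

lemma dirac_kin_add:
  "dirac_kin c (z + z') = dirac_kin c z + dirac_kin c z'" "dirac_kin_inv c (z + z') = dirac_kin_inv c z + dirac_kin_inv c z'"
  "dirac_mass m c (z + z') = dirac_mass m c z + dirac_mass m c z'"
  by (auto simp: vec_eq_iff forall_2 algebra_simps add_divide_distrib)

lemma bounded_linear_dirac:
  shows "bounded_linear (dirac_kin c)" and "bounded_linear (dirac_kin_inv c)" and "bounded_linear (dirac_mass m c)"
  using bounded_linear_vec2I[of "dirac_kin c"] bounded_linear_vec2I[of "dirac_kin_inv c"]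
    bounded_linear_vec2I[of "dirac_mass m c"] dirac_kin_add dirac_kin_scale by auto

lemma dirac_kin_inverse:
  assumes "c \<noteq> 0"
  shows "dirac_kin_inv c (dirac_kin c z) = z" "dirac_kin c (dirac_kin_inv c z) = z"
  using assms by (auto simp: vec_eq_iff forall_2 simp flip: mult.assoc)

lemma mean_limit_bounded_linear:
  fixes h :: "'b::euclidean_space \<Rightarrow> 'c::euclidean_space"
  assumes h: "bounded_linear h" and s: "\<And>n. sq_integrable M (v n)" "sq_integrable M l"
    and lim: "(\<lambda>n. LINT x|M. (norm (v n x - l x))\<^sup>2) \<longlonglongrightarrow> 0"
  shows "(\<lambda>n. LINT x|M. (norm (h (v n x) - h (l x)))\<^sup>2) \<longlonglongrightarrow> 0"
proof -
  interpret h: bounded_linear h by (rule h)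
  obtain K where K: "\<And>x. norm (h x) \<le> norm x * K" using h.bounded by blast
  have "(\<lambda>n. K\<^sup>2 * (LINT x|M. (norm (v n x - l x))\<^sup>2)) \<longlonglongrightarrow> K\<^sup>2 * 0" by (intro tendsto_intros lim)
  then have lim': "(\<lambda>n. K\<^sup>2 * (LINT x|M. (norm (v n x - l x))\<^sup>2)) \<longlonglongrightarrow> 0" by simp
  have "norm (LINT x|M. (norm (h (v n x) - h (l x)))\<^sup>2) \<le> K\<^sup>2 * (LINT x|M. (norm (v n x - l x))\<^sup>2)" for n
  proof -
    have sd: "sq_integrable M (\<lambda>x. v n x - l x)" by (intro sq_integrable_diff s)
    have "(LINT x|M. (norm (h (v n x) - h (l x)))\<^sup>2) \<le> (LINT x|M. K\<^sup>2 * (norm (v n x - l x))\<^sup>2)"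
    proof (rule Bochner_Integration.integral_mono)
      show "integrable M (\<lambda>x. (norm (h (v n x) - h (l x)))\<^sup>2)"
        using sq_integrable_square[OF sq_integrable_bounded_linear[OF h sd]] by (simp add: h.diff)
      show "integrable M (\<lambda>x. K\<^sup>2 * (norm (v n x - l x))\<^sup>2)" using sq_integrable_square[OF sd] by simp
      show "(norm (h (v n x) - h (l x)))\<^sup>2 \<le> K\<^sup>2 * (norm (v n x - l x))\<^sup>2" for x
        using power_mono[OF K[of "v n x - l x"], of 2] by (simp add: h.diff power_mult_distrib mult.commute)
    qed
    moreover have "0 \<le> (LINT x|M. (norm (h (v n x) - h (l x)))\<^sup>2)" by (rule Bochner_Integration.integral_nonneg) simp
    ultimately show ?thesis by simp
  qed
  then show ?thesis by (intro Lim_null_comparison[OF always_eventually lim']) auto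
qed

lemma norm_diff_square_le: "(norm (a - b))\<^sup>2 \<le> 2 * (norm a)\<^sup>2 + 2 * (norm (b :: 'b::real_normed_vector))\<^sup>2"
proof -
  have "(norm (a - b))\<^sup>2 \<le> (norm a + norm b)\<^sup>2" by (intro power_mono norm_triangle_ineq4) simp
  then show ?thesis using two_mult_le_squares[of "norm a" "norm b"] by (simp add: power2_sum)
qed

lemma mean_square_diff_le:
  fixes a b :: "'a \<Rightarrow> 'b::euclidean_space"
  assumes "sq_integrable M a" "sq_integrable M b"
  shows "(LINT x|M. (norm (a x - b x))\<^sup>2) \<le> 2 * (LINT x|M. (norm (a x))\<^sup>2) + 2 * (LINT x|M. (norm (b x))\<^sup>2)"
proof -
  have "(LINT x|M. (norm (a x - b x))\<^sup>2) \<le> (LINT x|M. 2 * (norm (a x))\<^sup>2 + 2 * (norm (b x))\<^sup>2)"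
    using sq_integrable_square[OF sq_integrable_diff[OF assms]] sq_integrable_square[OF assms(1)]
      sq_integrable_square[OF assms(2)]
    by (intro Bochner_Integration.integral_mono norm_diff_square_le) auto
  then show ?thesis using sq_integrable_square[OF assms(1)] sq_integrable_square[OF assms(2)] by simp
qed

lemma mean_limit_diff:
  fixes a b :: "nat \<Rightarrow> 'a \<Rightarrow> 'b::euclidean_space"
  assumes s: "\<And>n. sq_integrable M (a n)" "\<And>n. sq_integrable M (b n)" "sq_integrable M l" "sq_integrable M k"
    and lim: "(\<lambda>n. LINT x|M. (norm (a n x - l x))\<^sup>2) \<longlonglongrightarrow> 0" "(\<lambda>n. LINT x|M. (norm (b n x - k x))\<^sup>2) \<longlonglongrightarrow> 0"
  shows "(\<lambda>n. LINT x|M. (norm ((a n x - b n x) - (l x - k x)))\<^sup>2) \<longlonglongrightarrow> 0"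
proof -
  have "(\<lambda>n. 2 * (LINT x|M. (norm (a n x - l x))\<^sup>2) + 2 * (LINT x|M. (norm (b n x - k x))\<^sup>2)) \<longlonglongrightarrow> 2 * 0 + 2 * 0"
    by (intro tendsto_intros lim)
  then have lim': "(\<lambda>n. 2 * (LINT x|M. (norm (a n x - l x))\<^sup>2) + 2 * (LINT x|M. (norm (b n x - k x))\<^sup>2)) \<longlonglongrightarrow> 0"
    by simp
  have "norm (LINT x|M. (norm ((a n x - b n x) - (l x - k x)))\<^sup>2)
      \<le> 2 * (LINT x|M. (norm (a n x - l x))\<^sup>2) + 2 * (LINT x|M. (norm (b n x - k x))\<^sup>2)" for n
  proof -
    have "(\<lambda>x. (norm ((a n x - b n x) - (l x - k x)))\<^sup>2) = (\<lambda>x. (norm ((a n x - l x) - (b n x - k x)))\<^sup>2)"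
      by (simp add: algebra_simps)
    moreover have "0 \<le> (LINT x|M. (norm ((a n x - l x) - (b n x - k x)))\<^sup>2)"
      by (rule Bochner_Integration.integral_nonneg) simp
    ultimately show ?thesis
      using mean_square_diff_le[OF sq_integrable_diff[OF s(1,3)] sq_integrable_diff[OF s(2,4)], of n n]
      by (simp only: real_norm_def abs_of_nonneg)
  qed
  then show ?thesis by (intro Lim_null_comparison[OF always_eventually lim']) auto
qed

lemma mean_limit_Cauchy:
  fixes v :: "nat \<Rightarrow> 'a \<Rightarrow> 'b::euclidean_space"
  assumes s: "\<And>n. sq_integrable M (v n)" "sq_integrable M l"
    and lim: "(\<lambda>n. LINT x|M. (norm (v n x - l x))\<^sup>2) \<longlonglongrightarrow> 0" and "\<epsilon> > 0"
  obtains N where "\<And>j k. j \<ge> N \<Longrightarrow> k \<ge> N \<Longrightarrow> (LINT x|M. (norm (v j x - v k x))\<^sup>2) \<le> \<epsilon>"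
proof -
  obtain N where N: "\<And>n. n \<ge> N \<Longrightarrow> (LINT x|M. (norm (v n x - l x))\<^sup>2) < \<epsilon> / 4"
    using order_tendstoD(2)[OF lim, of "\<epsilon> / 4"] \<open>\<epsilon> > 0\<close> by (auto simp: eventually_sequentially)
  show ?thesis
  proof (rule that)
    fix j k assume "j \<ge> N" "k \<ge> N"
    then show "(LINT x|M. (norm (v j x - v k x))\<^sup>2) \<le> \<epsilon>"
      using mean_square_diff_le[OF sq_integrable_diff[OF s] sq_integrable_diff[OF s], of j k] N[of j] N[of k] by simp
  qed
qed

lemma weak_pair_diff:
  assumes "weak_pair I u du" "weak_pair I v dv" "I \<in> sets lebesgue"
    "sq_integrable (lebesgue_on I) u" "sq_integrable (lebesgue_on I) du"
    "sq_integrable (lebesgue_on I) v" "sq_integrable (lebesgue_on I) dv"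
  shows "weak_pair I (\<lambda>x. u x - v x) (\<lambda>x. du x - dv x)"
  using weak_pair_add[OF assms(1) weak_pair_linear[OF assms(2) bounded_linear_minus[OF bounded_linear_ident] assms(3,6,7)]
      assms(3,4,5) sq_integrable_scaleR[OF assms(6), of "-1", simplified] sq_integrable_scaleR[OF assms(7), of "-1", simplified]]
  by simp

locale dirac_graph =
  fixes G :: "('v, 'e) mgraph" and m c :: real
  assumes graph: "metric_graph G" and c_pos: "c > 0" and m_pos: "m > 0"

sublocale dirac_graph \<subseteq> finite_graph
  using graph by unfold_locales (simp add: metric_graph_def)

context dirac_graph
begin

abbreviation dinv :: "complex ^ 2 \<Rightarrow> complex ^ 2 \<Rightarrow> complex ^ 2" where
  "dinv u f \<equiv> dirac_kin_inv c (f - dirac_mass m c u)"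

lemma dirac_edge_eq_iff: "dirac_edge m c u du = f \<longleftrightarrow> du = dinv u f"
  using dirac_kin_inverse[of c] c_pos by (auto simp: dirac_edge_split)

lemma dinv_sq_integrable:
  "sq_integrable M u \<Longrightarrow> sq_integrable M f \<Longrightarrow> sq_integrable M (\<lambda>x. dinv (u x) (f x))"
  by (intro sq_integrable_bounded_linear[OF bounded_linear_dirac(2)] sq_integrable_diff
      sq_integrable_bounded_linear[OF bounded_linear_dirac(3)])

lemma L2D: "u \<in> L2 G \<Longrightarrow> e \<in> edges G \<Longrightarrow> sq_integrable (edge_measure G e) (u e)"
  by (simp add: L2_iff)

lemma dinv_L2: "u \<in> L2 G \<Longrightarrow> f \<in> L2 G \<Longrightarrow> (\<lambda>e x. dinv (u e x) (f e x)) \<in> L2 G"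
  by (simp add: L2_iff dinv_sq_integrable)

text \<open>
  The Dirac operator as a closed condition: since \<open>f\<close> determines the weak derivative of \<open>u\<close> through
  \<open>dinv\<close>, only the continuous representative is existentially quantified.
\<close>

lemma dirac_iff:
  "(u, f) \<in> dirac G m c \<longleftrightarrow> u \<in> L2 G \<and> f \<in> L2 G \<and>
     (\<forall>e\<in>edges G. weak_pair (edge_interval G e) (u e) (\<lambda>x. dinv (u e x) (f e x))) \<and>
     (\<exists>w. (\<forall>e\<in>edges G. continuous_on (edge_interval G e) (w e)) \<and> ae_eq G w u \<and> kirchhoff G w)"
  (is "_ \<longleftrightarrow> ?R")
proof
  assume "(u, f) \<in> dirac G m c"
  then obtain du where u: "u \<in> dirac_dom G" and f: "f \<in> L2 G" and du: "du \<in> L2 G" "weak_deriv G u du"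
    and eq: "ae_eq G f (\<lambda>e x. dirac_edge m c (u e x) (du e x))" by (auto simp: dirac_def)
  have uL: "u \<in> L2 G" using u by (auto simp: dirac_dom_def H1_def)
  have "weak_pair (edge_interval G e) (u e) (\<lambda>x. dinv (u e x) (f e x))" if e: "e \<in> edges G" for e
    unfolding weak_pair_def
  proof (intro allI impI)
    fix \<phi> assume \<phi>: "test_function (edge_interval G e) \<phi>"
    have "(LINT x|edge_measure G e. deriv \<phi> x *\<^sub>R u e x) = - (LINT x|edge_measure G e. \<phi> x *\<^sub>R du e x)"
      using du(2) e \<phi> by (simp add: weak_deriv_def)
    also have "(LINT x|edge_measure G e. \<phi> x *\<^sub>R du e x) = (LINT x|edge_measure G e. \<phi> x *\<^sub>R dinv (u e x) (f e x))"
    proof (rule integral_cong_AE)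
      note sq = test_function_sq_integrable(1)[OF \<phi> edge_lebesgue[OF graph e]]
      show "(\<lambda>x. \<phi> x *\<^sub>R du e x) \<in> borel_measurable (edge_measure G e)"
        by (intro borel_measurable_integrable sq_integrable_scaleR_product sq L2D[OF du(1) e])
      show "(\<lambda>x. \<phi> x *\<^sub>R dinv (u e x) (f e x)) \<in> borel_measurable (edge_measure G e)"
        by (intro borel_measurable_integrable sq_integrable_scaleR_product sq dinv_sq_integrable L2D[OF uL e] L2D[OF f e])
      have "AE x in edge_measure G e. f e x = dirac_edge m c (u e x) (du e x)" using eq e by (simp add: ae_eq_def)
      then show "AE x in edge_measure G e. \<phi> x *\<^sub>R du e x = \<phi> x *\<^sub>R dinv (u e x) (f e x)"
        by eventually_elim (metis dirac_edge_eq_iff)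
    qed
    finally show "(LINT x|edge_measure G e. deriv \<phi> x *\<^sub>R u e x) = - (LINT x|edge_measure G e. \<phi> x *\<^sub>R dinv (u e x) (f e x))" .
  qed
  then show ?R using u uL f by (auto simp: dirac_dom_def)
next
  assume R: ?R
  let ?du = "\<lambda>e x. dinv (u e x) (f e x)"
  have du: "?du \<in> L2 G" "weak_deriv G u ?du" using R dinv_L2 by (auto simp: weak_deriv_iff)
  have "dirac_edge m c (u e x) (?du e x) = f e x" for e x by (simp add: dirac_edge_eq_iff)
  then have "ae_eq G f (\<lambda>e x. dirac_edge m c (u e x) (?du e x))" by (simp add: ae_eq_def)
  moreover have "u \<in> dirac_dom G" using R du by (auto simp: dirac_dom_def H1_def)
  ultimately show "(u, f) \<in> dirac G m c" using R du unfolding dirac_def by blast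
qed

lemma dirac_sub: "dirac G m c \<subseteq> L2 G \<times> L2 G"
  by (auto simp: dirac_iff)

lemma dirac_add:
  assumes "(u, f) \<in> dirac G m c" "(v, g) \<in> dirac G m c"
  shows "(u + v, f + g) \<in> dirac G m c"
proof -
  obtain w w' where w: "\<forall>e\<in>edges G. continuous_on (edge_interval G e) (w e)" "ae_eq G w u" "kirchhoff G w"
    and w': "\<forall>e\<in>edges G. continuous_on (edge_interval G e) (w' e)" "ae_eq G w' v" "kirchhoff G w'"
    using assms unfolding dirac_iff by blast
  have L: "u \<in> L2 G" "f \<in> L2 G" "v \<in> L2 G" "g \<in> L2 G" using assms by (auto simp: dirac_iff)
  interpret E: bounded_linear "dirac_kin_inv c" by (rule bounded_linear_dirac)
  interpret M: bounded_linear "dirac_mass m c" by (rule bounded_linear_dirac)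
  have "weak_pair (edge_interval G e) ((u + v) e) (\<lambda>x. dinv ((u + v) e x) ((f + g) e x))" if e: "e \<in> edges G" for e
  proof -
    have "dinv ((u + v) e x) ((f + g) e x) = dinv (u e x) (f e x) + dinv (v e x) (g e x)" for x
      by (simp add: M.add E.add[symmetric] algebra_simps)
    moreover have "weak_pair (edge_interval G e) (\<lambda>x. u e x + v e x) (\<lambda>x. dinv (u e x) (f e x) + dinv (v e x) (g e x))"
    proof (intro weak_pair_add edge_lebesgue[OF graph e] L2D[OF _ e] dinv_sq_integrable L)
      show "weak_pair (edge_interval G e) (u e) (\<lambda>x. dinv (u e x) (f e x))"
        "weak_pair (edge_interval G e) (v e) (\<lambda>x. dinv (v e x) (g e x))"
        using assms e unfolding dirac_iff by blast+
    qed (intro dinv_L2 L)+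
    ultimately show ?thesis by (simp add: plus_fun_def)
  qed
  moreover have "ae_eq G (\<lambda>e x. w e x + w' e x) (u + v)"
    unfolding ae_eq_def
  proof
    fix e assume "e \<in> edges G"
    then have "AE x in edge_measure G e. w e x = u e x" "AE x in edge_measure G e. w' e x = v e x"
      using w w' by (auto simp: ae_eq_def)
    then show "AE x in edge_measure G e. w e x + w' e x = (u + v) e x" by eventually_elim simp
  qed
  moreover have "\<forall>e\<in>edges G. continuous_on (edge_interval G e) (\<lambda>x. w e x + w' e x)"
    using w w' by (auto intro: continuous_intros)
  ultimately show ?thesis unfolding dirac_iff
    using L kirchhoff_add[OF w(3) w'(3)] by (auto intro!: H.V_add)
qed

lemma dirac_scale:
  assumes "(u, f) \<in> dirac G m c"
  shows "(\<lambda>e x. a *s u e x, \<lambda>e x. a *s f e x) \<in> dirac G m c"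
proof -
  obtain w where w: "\<forall>e\<in>edges G. continuous_on (edge_interval G e) (w e)" "ae_eq G w u" "kirchhoff G w"
    using assms unfolding dirac_iff by blast
  have L: "u \<in> L2 G" "f \<in> L2 G" using assms by (auto simp: dirac_iff)
  have La: "(\<lambda>e x. a *s u e x) \<in> L2 G" "(\<lambda>e x. a *s f e x) \<in> L2 G"
    using L by (simp_all add: L2_iff sq_integrable_bounded_linear[OF bounded_linear_vec_scale])
  have "weak_pair (edge_interval G e) (\<lambda>x. a *s u e x) (\<lambda>x. dinv (a *s u e x) (a *s f e x))" if e: "e \<in> edges G" for e
  proof -
    have "dinv (a *s u e x) (a *s f e x) = a *s dinv (u e x) (f e x)" for x
      by (simp add: dirac_kin_scale vector_ssub_ldistrib flip: dirac_kin_scale(2))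
    moreover have "weak_pair (edge_interval G e) (\<lambda>x. a *s u e x) (\<lambda>x. a *s dinv (u e x) (f e x))"
      by (intro weak_pair_linear[OF _ bounded_linear_vec_scale] edge_lebesgue[OF graph e] L2D[OF _ e] dinv_sq_integrable L)
         (use assms e in \<open>auto simp: dirac_iff\<close>)
    ultimately show ?thesis by simp
  qed
  moreover have "ae_eq G (\<lambda>e x. a *s w e x) (\<lambda>e x. a *s u e x)"
    unfolding ae_eq_def
  proof
    fix e assume "e \<in> edges G"
    then have "AE x in edge_measure G e. w e x = u e x" using w by (auto simp: ae_eq_def)
    then show "AE x in edge_measure G e. a *s w e x = a *s u e x" by eventually_elim simp
  qed
  moreover have "\<forall>e\<in>edges G. continuous_on (edge_interval G e) (\<lambda>x. a *s w e x)"
    using w(1) bounded_linear.continuous_on[OF bounded_linear_vec_scale] by blast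
  ultimately show ?thesis unfolding dirac_iff
    using La kirchhoff_scale[OF w(3)] by (intro conjI exI[of _ "\<lambda>e x. a *s w e x"]) auto
qed

lemma dirac_rot_closed: "rot_closed (dirac G m c)"
  using dirac_scale[of _ _ \<i>] by (auto simp: rot_closed_def rot_def)

lemma dirac_subspace: "subspace (dirac G m c)"
proof -
  have "kirchhoff G (\<lambda>e x. 0)" by (rule kirchhoff_zero) simp
  then have z: "(0, 0) \<in> dirac G m c" unfolding dirac_iff
    using weak_pair_const[OF edge_lebesgue[OF graph], of _ "0 :: complex ^ 2"]
      linear_0[OF bounded_linear.linear[OF bounded_linear_dirac(2)], of c] linear_0[OF bounded_linear.linear[OF bounded_linear_dirac(3)], of m c]
    by (auto simp: zero_fun_def ae_eq_def L2_iff sq_integrable_zero intro!: exI[of _ "\<lambda>e x. 0"])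
  have "(r *\<^sub>R u, r *\<^sub>R f) \<in> dirac G m c" if "(u, f) \<in> dirac G m c" for r u f
  proof -
    have "r *\<^sub>R u = (\<lambda>e x. of_real r *s u e x)" for u :: "'e spinor"
      by (auto simp: fun_eq_iff vec_eq_iff scaleR_conv_of_real[where 'a = complex])
    then show ?thesis using dirac_scale[OF that, of "of_real r"] by simp
  qed
  then show ?thesis using z dirac_add by (auto simp: subspace_def zero_prod_def)
qed

lemma conv_edge:
  assumes "H.conv s u" "e \<in> edges G"
  shows "(\<lambda>n. LINT x|edge_measure G e. (norm (s n e x - u e x))\<^sup>2) \<longlonglongrightarrow> 0"
proof -
  have "(\<lambda>n. (H.nrm (s n - u))\<^sup>2) \<longlonglongrightarrow> 0\<^sup>2" using assms(1) unfolding H.conv_def by (intro tendsto_power) auto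
  then have lim: "(\<lambda>n. mass G (s n - u)) \<longlonglongrightarrow> 0"
    using H.nrm_sq[OF H.V_diff] H.conv_in[OF assms(1)] by (simp add: rip_self)
  have "norm (LINT x|edge_measure G e. (norm (s n e x - u e x))\<^sup>2) \<le> mass G (s n - u)" for n
  proof -
    have "0 \<le> (LINT x|edge_measure G e. (norm (s n e x - u e x))\<^sup>2)" by (rule Bochner_Integration.integral_nonneg) simp
    moreover have "(LINT x|edge_measure G e. (norm (s n e x - u e x))\<^sup>2) \<le> mass G (s n - u)"
      unfolding mass_def
      by (rule order_trans[OF _ member_le_sum[OF assms(2)]])
         (auto intro!: Bochner_Integration.integral_nonneg finite_edges)
    ultimately show ?thesis by simp
  qed
  then show ?thesis by (intro Lim_null_comparison[OF always_eventually lim]) auto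
qed

text \<open>
  In the graph norm, the continuous representatives converge uniformly on bounded parts of the edges
  by the Sobolev inequality, so the vertex conditions survive.
\<close>

proposition dirac_closed: "H.closed_rel (dirac G m c)"
  unfolding H.closed_rel_def
proof (intro allI impI)
  fix s t u f assume st: "\<forall>n. (s n, t n) \<in> dirac G m c" and su: "H.conv s u" and tf: "H.conv t f"
  have L: "u \<in> L2 G" "f \<in> L2 G" "s n \<in> L2 G" "t n \<in> L2 G" for n
    using H.conv_in[OF su] H.conv_in[OF tf] by auto
  define d where "d n e x = dinv (s n e x) (t n e x)" for n e x
  define d' where "d' e x = dinv (u e x) (f e x)" for e x
  have sq: "sq_integrable (edge_measure G e) (s n e)" "sq_integrable (edge_measure G e) (u e)"
    "sq_integrable (edge_measure G e) (t n e)" "sq_integrable (edge_measure G e) (f e)"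
    "sq_integrable (edge_measure G e) (d n e)" "sq_integrable (edge_measure G e) (d' e)" if "e \<in> edges G" for e n
    using that L by (auto simp: d_def[abs_def] d'_def[abs_def] intro!: L2D dinv_sq_integrable)
  have sl: "(\<lambda>n. LINT x|edge_measure G e. (norm (s n e x - u e x))\<^sup>2) \<longlonglongrightarrow> 0" if "e \<in> edges G" for e
    by (rule conv_edge[OF su that])
  have dl: "(\<lambda>n. LINT x|edge_measure G e. (norm (d n e x - d' e x))\<^sup>2) \<longlonglongrightarrow> 0" if e: "e \<in> edges G" for e
    unfolding d_def d'_def
    by (intro mean_limit_bounded_linear[OF bounded_linear_dirac(2)] mean_limit_diff
        mean_limit_bounded_linear[OF bounded_linear_dirac(3)] sq_integrable_diff
        sq_integrable_bounded_linear[OF bounded_linear_dirac(3)] sq[OF e] conv_edge[OF su e] conv_edge[OF tf e])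
  have wp: "weak_pair (edge_interval G e) (s n e) (d n e)" if "e \<in> edges G" for n e
    using st that by (auto simp: dirac_iff d_def[abs_def])
  have wp': "weak_pair (edge_interval G e) (u e) (d' e)" if e: "e \<in> edges G" for e
    by (rule weak_pair_limit[OF wp[OF e] edge_lebesgue[OF graph e] sq(1)[OF e] sq(5)[OF e] sq(2)[OF e] sq(6)[OF e] sl[OF e] dl[OF e]])
  have "\<forall>n. \<exists>w. (\<forall>e\<in>edges G. continuous_on (edge_interval G e) (w e)) \<and> ae_eq G w (s n) \<and> kirchhoff G w"
    using st by (auto simp: dirac_iff)
  then obtain W where W: "\<And>n e. e \<in> edges G \<Longrightarrow> continuous_on (edge_interval G e) (W n e)" "\<And>n. ae_eq G (W n) (s n)" "\<And>n. kirchhoff G (W n)"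
    by metis
  have Wae: "AE x in edge_measure G e. W n e x = s n e x" if "e \<in> edges G" for n e using W(2) that by (simp add: ae_eq_def)
  define w where "w e x = lim (\<lambda>n. W n e x)" for e x
  have unif: "uniform_limit {0..q} (\<lambda>n. W n e) (w e) sequentially"
    if e: "e \<in> edges G" and q: "0 < q" "{0..q} \<subseteq> edge_interval G e" for e q
  proof -
    have "uniformly_Cauchy_on {0..q} (\<lambda>n. W n e)"
      unfolding uniformly_Cauchy_on_def
    proof (intro allI impI)
      fix \<epsilon>' :: real assume "\<epsilon>' > 0"
      define K where "K = (q - 0 + 1) / 2 * (1 / (q - 0) + 1)"
      have K: "K > 0" unfolding K_def using q by (intro mult_pos_pos divide_pos_pos add_pos_pos) auto
      define \<epsilon> where "\<epsilon> = \<epsilon>' / (2 * K)"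
      have \<epsilon>: "\<epsilon> > 0" using \<open>\<epsilon>' > 0\<close> K by (simp add: \<epsilon>_def)
      then have \<epsilon>2: "\<epsilon>\<^sup>2 > 0" by simp
      obtain N1 where N1: "\<And>j k. j \<ge> N1 \<Longrightarrow> k \<ge> N1 \<Longrightarrow> (LINT x|edge_measure G e. (norm (s j e x - s k e x))\<^sup>2) \<le> \<epsilon>\<^sup>2"
        by (rule mean_limit_Cauchy[OF sq(1)[OF e] sq(2)[OF e] sl[OF e] \<epsilon>2]) (rule that; assumption)
      obtain N2 where N2: "\<And>j k. j \<ge> N2 \<Longrightarrow> k \<ge> N2 \<Longrightarrow> (LINT x|edge_measure G e. (norm (d j e x - d k e x))\<^sup>2) \<le> \<epsilon>\<^sup>2"
        by (rule mean_limit_Cauchy[OF sq(5)[OF e] sq(6)[OF e] dl[OF e] \<epsilon>2]) (rule that; assumption)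
      have "dist (W j e x) (W k e x) < \<epsilon>'" if jk: "j \<ge> max N1 N2" "k \<ge> max N1 N2" and x: "x \<in> {0..q}" for j k x
      proof -
        have "norm (W j e x - W k e x) \<le> (q - 0 + 1) / 2 * (1 / (q - 0) + 1) * \<epsilon>"
        proof (rule weak_sup_bound[where u = "\<lambda>x. s j e x - s k e x" and du = "\<lambda>x. d j e x - d k e x" and w = "\<lambda>x. W j e x - W k e x"
              and I = "edge_interval G e"])
          show "weak_pair (edge_interval G e) (\<lambda>x. s j e x - s k e x) (\<lambda>x. d j e x - d k e x)"
            by (intro weak_pair_diff wp edge_lebesgue[OF graph] sq e)
          show "continuous_on (edge_interval G e) (\<lambda>x. W j e x - W k e x)" by (intro continuous_intros W e)
          show "AE x in edge_measure G e. W j e x - W k e x = s j e x - s k e x"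
            using Wae[OF e, of j] Wae[OF e, of k] by eventually_elim simp
        qed (use jk x q \<epsilon> N1 N2 e in \<open>auto intro!: edge_is_interval edge_lebesgue graph sq_integrable_diff sq\<close>)
        also have "\<dots> = \<epsilon>' / 2" unfolding K_def[symmetric] using K by (simp add: \<epsilon>_def)
        finally show ?thesis using \<open>\<epsilon>' > 0\<close> by (simp add: dist_norm)
      qed
      then show "\<exists>M. \<forall>x\<in>{0..q}. \<forall>j\<ge>M. \<forall>k\<ge>M. dist (W j e x) (W k e x) < \<epsilon>'"
        by blast
    qed
    then have "uniformly_convergent_on {0..q} (\<lambda>n. W n e)" by (rule Cauchy_uniformly_convergent)
    then show ?thesis by (simp add: uniformly_convergent_uniform_limit_iff w_def[abs_def])
  qed
  have wlim: "(\<lambda>n. W n e x) \<longlonglongrightarrow> w e x" if e: "e \<in> edges G" and x: "x \<in> edge_interval G e" for e x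
  proof -
    obtain q S where q: "0 < q" "{0..q} \<subseteq> edge_interval G e" "x \<in> {0..q}" using edge_local[OF graph e x] by blast
    show ?thesis by (rule tendsto_uniform_limitI[OF unif[OF e q(1,2)] q(3)])
  qed
  have wc: "continuous_on (edge_interval G e) (w e)" if e: "e \<in> edges G" for e
    unfolding continuous_on_eq_continuous_within
  proof
    fix x assume x: "x \<in> edge_interval G e"
    obtain q S where q: "0 < q" "{0..q} \<subseteq> edge_interval G e" "x \<in> {0..q}" "open S" "x \<in> S" "edge_interval G e \<inter> S \<subseteq> {0..q}"
      using edge_local[OF graph e x] by blast
    have "continuous_on {0..q} (w e)"
    proof (rule uniform_limit_theorem[OF _ unif[OF e q(1,2)]])
      show "\<forall>\<^sub>F n in sequentially. continuous_on {0..q} (W n e)"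
        using continuous_on_subset[OF W(1)[OF e] q(2)] by simp
    qed simp
    then have "continuous (at x within {0..q}) (w e)" using q(3) by (simp add: continuous_on_eq_continuous_within)
    moreover have "at x within {0..q} = at x within edge_interval G e"
      by (rule at_within_nhd[OF q(5,4)]) (use q(2,6) in auto)
    ultimately show "continuous (at x within edge_interval G e) (w e)" by simp
  qed
  have "ae_eq G w u" unfolding ae_eq_def
  proof
    fix e assume e: "e \<in> edges G"
    have "integrable (edge_measure G e) (\<lambda>x. (norm (s n e x - u e x))\<^sup>2)" for n
      by (intro sq_integrable_square sq_integrable_diff sq[OF e])
    then obtain r where r: "strict_mono r" "AE x in edge_measure G e. (\<lambda>n. (norm (s (r n) e x - u e x))\<^sup>2) \<longlonglongrightarrow> 0"
      using tendsto_L1_AE_subseq[of "edge_measure G e" "\<lambda>n x. (norm (s n e x - u e x))\<^sup>2"] sl[OF e] by auto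
    have "AE x in edge_measure G e. \<forall>n. W n e x = s n e x" using Wae[OF e] by (simp add: AE_all_countable)
    moreover have "AE x in edge_measure G e. x \<in> edge_interval G e" using AE_space[of "edge_measure G e"] by simp
    ultimately show "AE x in edge_measure G e. w e x = u e x" using r(2)
    proof eventually_elim
      fix x assume x: "\<forall>n. W n e x = s n e x" "x \<in> edge_interval G e" "(\<lambda>n. (norm (s (r n) e x - u e x))\<^sup>2) \<longlonglongrightarrow> 0"
      have "(\<lambda>n. sqrt ((norm (s (r n) e x - u e x))\<^sup>2)) \<longlonglongrightarrow> sqrt 0" by (rule tendsto_real_sqrt[OF x(3)])
      then have "(\<lambda>n. norm (W (r n) e x - u e x)) \<longlonglongrightarrow> 0" using x(1) by simp
      then have "(\<lambda>n. W (r n) e x) \<longlonglongrightarrow> u e x" by (simp add: Lim_null[of _ "u e x"] tendsto_norm_zero_iff)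
      moreover have "(\<lambda>n. W (r n) e x) \<longlonglongrightarrow> w e x"
        using LIMSEQ_subseq_LIMSEQ[OF wlim[OF e x(2)] r(1)] by (simp add: o_def)
      ultimately show "w e x = u e x" using LIMSEQ_unique by blast
    qed
  qed
  moreover have "kirchhoff G w" by (rule kirchhoff_limit[OF graph W(3) wlim])
  ultimately show "(u, f) \<in> dirac G m c" unfolding dirac_iff
    using L wp' wc by (intro conjI exI[of _ w]) (auto simp: d'_def[abs_def])
qed

text \<open>
  A function supported inside an edge vanishes at all vertices, so the vertex conditions hold trivially.
\<close>

lemma bump_in_domain:
  assumes \<phi>: "smooth \<phi>" "continuous_on UNIV (deriv \<phi>)" and K: "compact K" "K \<subseteq> interior (edge_interval G e)"
      "\<And>x. x \<notin> K \<Longrightarrow> \<phi> x = 0" and e: "e \<in> edges G"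
  shows "(\<lambda>e' x. if e' = e then \<phi> x *\<^sub>R z else 0) \<in> Domain (dirac G m c)"
proof -
  let ?u = "\<lambda>e' x. if e' = e then \<phi> x *\<^sub>R z else 0"
  let ?du = "\<lambda>e' x. if e' = e then deriv \<phi> x *\<^sub>R z else 0"
  have t: "test_function (edge_interval G e) \<phi>" by (rule test_functionI[OF \<phi>(1) K]) 
  note sq = test_function_sq_integrable[OF t edge_lebesgue[OF graph e]]
  have bl: "bounded_linear (\<lambda>r. r *\<^sub>R z)" by (rule bounded_linear_scaleR_left)
  have if_fun: "(\<lambda>x. if e' = e then h x else 0) = (if e' = e then h else (\<lambda>x. 0))" for e' and h :: "real \<Rightarrow> complex ^ 2" by auto
  have uL: "?u \<in> L2 G" and duL: "?du \<in> L2 G"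
    using sq_integrable_bounded_linear[OF bl sq(1)] sq_integrable_bounded_linear[OF bl sq(2)]
    by (auto simp: L2_iff sq_integrable_zero if_fun)
  have wp: "weak_pair (edge_interval G e') (?u e') (?du e')" if e': "e' \<in> edges G" for e'
    using weak_pair_test_function[OF \<phi> edge_lebesgue[OF graph e], of z] weak_pair_const[OF edge_lebesgue[OF graph e'], of "0 :: complex ^ 2"]
    by (simp add: if_fun)
  define f where "f e' x = dirac_edge m c (?u e' x) (?du e' x)" for e' x
  have du_eq: "dinv (?u e' x) (f e' x) = ?du e' x" for e' x
    using dirac_edge_eq_iff[of "?u e' x" "?du e' x" "f e' x"] by (simp add: f_def)
  have fL: "f \<in> L2 G" unfolding f_def[abs_def] dirac_edge_split L2_iff
    by (intro ballI sq_integrable_add sq_integrable_bounded_linear[OF bounded_linear_dirac(1)]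
        sq_integrable_bounded_linear[OF bounded_linear_dirac(3)] L2D[OF uL] L2D[OF duL])
  have cont: "continuous_on (edge_interval G e') (?u e')" for e'
    using test_function_derivative(2)[OF t] by (cases "e' = e") (auto intro!: continuous_intros)
  have "?u (fst p) (snd p) = 0" if "p \<in> ends_at G v" for p v
    using ends_at_props(3)[OF graph that] K(2,3) by auto
  then have "kirchhoff G ?u" by (rule kirchhoff_zero)
  then have "(?u, f) \<in> dirac G m c" unfolding dirac_iff
    using uL fL wp cont by (intro conjI exI[of _ ?u]) (auto simp: du_eq ae_eq_def)
  then show ?thesis by blast
qed

text \<open>A spinor orthogonal to the bump functions has vanishing integrals over all intervals.\<close>

proposition dirac_dense: "H.dense_dom (dirac G m c)"
proof (subst H.dense_dom_iff[OF dirac_subspace dirac_sub], intro ballI impI)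
  fix v assume v: "v \<in> L2 G" and o: "\<forall>u\<in>Domain (dirac G m c). rip G v u = 0"
  have zero: "AE x in edge_measure G e. inner (v e x) z = 0" if e: "e \<in> edges G" for e z
  proof (rule AE_zero_if_integrals_zero[OF edge_is_interval[OF graph e] edge_lebesgue[OF graph e]])
    let ?I = "edge_interval G e"
    show sv: "sq_integrable (edge_measure G e) (\<lambda>x. inner (v e x) z)"
      by (rule sq_integrable_bounded_linear[OF bounded_linear_inner_left L2D[OF v e]])
    fix a b assume ab: "a \<in> interior ?I" "b \<in> interior ?I" "a < b"
    obtain d where d: "d > 0" "cball b d \<subseteq> interior ?I" using ab(2) open_contains_cball[of "interior ?I"] by auto
    have "is_interval (interior ?I)" using edge_is_interval[OF graph e] by (simp add: is_interval_convex_1 convex_interior)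
    moreover have "b + d \<in> interior ?I" using d by (auto simp: dist_real_def subset_iff)
    ultimately have JI: "{a..b + d} \<subseteq> interior ?I"
      using ab(1) unfolding is_interval_1 by (meson atLeastAtMost_iff subsetI)
    then have JI': "{a..b + d} \<subseteq> ?I" using interior_subset by blast
    obtain \<phi> \<phi>' :: "nat \<Rightarrow> real \<Rightarrow> real" where \<phi>:
      "\<And>n x. (\<phi> n has_real_derivative \<phi>' n x) (at x)" "\<And>n. smooth (\<phi> n)"
      "\<And>n x. x \<le> a \<or> b + d \<le> x \<Longrightarrow> \<phi> n x = 0 \<and> \<phi>' n x = 0" "\<And>n x. \<bar>\<phi> n x\<bar> \<le> 1"
      "\<And>x. (\<lambda>n. \<phi> n x) \<longlonglongrightarrow> indicator {a<..b} x" "\<And>n. continuous_on UNIV (\<phi>' n)"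
      "\<And>w :: real \<Rightarrow> real. continuous_on {a..b + d} w \<Longrightarrow>
         (\<lambda>n. LINT x|lebesgue_on {a..b + d}. \<phi>' n x *\<^sub>R w x) \<longlonglongrightarrow> w a - w b"
      by (rule bump_sequence[OF ab(3) d(1), where 'b = real]) (rule that; assumption)
    have deriv: "deriv (\<phi> n) = \<phi>' n" for n using \<phi>(1) by (auto intro: DERIV_imp_deriv)
    have meas: "\<phi> n \<in> borel_measurable borel" for n
      by (intro borel_measurable_continuous_onI continuous_at_imp_continuous_on ballI DERIV_isCont[OF \<phi>(1)])
    have "(LINT x|edge_measure G e. \<phi> n x *\<^sub>R inner (v e x) z) = 0" for n
    proof -
      let ?u = "\<lambda>e' x. if e' = e then \<phi> n x *\<^sub>R z else 0"
      have "?u \<in> Domain (dirac G m c)"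
        by (rule bump_in_domain[OF \<phi>(2) _ compact_Icc JI _ e]) (use \<phi>(3)[of _ n] \<phi>(6) deriv in auto)
      then have "rip G v ?u = 0" using o by blast
      also have "rip G v ?u = (\<Sum>e'\<in>edges G. if e' = e then LINT x|edge_measure G e. \<phi> n x *\<^sub>R inner (v e x) z else 0)"
        unfolding rip_def by (intro sum.cong refl) auto
      also have "\<dots> = (LINT x|edge_measure G e. \<phi> n x *\<^sub>R inner (v e x) z)" using e finite_edges by simp
      finally show ?thesis by simp
    qed
    moreover have "(\<lambda>n. LINT x|edge_measure G e. \<phi> n x *\<^sub>R inner (v e x) z) \<longlonglongrightarrow> integral {a..b} (\<lambda>x. inner (v e x) z)"
      by (rule bump_integral_limit[OF ab(3) d(1) JI' edge_lebesgue[OF graph e] sv meas _ \<phi>(4,5)]) (use \<phi>(3) in auto)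
    ultimately show "integral {a..b} (\<lambda>x. inner (v e x) z) = 0"
      by (simp add: LIMSEQ_const_iff)
  qed
  have "(LINT x|edge_measure G e. (norm (v e x))\<^sup>2) = 0" if e: "e \<in> edges G" for e
  proof -
    have "AE x in edge_measure G e. \<forall>z\<in>Basis. inner (v e x) z = 0"
      using zero[OF e] by (simp add: AE_finite_all)
    then have "AE x in edge_measure G e. (norm (v e x))\<^sup>2 = 0"
      by eventually_elim (simp add: euclidean_all_zero_iff)
    then have "(LINT x|edge_measure G e. (norm (v e x))\<^sup>2) = (LINT x|edge_measure G e. 0)"
      by (intro integral_cong_AE) (use sq_integrable_square[OF L2D[OF v e]] in auto)
    then show ?thesis by simp
  qed
  then show "rip G v v = 0" by (simp add: rip_self mass_def)
qed

end

section \<open>Simple cycles in the support of a circulation\<close>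

definition circulation :: "'e set \<Rightarrow> ('e \<Rightarrow> 'v) \<Rightarrow> ('e \<Rightarrow> 'v) \<Rightarrow> ('e \<Rightarrow> 'a::real_vector) \<Rightarrow> bool" where
  "circulation F s t f \<longleftrightarrow>
     (\<forall>v. (\<Sum>e\<in>F. (if s e = v then f e else 0) - (if t e = v then f e else 0)) = 0)"

text \<open>
  A nonzero circulation supported on a simple cycle. Counting the ends at every vertex makes the
  property stable under undoing the contraction of an edge.
\<close>

definition simple_cycle :: "'e set \<Rightarrow> ('e \<Rightarrow> 'v) \<Rightarrow> ('e \<Rightarrow> 'v) \<Rightarrow> ('e \<Rightarrow> real) \<Rightarrow> bool" where
  "simple_cycle F s t g \<longleftrightarrow> circulation F s t g \<and> (\<forall>e\<in>F. g e \<in> {-1, 0, 1}) \<and> (\<exists>e\<in>F. g e \<noteq> 0) \<and>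
     (\<forall>v. (\<Sum>e\<in>F. (if s e = v then \<bar>g e\<bar> else 0) + (if t e = v then \<bar>g e\<bar> else 0)) \<le> 2)"

lemma circulation_insert_zero:
  assumes "finite F" "e \<notin> F" "f e = 0"
  shows "circulation (insert e F) s t f \<longleftrightarrow> circulation F s t f"
  using assms by (simp add: circulation_def)

text \<open>
  Induction on the number of edges. Edges that carry no flow are deleted, and a loop is a simple
  cycle. Otherwise some edge \<open>e\<close> from \<open>a\<close> to \<open>b \<noteq> a\<close> is contracted. A circulation of the contracted
  graph extends uniquely to \<open>e\<close>, by the flow that balances \<open>b\<close>. For a simple cycle this flow is
  \<open>-1\<close>, \<open>0\<close> or \<open>1\<close>: the merged vertex has at most two ends with opposite flows, so that at \<open>b\<close> there is
  at most one unbalanced end.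
\<close>

theorem circulation_imp_simple_cycle:
  fixes f :: "'e \<Rightarrow> 'a::real_vector"
  assumes "finite F" "circulation F s t f" "\<exists>e\<in>F. f e \<noteq> 0"
  shows "\<exists>g. simple_cycle F s t g"
  using assms
proof (induction "card F" arbitrary: F s t)
  case 0
  then show ?case by simp
next
  case (Suc n)
  note fin = \<open>finite F\<close>
  show ?case
  proof (cases "\<exists>e\<in>F. s e = t e")
    case True
    then obtain e where e: "e \<in> F" "s e = t e" by blast
    let ?g = "\<lambda>e'. if e' = e then 1 else 0 :: real"
    have "circulation F s t ?g" unfolding circulation_def
      using e(2) by (intro allI sum.neutral) auto
    moreover have "(\<Sum>e'\<in>F. (if s e' = v then \<bar>?g e'\<bar> else 0) + (if t e' = v then \<bar>?g e'\<bar> else 0)) \<le> 2" for v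
    proof -
      have "(\<Sum>e'\<in>F. (if s e' = v then \<bar>?g e'\<bar> else 0) + (if t e' = v then \<bar>?g e'\<bar> else 0))
        \<le> (\<Sum>e'\<in>F. if e' = e then 2 else 0)" by (rule sum_mono) auto
      then show ?thesis using e(1) fin by simp
    qed
    ultimately show ?thesis using e(1) unfolding simple_cycle_def by (intro exI[of _ ?g]) auto
  next
    case no_loop: False
    show ?thesis
    proof (cases "\<exists>e\<in>F. f e = 0")
      case True
      then obtain e where e: "e \<in> F" "f e = 0" by blast
      define F' where "F' = F - {e}"
      have F: "F = insert e F'" "e \<notin> F'" "finite F'" using e fin by (auto simp: F'_def)
      have "n = card F'" using Suc(2) F by simp
      moreover have "circulation F' s t f" using Suc.prems(2) circulation_insert_zero[OF F(3,2), of f s t] e F(1) by simp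
      moreover have "\<exists>e\<in>F'. f e \<noteq> 0" using Suc.prems(3) F e by auto
      ultimately obtain g where g: "simple_cycle F' s t g" using Suc(1) F(3) by blast
      let ?g = "g(e := 0)"
      have eq: "?g x = g x" if "x \<in> F'" for x using that F by auto
      have "circulation F' s t ?g"
      proof -
        have "(\<Sum>e'\<in>F'. (if s e' = v then ?g e' else 0) - (if t e' = v then ?g e' else 0))
          = (\<Sum>e'\<in>F'. (if s e' = v then g e' else 0) - (if t e' = v then g e' else 0))" for v
          using eq by (intro sum.cong refl) auto
        then show ?thesis using g unfolding simple_cycle_def circulation_def by presburger
      qed
      then have "circulation F s t ?g" using circulation_insert_zero[OF F(3,2), of ?g s t] F(1) by simp
      moreover have "(\<Sum>e\<in>F. (if s e = v then \<bar>?g e\<bar> else 0) + (if t e = v then \<bar>?g e\<bar> else 0)) \<le> 2" for v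
      proof -
        have "(\<Sum>e\<in>F. (if s e = v then \<bar>?g e\<bar> else 0) + (if t e = v then \<bar>?g e\<bar> else 0))
          = (\<Sum>e\<in>F'. (if s e = v then \<bar>?g e\<bar> else 0) + (if t e = v then \<bar>?g e\<bar> else 0))"
          using F by simp
        also have "\<dots> = (\<Sum>e\<in>F'. (if s e = v then \<bar>g e\<bar> else 0) + (if t e = v then \<bar>g e\<bar> else 0))"
          using eq by (intro sum.cong) auto
        finally show ?thesis using g by (simp add: simple_cycle_def)
      qed
      ultimately have "simple_cycle F s t ?g" using g F eq by (auto simp: simple_cycle_def)
      then show ?thesis by blast
    next
      case nonzero: False
      obtain e where e: "e \<in> F" using Suc.prems(3) by blast
      define F' where "F' = F - {e}"
      have F: "F = insert e F'" "e \<notin> F'" "finite F'" using e fin by (auto simp: F'_def)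
      define a where "a = s e"
      define b where "b = t e"
      have ab: "a \<noteq> b" using no_loop e by (auto simp: a_def b_def)
      \<comment> \<open>the contraction, which moves \<open>b\<close> to \<open>a\<close>\<close>
      define c where "c v = (if v = b then a else v)" for v
      \<comment> \<open>the flow out of \<open>v\<close> along the edges of \<open>F'\<close>\<close>
      define out where "out h v = (\<Sum>e\<in>F'. (if s e = v then h e else 0) - (if t e = v then h e else 0))"
        for h :: "'e \<Rightarrow> 'a" and v
      define outr where "outr h v = (\<Sum>e\<in>F'. (if s e = v then h e else 0) - (if t e = v then h e else 0))"
        for h :: "'e \<Rightarrow> real" and v
      define deg where "deg h v = (\<Sum>e\<in>F'. (if s e = v then \<bar>h e\<bar> else 0) + (if t e = v then \<bar>h e\<bar> else 0))"
        for h :: "'e \<Rightarrow> real" and v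
      have contract: "(if c x = v then h else 0) = (if v = b then 0 else if v = a then (if x = a then h else 0) + (if x = b then h else 0)
          else if x = v then h else 0)" for x v and h :: "'c::real_vector"
        using ab by (auto simp: c_def)
      have out_c: "(\<Sum>e\<in>F'. (if c (s e) = v then h e else 0) - (if c (t e) = v then h e else 0))
          = (if v = b then 0 else if v = a then out h a + out h b else out h v)" for h v
        unfolding contract out_def by (simp add: sum.distrib sum_subtractf)
      have outr_c: "(\<Sum>e\<in>F'. (if c (s e) = v then h e else 0) - (if c (t e) = v then h e else 0))
          = (if v = b then 0 else if v = a then outr h a + outr h b else outr h v)" for h v
        unfolding contract outr_def by (simp add: sum.distrib sum_subtractf)
      have deg_c: "(\<Sum>e\<in>F'. (if c (s e) = v then \<bar>h e\<bar> else 0) + (if c (t e) = v then \<bar>h e\<bar> else 0))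
          = (if v = b then 0 else if v = a then deg h a + deg h b else deg h v)" for h v
        unfolding contract deg_def by (simp add: sum.distrib)
      have full: "(\<Sum>e\<in>F. (if s e = v then h e else 0) - (if t e = v then h e else 0))
          = (if v = a then h e else 0) - (if v = b then h e else 0) + out h v" for h v
        using F by (auto simp: out_def a_def b_def)
      have fullr: "(\<Sum>e\<in>F. (if s e = v then h e else 0) - (if t e = v then h e else 0))
          = (if v = a then h e else 0) - (if v = b then h e else 0) + outr h v" for h v
        using F by (auto simp: outr_def a_def b_def)
      have fulld: "(\<Sum>e\<in>F. (if s e = v then \<bar>h e\<bar> else 0) + (if t e = v then \<bar>h e\<bar> else 0))
          = (if v = a then \<bar>h e\<bar> else 0) + (if v = b then \<bar>h e\<bar> else 0) + deg h v" for h v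
        using F by (auto simp: deg_def a_def b_def)
      have f0: "(if v = a then f e else 0) - (if v = b then f e else 0) + out f v = 0" for v
        using Suc.prems(2) unfolding circulation_def full by blast
      have f1: "out f v = 0" if "v \<noteq> a" "v \<noteq> b" for v using f0[of v] that by simp
      have circ: "circulation F' (c \<circ> s) (c \<circ> t) f"
        unfolding circulation_def o_def out_c using f0[of a] f0[of b] f1 ab by (auto simp: algebra_simps)
      have "\<exists>e\<in>F'. f e \<noteq> 0"
      proof (rule ccontr)
        assume "\<not> ?thesis"
        then have "out f b = 0" unfolding out_def by (intro sum.neutral) auto
        then have "f e = 0" using f0[of b] ab by simp
        then show False using nonzero e by blast
      qed
      moreover have "n = card F'" using Suc(2) F by simp
      ultimately obtain g where g: "simple_cycle F' (c \<circ> s) (c \<circ> t) g" using Suc(1)[OF _ F(3) circ] by blast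
      have g_int: "g x \<in> {-1, 0, 1}" if "x \<in> F'" for x using g that by (simp add: simple_cycle_def)
      have g_out: "outr g a + outr g b = 0" "\<And>v. v \<noteq> a \<Longrightarrow> v \<noteq> b \<Longrightarrow> outr g v = 0"
      proof -
        have *: "(if v = b then 0 else if v = a then outr g a + outr g b else outr g v) = 0" for v
          using g unfolding simple_cycle_def circulation_def o_def outr_c by blast
        show "outr g a + outr g b = 0" using *[of a] ab by simp
        show "outr g v = 0" if "v \<noteq> a" "v \<noteq> b" for v using *[of v] that by simp
      qed
      have g_deg: "deg g a + deg g b \<le> 2" "\<And>v. v \<noteq> a \<Longrightarrow> v \<noteq> b \<Longrightarrow> deg g v \<le> 2"
      proof -
        have *: "(if v = b then 0 else if v = a then deg g a + deg g b else deg g v) \<le> 2" for v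
          using g unfolding simple_cycle_def o_def deg_c by blast
        show "deg g a + deg g b \<le> 2" using *[of a] ab by simp
        show "deg g v \<le> 2" if "v \<noteq> a" "v \<noteq> b" for v using *[of v] that by simp
      qed
      have out_le: "\<bar>outr g v\<bar> \<le> deg g v" for v
        unfolding outr_def deg_def by (rule order_trans[OF sum_abs sum_mono]) auto
      have out_int: "outr g v \<in> \<int>" for v
        unfolding outr_def by (intro Ints_sum) (use g_int in force)
      let ?x = "outr g b"
      have x1: "\<bar>?x\<bar> \<le> 1" using out_le[of a] out_le[of b] g_deg(1) g_out(1) by linarith
      have x: "?x \<in> {-1, 0, 1}"
      proof -
        obtain k where k: "?x = of_int k" using out_int[of b] by (auto simp: Ints_def)
        with x1 have "\<bar>k\<bar> \<le> 1" by (metis of_int_abs of_int_le_1_iff)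
        then have "k = -1 \<or> k = 0 \<or> k = 1" by auto
        then show ?thesis using k by auto
      qed
      let ?g = "g(e := ?x)"
      have eq: "?g y = g y" if "y \<in> F'" for y using that F by auto
      have outr_eq: "outr ?g v = outr g v" and deg_eq: "deg ?g v = deg g v" for v
        unfolding outr_def deg_def using F(2) by (auto intro!: sum.cong)
      have "circulation F s t ?g"
        unfolding circulation_def fullr outr_eq using g_out ab by auto
      moreover have "\<forall>y\<in>F. ?g y \<in> {-1, 0, 1}" using F x g_int by auto
      moreover have "\<exists>y\<in>F. ?g y \<noteq> 0" using g F eq by (auto simp: simple_cycle_def)
      moreover have "(\<Sum>e\<in>F. (if s e = v then \<bar>?g e\<bar> else 0) + (if t e = v then \<bar>?g e\<bar> else 0)) \<le> 2" for v
      proof -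
        have "\<bar>?x\<bar> + deg g a \<le> 2" "\<bar>?x\<bar> + deg g b \<le> 2"
          using out_le[of a] out_le[of b] g_deg(1) g_out(1) by linarith+
        then show ?thesis unfolding fulld deg_eq using g_deg(2) ab by auto
      qed
      ultimately have "simple_cycle F s t ?g" by (simp add: simple_cycle_def)
      then show ?thesis by blast
    qed
  qed
qed

section \<open>The eigenspinors for the eigenvalue -mc^2 are circulations\<close>

text \<open>The fundamental theorem of calculus with a vanishing integrand.\<close>

lemma weak_const:
  fixes w :: "real \<Rightarrow> 'b::euclidean_space"
  assumes I: "is_interval I" "I \<in> sets lebesgue"
    and u: "sq_integrable (lebesgue_on I) u" and du: "sq_integrable (lebesgue_on I) du"
    and wp: "weak_pair I u du"
    and w: "continuous_on I w" "AE x in lebesgue_on I. w x = u x"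
    and zero: "AE x in lebesgue_on I. du x = 0" and xy: "x \<in> I" "y \<in> I"
  shows "w x = w y"
proof -
  have *: "w a = w b" if "a \<in> I" "b \<in> I" "a \<le> b" for a b
  proof -
    note F = weak_FTC[OF I u du wp w that]
    have sub: "{a..b} \<subseteq> I" using I(1) that unfolding is_interval_1 by (meson atLeastAtMost_iff subsetI)
    have "AE x in lebesgue. x \<in> I \<longrightarrow> du x = 0" using zero I(2) by (simp add: AE_restrict_space_iff)
    then have "AE x in lebesgue. x \<in> {a..b} \<longrightarrow> du x = 0" by eventually_elim (use sub in auto)
    then have "AE x in lebesgue_on {a..b}. du x = 0" by (simp add: AE_restrict_space_iff)
    then have "(LINT x|lebesgue_on {a..b}. du x) = (LINT x|lebesgue_on {a..b}. 0)"
      by (intro integral_cong_AE) (use F(2) in auto)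
    then show ?thesis using F(1) lebesgue_integral_eq_integral[OF F(2)] by simp
  qed
  show ?thesis
  proof (cases "x \<le> y")
    case True
    then show ?thesis by (rule *[OF xy])
  next
    case False
    then show ?thesis using *[OF xy(2,1)] by simp
  qed
qed

lemma lebesgue_integral_const: "0 \<le> l \<Longrightarrow> (LINT x|lebesgue_on {0..l}. k) = k * l" for k l :: real
  by (simp add: measure_restrict_space)

lemma const_sq_integrable_half_line:
  fixes k :: "'b::euclidean_space"
  assumes "sq_integrable (lebesgue_on {0::real..}) (\<lambda>x. k)"
  shows "k = 0"
proof -
  define C where "C = (LINT x|lebesgue_on {0::real..}. (norm k)\<^sup>2)"
  have le: "real n * (norm k)\<^sup>2 \<le> C" for n
  proof -
    have "real n * (norm k)\<^sup>2 = (LINT x|lebesgue_on {0..real n}. (norm k)\<^sup>2)"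
      by (subst lebesgue_integral_const) simp_all
    also have "\<dots> = (LINT x|lebesgue_on {0..real n}. indicator {0..real n} x *\<^sub>R (norm k)\<^sup>2)"
      by (rule Bochner_Integration.integral_cong) auto
    also have "\<dots> = (LINT x|lebesgue_on {0::real..}. indicator {0..real n} x *\<^sub>R (norm k)\<^sup>2)"
      by (rule lebesgue_on_support(2)[symmetric]) auto
    also have "\<dots> \<le> C" unfolding C_def
      using sq_integrable_square[OF assms] by (intro integral_mono_AE' AE_I2) (auto simp: indicator_def)
    finally show ?thesis .
  qed
  show ?thesis
  proof (rule ccontr)
    assume "k \<noteq> 0"
    then have pos: "(norm k)\<^sup>2 > 0" by simp
    obtain n where "real n > C / (norm k)\<^sup>2" using reals_Archimedean2 by blast
    then have "real n * (norm k)\<^sup>2 > C" using pos by (simp add: field_simps)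
    then show False using le[of n] by simp
  qed
qed

text \<open>The two kinds of edge ends at a vertex do not overlap, as edges have positive length.\<close>

lemma sum_ends_at:
  fixes F :: "'e \<times> real \<Rightarrow> 'b::comm_monoid_add"
  assumes G: "metric_graph G"
  shows "(\<Sum>p\<in>ends_at G v. F p) = (\<Sum>e\<in>edges G. if src G e = v then F (e, 0) else 0)
    + (\<Sum>e\<in>bounded_edges G. if tgt G e = v then F (e, real_of_ereal (len G e)) else 0)"
proof -
  let ?A = "(\<lambda>e. (e, 0)) ` {e \<in> edges G. src G e = v}"
  let ?B = "(\<lambda>e. (e, real_of_ereal (len G e))) ` {e \<in> bounded_edges G. tgt G e = v}"
  have fin: "finite (edges G)" using G by (simp add: metric_graph_def)
  have finb: "finite (bounded_edges G)" using fin by (simp add: bounded_edges_def)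
  have E: "ends_at G v = ?A \<union> ?B" by (auto simp: ends_at_def)
  have pos: "real_of_ereal (len G e) > 0" if "e \<in> bounded_edges G" for e
    using edge_interval_bounded[OF G that] by (metis real_of_ereal.simps(1))
  have D: "?A \<inter> ?B = {}" using pos by fastforce
  have "(\<Sum>p\<in>ends_at G v. F p) = sum F ?A + sum F ?B"
    unfolding E by (rule sum.union_disjoint) (use fin finb D in auto)
  also have "sum F ?A = (\<Sum>e | e \<in> edges G \<and> src G e = v. F (e, 0))"
    by (subst sum.reindex) (auto simp: inj_on_def)
  also have "\<dots> = (\<Sum>e\<in>edges G. if src G e = v then F (e, 0) else 0)"
    by (rule sum.inter_filter[OF fin])
  also have "sum F ?B = (\<Sum>e | e \<in> bounded_edges G \<and> tgt G e = v. F (e, real_of_ereal (len G e)))"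
    by (subst sum.reindex) (auto simp: inj_on_def)
  also have "\<dots> = (\<Sum>e\<in>bounded_edges G. if tgt G e = v then F (e, real_of_ereal (len G e)) else 0)"
    by (rule sum.inter_filter[OF finb])
  finally show ?thesis .
qed

lemma edges_split:
  assumes "metric_graph G"
  shows "finite (edges G)" "finite (bounded_edges G)" "edges G = bounded_edges G \<union> half_lines G"
    "bounded_edges G \<inter> half_lines G = {}"
  using assms by (auto simp: metric_graph_def bounded_edges_def half_lines_def)

lemma sum_edges_bounded:
  fixes F :: "'e \<Rightarrow> 'b::comm_monoid_add"
  assumes "metric_graph G" "\<And>e. e \<in> half_lines G \<Longrightarrow> F e = 0"
  shows "(\<Sum>e\<in>edges G. F e) = (\<Sum>e\<in>bounded_edges G. F e)"
  using edges_split[OF assms(1)] assms(2) by (intro sum.mono_neutral_right) auto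

lemma edge_ends:
  assumes "metric_graph G" "e \<in> edges G"
  shows "(e, 0) \<in> ends_at G (src G e)"
    and "e \<in> bounded_edges G \<Longrightarrow> (e, real_of_ereal (len G e)) \<in> ends_at G (tgt G e)"
    and "src G e \<in> verts G" and "e \<in> bounded_edges G \<Longrightarrow> tgt G e \<in> verts G"
  using assms by (auto simp: ends_at_def metric_graph_def)

context dirac_graph
begin

text \<open>
  The two components of \<open>D u = - m c\<^sup>2 u\<close> are \<open>(u\<^sup>1)' = 0\<close> and \<open>c (u\<^sup>2)' = - 2 \<i> m c\<^sup>2 u\<^sup>1\<close>. The predicate
  \<open>Z v\<close> of the proof says that \<open>u\<^sup>1\<close> vanishes at \<open>v\<close>; it holds at the vertex of a half-line and spreads
  along bounded edges.
\<close>

lemma eigenspinor_circulation: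
  assumes nc: "noncompact_mgraph G" and ev: "eigenvalue G (dirac G m c) (of_real (- (m * c\<^sup>2)))"
  obtains k :: "'e \<Rightarrow> complex" where "circulation (bounded_edges G) (src G) (tgt G) k" "\<exists>e\<in>bounded_edges G. k e \<noteq> 0"
proof -
  let ?M = "m * c\<^sup>2"
  obtain u f where uf: "(u, f) \<in> dirac G m c" and nt: "nontrivial G u"
    and eq: "ae_eq G f (\<lambda>e x. of_real (- ?M) *s u e x)"
    using ev unfolding eigenvalue_def by blast
  have L: "u \<in> L2 G" "f \<in> L2 G" using uf by (auto simp: dirac_iff)
  have wp: "weak_pair (edge_interval G e) (u e) (\<lambda>x. dinv (u e x) (f e x))" if "e \<in> edges G" for e
    using uf that by (auto simp: dirac_iff)
  obtain w where w: "\<And>e. e \<in> edges G \<Longrightarrow> continuous_on (edge_interval G e) (w e)" "ae_eq G w u" "kirchhoff G w"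
    using uf unfolding dirac_iff by blast
  have wu: "AE x in edge_measure G e. w e x = u e x" if "e \<in> edges G" for e
    using w(2) that by (simp add: ae_eq_def)
  have d: "AE x in edge_measure G e. dinv (u e x) (f e x) $ 1 = 0 \<and>
      dinv (u e x) (f e x) $ 2 = - 2 * \<i> * of_real ?M / of_real c * u e x $ 1" if "e \<in> edges G" for e
  proof -
    have "AE x in edge_measure G e. f e x = of_real (- ?M) *s u e x" using eq that by (simp add: ae_eq_def)
    then show ?thesis by eventually_elim (simp add: algebra_simps add_divide_distrib)
  qed
  have const: "w e x $ i = w e y $ i"
    if e: "e \<in> edges G" and z: "AE x in edge_measure G e. dinv (u e x) (f e x) $ i = 0"
      and xy: "x \<in> edge_interval G e" "y \<in> edge_interval G e" for e i x y
  proof (rule weak_const[where w = "\<lambda>x. w e x $ i" and u = "\<lambda>x. u e x $ i" and du = "\<lambda>x. dinv (u e x) (f e x) $ i"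
        and I = "edge_interval G e"])
    show "weak_pair (edge_interval G e) (\<lambda>x. u e x $ i) (\<lambda>x. dinv (u e x) (f e x) $ i)"
      by (intro weak_pair_linear[OF wp[OF e] bounded_linear_vec_nth] edge_lebesgue[OF graph e] dinv_sq_integrable
          L2D[OF L(1) e] L2D[OF L(2) e])
    show "sq_integrable (edge_measure G e) (\<lambda>x. u e x $ i)"
      by (rule sq_integrable_bounded_linear[OF bounded_linear_vec_nth L2D[OF L(1) e]])
    show "sq_integrable (edge_measure G e) (\<lambda>x. dinv (u e x) (f e x) $ i)"
      by (rule sq_integrable_bounded_linear[OF bounded_linear_vec_nth dinv_sq_integrable[OF L2D[OF L(1) e] L2D[OF L(2) e]]])
    show "continuous_on (edge_interval G e) (\<lambda>x. w e x $ i)" by (intro continuous_intros w(1) e)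
    show "AE x in edge_measure G e. w e x $ i = u e x $ i" using wu[OF e] by eventually_elim simp
  qed (use e z xy edge_is_interval[OF graph e] edge_lebesgue[OF graph e] in auto)
  have half: "w e 0 $ i = 0" if e: "e \<in> half_lines G" and z: "AE x in edge_measure G e. dinv (u e x) (f e x) $ i = 0" for e i
  proof (rule const_sq_integrable_half_line)
    have ee: "e \<in> edges G" using e by (simp add: half_lines_def)
    have I: "edge_interval G e = {0..}" by (rule edge_interval_half_line[OF e])
    have s: "sq_integrable (lebesgue_on {0::real..}) (\<lambda>x. u e x $ i)"
      using sq_integrable_bounded_linear[OF bounded_linear_vec_nth L2D[OF L(1) ee], of i] I by simp
    have "AE x in lebesgue_on {0::real..}. w e x = u e x" using wu[OF ee] unfolding I .
    moreover have "AE x in lebesgue_on {0::real..}. x \<in> {0..}" using AE_space[of "lebesgue_on {0::real..}"] by simp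
    ultimately have ae: "AE x in lebesgue_on {0::real..}. (norm (u e x $ i))\<^sup>2 = (norm (w e 0 $ i))\<^sup>2"
    proof eventually_elim
      fix x assume "w e x = u e x" "x \<in> {0::real..}"
      then show "(norm (u e x $ i))\<^sup>2 = (norm (w e 0 $ i))\<^sup>2"
        using const[OF ee z, of x 0] I by simp
    qed
    have "integrable (lebesgue_on {0::real..}) (\<lambda>x. (norm (w e 0 $ i))\<^sup>2)"
      by (rule integrable_cong_AE_imp[OF sq_integrable_square[OF s] _ ae]) simp
    then show "sq_integrable (lebesgue_on {0::real..}) (\<lambda>x. w e 0 $ i)" by (simp add: sq_integrable_def)
  qed
  have d1: "AE x in edge_measure G e. dinv (u e x) (f e x) $ 1 = 0" if "e \<in> edges G" for e
    using d[OF that] by eventually_elim simp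
  define Z where "Z v \<longleftrightarrow> (\<forall>p\<in>ends_at G v. w (fst p) (snd p) $ 1 = 0)" for v
  have ZI: "Z v" if "v \<in> verts G" "p \<in> ends_at G v" "w (fst p) (snd p) $ 1 = 0" for v p
    unfolding Z_def using kirchhoffD(1)[OF w(3) that(1) that(2)] that(3) by metis
  have len_in: "real_of_ereal (len G e) \<in> edge_interval G e" if "e \<in> bounded_edges G" for e
    using edge_interval_bounded[OF graph that] by (metis atLeastAtMost_iff less_imp_le order_refl real_of_ereal.simps(1))
  have step: "Z v'" if e: "e \<in> bounded_edges G" and vv: "v = src G e \<and> v' = tgt G e \<or> v = tgt G e \<and> v' = src G e" and Zv: "Z v" for v v' e
  proof -
    have ee: "e \<in> edges G" by (rule bounded_edges_sub[OF e])
    note E = edge_ends[OF graph ee]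
    have c: "w e 0 $ 1 = w e (real_of_ereal (len G e)) $ 1"
      by (rule const[OF ee d1[OF ee] edge_0[OF graph ee] len_in[OF e]])
    from vv show ?thesis
    proof
      assume v: "v = src G e \<and> v' = tgt G e"
      then have "w e 0 $ 1 = 0" using Zv E(1) unfolding Z_def by force
      then show ?thesis using ZI[OF E(4)[OF e] E(2)[OF e]] v c by simp
    next
      assume v: "v = tgt G e \<and> v' = src G e"
      then have "w e (real_of_ereal (len G e)) $ 1 = 0" using Zv E(2)[OF e] unfolding Z_def by force
      then show ?thesis using ZI[OF E(3) E(1)] v c by simp
    qed
  qed
  obtain h where h: "h \<in> half_lines G" using nc by (auto simp: noncompact_mgraph_def)
  have hh: "h \<in> edges G" using h by (simp add: half_lines_def)
  have Zh: "Z (src G h)"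
    using ZI[OF edge_ends(3,1)[OF graph hh]] half[OF h d1[OF hh]] by simp
  have Zall: "Z v" if v: "v \<in> verts G" for v
  proof -
    let ?R = "{(src G e, tgt G e) | e. e \<in> bounded_edges G}"
    have "(src G h, v) \<in> (?R \<union> ?R\<inverse>)\<^sup>*"
      using graph v edge_ends(3)[OF graph hh] unfolding metric_graph_def connected_mgraph_def Let_def by blast
    then show ?thesis
    proof (induction rule: rtrancl_induct)
      case base
      show ?case by (rule Zh)
    next
      case (step y z)
      then obtain e where "e \<in> bounded_edges G" "y = src G e \<and> z = tgt G e \<or> y = tgt G e \<and> z = src G e" by auto
      then show ?case using \<open>\<And>v' v e. e \<in> bounded_edges G \<Longrightarrow> v = src G e \<and> v' = tgt G e \<or> v = tgt G e \<and> v' = src G e \<Longrightarrow> Z v \<Longrightarrow> Z v'\<close> step.IH by blast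
    qed
  qed
  have w1: "w e x $ 1 = 0" if e: "e \<in> edges G" and x: "x \<in> edge_interval G e" for e x
  proof -
    have "w e 0 $ 1 = 0" using Zall[OF edge_ends(3)[OF graph e]] edge_ends(1)[OF graph e] unfolding Z_def by force
    then show ?thesis using const[OF e d1[OF e] x edge_0[OF graph e]] by simp
  qed
  have in_I: "AE x in edge_measure G e. x \<in> edge_interval G e" for e
    using AE_space[of "edge_measure G e"] by simp
  have d2: "AE x in edge_measure G e. dinv (u e x) (f e x) $ 2 = 0" if e: "e \<in> edges G" for e
    using d[OF e] wu[OF e] in_I[of e]
  proof eventually_elim
    fix x assume *: "dinv (u e x) (f e x) $ 1 = 0 \<and> dinv (u e x) (f e x) $ 2 = - 2 * \<i> * of_real ?M / of_real c * u e x $ 1"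
      "w e x = u e x" "x \<in> edge_interval G e"
    have "u e x $ 1 = 0" using w1[OF e *(3)] *(2) by simp
    then show "dinv (u e x) (f e x) $ 2 = 0" using *(1) by (metis mult_zero_right)
  qed
  define k where "k e = w e 0 $ 2" for e
  have wk: "w e x $ 2 = k e" if e: "e \<in> edges G" and x: "x \<in> edge_interval G e" for e x
    using const[OF e d2[OF e] x edge_0[OF graph e]] by (simp add: k_def)
  have k_half: "k e = 0" if e: "e \<in> half_lines G" for e
    unfolding k_def by (rule half[OF e d2]) (use e in \<open>simp add: half_lines_def\<close>)
  have "circulation (bounded_edges G) (src G) (tgt G) k" unfolding circulation_def
  proof
    fix v
    show "(\<Sum>e\<in>bounded_edges G. (if src G e = v then k e else 0) - (if tgt G e = v then k e else 0)) = 0"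
    proof (cases "v \<in> verts G")
      case True
      have "0 = (\<Sum>p\<in>ends_at G v. if snd p = 0 then w (fst p) (snd p) $ 2 else - (w (fst p) (snd p) $ 2))"
        using kirchhoffD(2)[OF w(3) True] by simp
      also have "\<dots> = (\<Sum>e\<in>edges G. if src G e = v then k e else 0) + (\<Sum>e\<in>bounded_edges G. if tgt G e = v then - k e else 0)"
      proof -
        have pos: "real_of_ereal (len G e) \<noteq> 0" if "e \<in> bounded_edges G" for e
          using edge_interval_bounded[OF graph that] by (metis less_irrefl real_of_ereal.simps(1))
        show ?thesis unfolding sum_ends_at[OF graph]
          using pos wk[OF bounded_edges_sub len_in]
          by (intro arg_cong2[where f = "(+)"] sum.cong refl) (auto simp: k_def)
      qed
      also have "(\<Sum>e\<in>edges G. if src G e = v then k e else 0) = (\<Sum>e\<in>bounded_edges G. if src G e = v then k e else 0)"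
        by (rule sum_edges_bounded[OF graph]) (simp add: k_half)
      finally have "0 = (\<Sum>e\<in>bounded_edges G. (if src G e = v then k e else 0) + (if tgt G e = v then - k e else 0))"
        by (simp add: sum.distrib)
      also have "\<dots> = (\<Sum>e\<in>bounded_edges G. (if src G e = v then k e else 0) - (if tgt G e = v then k e else 0))"
        by (intro sum.cong refl) simp
      finally show ?thesis by simp
    next
      case False
      then have "src G e \<noteq> v" "tgt G e \<noteq> v" if "e \<in> bounded_edges G" for e
        using edge_ends(3,4)[OF graph bounded_edges_sub[OF that]] that by auto
      then show ?thesis by (intro sum.neutral) auto
    qed
  qed
  moreover have "\<exists>e\<in>bounded_edges G. k e \<noteq> 0"
  proof (rule ccontr)
    assume "\<not> ?thesis"
    then have k0: "k e = 0" if "e \<in> edges G" for e using k_half edges_cases[OF that] by blast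
    have "ae_eq G u (\<lambda>e x. 0)" unfolding ae_eq_def
    proof
      fix e assume e: "e \<in> edges G"
      show "AE x in edge_measure G e. u e x = 0" using wu[OF e] in_I[of e]
      proof eventually_elim
        fix x assume "w e x = u e x" "x \<in> edge_interval G e"
        then show "u e x = 0" using w1[OF e, of x] wk[OF e, of x] k0[OF e] by (simp add: vec_eq_iff forall_2)
      qed
    qed
    then show False using nt by (simp add: nontrivial_def)
  qed
  ultimately show ?thesis using that by blast
qed

end

text \<open>
  A circulation is orthogonal to the differences of a function on the vertices: summation by parts.
\<close>

lemma circulation_potential:
  fixes g :: "'e \<Rightarrow> real" and \<phi> :: "'v \<Rightarrow> 'b::real_vector"
  assumes F: "finite F" and g: "circulation F s t g"
  shows "(\<Sum>e\<in>F. g e *\<^sub>R (\<phi> (t e) - \<phi> (s e))) = 0"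
proof -
  define S where "S = s ` F \<union> t ` F"
  have S: "finite S" using F by (simp add: S_def)
  have "(\<Sum>e\<in>F. g e *\<^sub>R (\<phi> (s e) - \<phi> (t e))) = (\<Sum>e\<in>F. \<Sum>v\<in>S. ((if s e = v then g e else 0) - (if t e = v then g e else 0)) *\<^sub>R \<phi> v)"
  proof (rule sum.cong[OF refl])
    fix e assume e: "e \<in> F"
    have "(\<Sum>v\<in>S. ((if s e = v then g e else 0) - (if t e = v then g e else 0)) *\<^sub>R \<phi> v)
      = (\<Sum>v\<in>S. (if s e = v then g e *\<^sub>R \<phi> v else 0) - (if t e = v then g e *\<^sub>R \<phi> v else 0))"
      by (intro sum.cong refl) (simp add: scaleR_diff_left)
    also have "\<dots> = g e *\<^sub>R \<phi> (s e) - g e *\<^sub>R \<phi> (t e)"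
      using S e by (simp add: sum_subtractf S_def)
    finally show "g e *\<^sub>R (\<phi> (s e) - \<phi> (t e)) = (\<Sum>v\<in>S. ((if s e = v then g e else 0) - (if t e = v then g e else 0)) *\<^sub>R \<phi> v)"
      by (simp add: scaleR_diff_right)
  qed
  also have "\<dots> = (\<Sum>v\<in>S. (\<Sum>e\<in>F. (if s e = v then g e else 0) - (if t e = v then g e else 0)) *\<^sub>R \<phi> v)"
    by (subst sum.swap) (simp add: scaleR_sum_left)
  also have "\<dots> = 0" using g by (simp add: circulation_def)
  finally have "(\<Sum>e\<in>F. - (g e *\<^sub>R (\<phi> (s e) - \<phi> (t e)))) = 0" by (simp add: sum_negf)
  then show ?thesis by (simp add: algebra_simps)
qed

section \<open>Spinors carried by a simple cycle\<close>

locale cycle_graph = dirac_graph G m c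
  for G :: "('v, 'e) mgraph" and m c :: real +
  fixes g :: "'e \<Rightarrow> real"
  assumes cycle: "simple_cycle (bounded_edges G) (src G) (tgt G) g"
begin

definition cyc :: "real \<Rightarrow> 'e spinor" where
  "cyc t = (\<lambda>e x. (if e \<in> bounded_edges G then of_real (t * g e) else 0) *s axis 2 1)"

definition cycle_length :: real where
  "cycle_length = (\<Sum>e\<in>bounded_edges G. \<bar>g e\<bar> * real_of_ereal (len G e))"

lemma cyc_nth [simp]: "cyc t e x $ 1 = 0" "cyc t e x $ 2 = (if e \<in> bounded_edges G then of_real (t * g e) else 0)"
  by (simp_all add: cyc_def axis_def)

lemma g_cases: "e \<in> bounded_edges G \<Longrightarrow> g e = -1 \<or> g e = 0 \<or> g e = 1"
  using cycle by (auto simp: simple_cycle_def)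

lemma norm_cyc: "norm (cyc t e x) = (if e \<in> bounded_edges G then \<bar>t\<bar> * \<bar>g e\<bar> else 0)"
proof -
  have "(norm (cyc t e x))\<^sup>2 = (if e \<in> bounded_edges G then \<bar>t\<bar> * \<bar>g e\<bar> else 0)\<^sup>2"
    by (simp add: norm_cvec2 power_mult_distrib norm_mult)
  then show ?thesis by (rule power2_eq_imp_eq) auto
qed

lemma bounded_edge_measure:
  assumes "e \<in> bounded_edges G"
  obtains l where "l > 0" "real_of_ereal (len G e) = l" "edge_interval G e = {0..l}"
  using edge_interval_bounded[OF graph assms] by (metis real_of_ereal.simps(1))

lemma cycle_length_pos: "cycle_length > 0"
proof -
  obtain e where e: "e \<in> bounded_edges G" "g e \<noteq> 0" using cycle by (auto simp: simple_cycle_def)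
  have nn: "0 \<le> \<bar>g e\<bar> * real_of_ereal (len G e)" if "e \<in> bounded_edges G" for e
    using bounded_edge_measure[OF that] by (metis abs_ge_zero less_imp_le mult_nonneg_nonneg)
  have "0 < \<bar>g e\<bar> * real_of_ereal (len G e)"
    using bounded_edge_measure[OF e(1)] e(2) by (metis mult_pos_pos zero_less_abs_iff)
  then show ?thesis unfolding cycle_length_def
    by (rule sum_pos2[OF edges_split(2)[OF graph] e(1)]) (use nn in auto)
qed

lemma cyc_L2: "cyc t \<in> L2 G"
  unfolding L2_iff
proof
  fix e assume e: "e \<in> edges G"
  show "sq_integrable (edge_measure G e) (cyc t e)"
  proof (cases "e \<in> bounded_edges G")
    case True
    then show ?thesis
    proof (rule bounded_edge_measure)
      fix l assume "edge_interval G e = {0..l}"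
      then show ?thesis by (simp add: sq_integrable_continuous cyc_def)
    qed
  next
    case False
    then show ?thesis using sq_integrable_zero by (simp add: cyc_def)
  qed
qed

lemma cyc_integral: "(LINT x|edge_measure G e. k) = k * real_of_ereal (len G e)" if "e \<in> bounded_edges G" for k :: real
  using that
proof (rule bounded_edge_measure)
  fix l assume l: "l > 0" "real_of_ereal (len G e) = l" "edge_interval G e = {0..l}"
  then show ?thesis
    using lebesgue_integral_const[of l k] by (simp del: lebesgue_integral_const)
qed

lemma mass_cyc: "mass G (cyc t) = t\<^sup>2 * cycle_length"
proof -
  have "mass G (cyc t) = (\<Sum>e\<in>bounded_edges G. LINT x|edge_measure G e. (norm (cyc t e x))\<^sup>2)"
    unfolding mass_def by (rule sum_edges_bounded[OF graph]) (simp add: norm_cyc half_lines_def bounded_edges_def)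
  also have "\<dots> = (\<Sum>e\<in>bounded_edges G. t\<^sup>2 * (\<bar>g e\<bar> * real_of_ereal (len G e)))"
  proof (rule sum.cong[OF refl])
    fix e assume e: "e \<in> bounded_edges G"
    have "\<bar>g e\<bar>\<^sup>2 = \<bar>g e\<bar>" using g_cases[OF e] by auto
    then show "(LINT x|edge_measure G e. (norm (cyc t e x))\<^sup>2) = t\<^sup>2 * (\<bar>g e\<bar> * real_of_ereal (len G e))"
      using e cyc_integral[OF e] by (simp add: norm_cyc power_mult_distrib)
  qed
  finally show ?thesis by (simp add: cycle_length_def sum_distrib_left)
qed

lemma cyc_dirac: "(cyc t, (- (m * c\<^sup>2)) *\<^sub>R cyc t) \<in> dirac G m c"
  unfolding dirac_iff
proof (intro conjI ballI exI[of _ "cyc t"])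
  show "cyc t \<in> L2 G" "(- (m * c\<^sup>2)) *\<^sub>R cyc t \<in> L2 G" using cyc_L2 by (auto intro: H.V_scale)
  fix e assume e: "e \<in> edges G"
  have "dinv (cyc t e x) (((- (m * c\<^sup>2)) *\<^sub>R cyc t) e x) = 0" for x
    by (simp add: vec_eq_iff forall_2 scaleR_conv_of_real[where 'a = complex])
  then have eq: "(\<lambda>x. dinv (cyc t e x) (((- (m * c\<^sup>2)) *\<^sub>R cyc t) e x)) = (\<lambda>x. 0)" by (rule ext)
  have z: "cyc t e = (\<lambda>x. cyc t e 0)" by (simp add: cyc_def)
  show "weak_pair (edge_interval G e) (cyc t e) (\<lambda>x. dinv (cyc t e x) (((- (m * c\<^sup>2)) *\<^sub>R cyc t) e x))"
    unfolding eq by (subst z) (rule weak_pair_const[OF edge_lebesgue[OF graph e]])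
  show "continuous_on (edge_interval G e) (cyc t e)" by (simp add: cyc_def)
next
  show "ae_eq G (cyc t) (cyc t)" by (simp add: ae_eq_def)
  show "kirchhoff G (cyc t)"
  proof (rule kirchhoffI)
    fix v
    have pos: "real_of_ereal (len G e) \<noteq> 0" if "e \<in> bounded_edges G" for e
      using bounded_edge_measure[OF that] by (metis less_irrefl)
    let ?k = "\<lambda>e. of_real (t * g e) :: complex"
    have "(\<Sum>p\<in>ends_at G v. if snd p = 0 then cyc t (fst p) (snd p) $ 2 else - (cyc t (fst p) (snd p) $ 2))
      = (\<Sum>e\<in>edges G. if src G e = v then if e \<in> bounded_edges G then ?k e else 0 else 0)
        + (\<Sum>e\<in>bounded_edges G. if tgt G e = v then - ?k e else 0)"
      unfolding sum_ends_at[OF graph] using pos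
      by (intro arg_cong2[where f = "(+)"] sum.cong refl) auto
    also have "(\<Sum>e\<in>edges G. if src G e = v then if e \<in> bounded_edges G then ?k e else 0 else 0)
      = (\<Sum>e\<in>bounded_edges G. if src G e = v then if e \<in> bounded_edges G then ?k e else 0 else 0)"
      by (rule sum_edges_bounded[OF graph]) (auto simp: half_lines_def bounded_edges_def)
    also have "\<dots> + (\<Sum>e\<in>bounded_edges G. if tgt G e = v then - ?k e else 0)
      = (\<Sum>e\<in>bounded_edges G. of_real (t * ((if src G e = v then g e else 0) - (if tgt G e = v then g e else 0))))"
      unfolding sum.distrib[symmetric] by (intro sum.cong refl) auto
    also have "\<dots> = of_real (t * (\<Sum>e\<in>bounded_edges G. (if src G e = v then g e else 0) - (if tgt G e = v then g e else 0)))"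
      by (simp only: sum_distrib_left of_real_sum)
    also have "\<dots> = 0" using cycle by (simp add: simple_cycle_def circulation_def)
    finally show "(\<Sum>p\<in>ends_at G v. if snd p = 0 then cyc t (fst p) (snd p) $ 2 else - (cyc t (fst p) (snd p) $ 2)) = 0" .
  qed simp
qed

lemma cyc_dom: "cyc t \<in> dirac_dom G"
  using cyc_dirac by (auto simp: dirac_def)

lemma cyc_nontrivial:
  assumes "t \<noteq> 0"
  shows "nontrivial G (cyc t)"
proof -
  have "mass G (cyc t) = 0" if z: "ae_eq G (cyc t) (\<lambda>e x. 0)"
  proof -
    have "(LINT x|edge_measure G e. (norm (cyc t e x))\<^sup>2) = (LINT x|edge_measure G e. 0)" if e: "e \<in> edges G" for e
    proof (rule integral_cong_AE)
      have "AE x in edge_measure G e. cyc t e x = 0" using z e by (simp add: ae_eq_def)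
      then show "AE x in edge_measure G e. (norm (cyc t e x))\<^sup>2 = 0" by eventually_elim simp
    qed (use sq_integrable_square[OF L2D[OF cyc_L2 e]] in auto)
    then show ?thesis by (simp add: mass_def)
  qed
  moreover have "mass G (cyc t) \<noteq> 0" using assms cycle_length_pos by (simp add: mass_cyc)
  ultimately show ?thesis by (auto simp: nontrivial_def)
qed

text \<open>
  The modulus is \<open>t\<close> wherever \<open>g\<close> does not vanish, and all those edges belong to the compact core.
\<close>

lemma cyc_NLD:
  assumes t: "t > 0" and \<omega>: "a * t powr (p - 2) = m * c\<^sup>2 - \<omega>"
  shows "NLD_solution G m c a p \<omega> (cyc t)"
  unfolding NLD_solution_def
proof (intro exI[of _ "(- (m * c\<^sup>2)) *\<^sub>R cyc t"] conjI cyc_dirac)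
  have "((- (m * c\<^sup>2)) *\<^sub>R cyc t) e x + \<omega> *\<^sub>R cyc t e x = (- a * core_chi G e * norm (cyc t e x) powr (p - 2)) *\<^sub>R cyc t e x" for e x
  proof (cases "e \<in> bounded_edges G \<and> g e \<noteq> 0")
    case True
    then have "norm (cyc t e x) = t" using t g_cases[of e] by (auto simp: norm_cyc)
    moreover have "core_chi G e = 1" using True by (simp add: core_chi_def)
    ultimately have "(- a * core_chi G e * norm (cyc t e x) powr (p - 2)) = - (m * c\<^sup>2) + \<omega>" using \<omega> by simp
    then show ?thesis by (simp only: scaleR_fun_apply scaleR_add_left)
  next
    case False
    then have "cyc t e x = 0" by (auto simp: cyc_def)
    then show ?thesis by simp
  qed
  then show "ae_eq G (\<lambda>e x. ((- (m * c\<^sup>2)) *\<^sub>R cyc t) e x + \<omega> *\<^sub>R cyc t e x)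
     (\<lambda>e x. (- a * core_chi G e * norm (cyc t e x) powr (p - 2)) *\<^sub>R cyc t e x)" by (simp add: ae_eq_def)
qed

text \<open>
  Only the second component of \<open>cyc t\<close> is nonzero, so testing the Dirac operator against it leaves
  the increments of the first component of \<open>v\<close> along the cycle, which telescope.
\<close>

lemma cyc_adjoint: "(cyc t, (- (m * c\<^sup>2)) *\<^sub>R cyc t) \<in> H.adj (dirac G m c)"
proof -
  let ?M = "m * c\<^sup>2"
  have *: "rip G f (cyc t) = rip G v ((- ?M) *\<^sub>R cyc t)" if vf: "(v, f) \<in> dirac G m c" for v f
  proof -
    have L: "v \<in> L2 G" "f \<in> L2 G" using vf by (auto simp: dirac_iff)
    obtain w where w: "\<And>e. e \<in> edges G \<Longrightarrow> continuous_on (edge_interval G e) (w e)" "ae_eq G w v" "kirchhoff G w"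
      using vf unfolding dirac_iff by blast
    define d where "d e x = dinv (v e x) (f e x)" for e x
    have wp: "weak_pair (edge_interval G e) (v e) (d e)" if "e \<in> edges G" for e
      using vf that by (auto simp: dirac_iff d_def[abs_def])
    have dsq: "sq_integrable (edge_measure G e) (d e)" if "e \<in> edges G" for e
      unfolding d_def by (intro dinv_sq_integrable L2D L that)
    have f_eq: "f e x = dirac_edge m c (v e x) (d e x)" for e x
      using dirac_edge_eq_iff[of "v e x" "d e x" "f e x"] by (simp add: d_def)
    define \<phi> where "\<phi> v = (SOME z. \<forall>p\<in>ends_at G v. w (fst p) (snd p) $ 1 = z)" for v
    have \<phi>: "w (fst p) (snd p) $ 1 = \<phi> v" if "v \<in> verts G" "p \<in> ends_at G v" for v p
    proof -
      have "\<forall>q\<in>ends_at G v. w (fst q) (snd q) $ 1 = w (fst p) (snd p) $ 1"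
        using kirchhoffD(1)[OF w(3) that(1) _ that(2)] by blast
      then have "\<forall>q\<in>ends_at G v. w (fst q) (snd q) $ 1 = \<phi> v" unfolding \<phi>_def by (rule someI)
      then show ?thesis using that(2) by blast
    qed
    have edge: "(LINT x|edge_measure G e. inner (f e x + ?M *\<^sub>R v e x) (cyc t e x))
        = t * inner (- \<i> * of_real c) (cnj (g e *\<^sub>R (\<phi> (tgt G e) - \<phi> (src G e))))"
      if e: "e \<in> bounded_edges G" for e
      using e
    proof (rule bounded_edge_measure)
      fix l assume l: "l > 0" "real_of_ereal (len G e) = l" "edge_interval G e = {0..l}"
      have ee: "e \<in> edges G" by (rule bounded_edges_sub[OF e])
      have d1: "sq_integrable (edge_measure G e) (\<lambda>x. d e x $ 1)"
        by (rule sq_integrable_bounded_linear[OF bounded_linear_vec_nth dsq[OF ee]])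
      have i: "integrable (edge_measure G e) (\<lambda>x. d e x $ 1)"
        using d1 l(3) sq_integrable_imp_integrable by simp
      have pw: "inner (f e x + ?M *\<^sub>R v e x) (cyc t e x) = (t * g e) *\<^sub>R inner (- \<i> * of_real c) (cnj (d e x $ 1))" for x
        using e unfolding f_eq dirac_edge_split
        by (simp add: inner_vec_def sum_2 inner_complex_def scaleR_conv_of_real[where 'a = complex] algebra_simps)
      have bl: "bounded_linear (\<lambda>z. (t * g e) *\<^sub>R inner (- \<i> * of_real c) (cnj z))"
        by (intro bounded_linear_compose[OF bounded_linear_scaleR_right] bounded_linear_compose[OF bounded_linear_inner_right] bounded_linear_cnj)
      have "(LINT x|edge_measure G e. inner (f e x + ?M *\<^sub>R v e x) (cyc t e x))
        = (t * g e) *\<^sub>R inner (- \<i> * of_real c) (cnj (LINT x|edge_measure G e. d e x $ 1))"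
        unfolding pw by (rule integral_bounded_linear[OF bl i])
      also have "(LINT x|edge_measure G e. d e x $ 1) = \<phi> (tgt G e) - \<phi> (src G e)"
      proof -
        have "w e l $ 1 - w e 0 $ 1 = integral {0..l} (\<lambda>x. d e x $ 1)"
        proof (rule weak_FTC(1)[where w = "\<lambda>x. w e x $ 1" and u = "\<lambda>x. v e x $ 1" and I = "edge_interval G e"])
          show "weak_pair (edge_interval G e) (\<lambda>x. v e x $ 1) (\<lambda>x. d e x $ 1)"
            by (intro weak_pair_linear[OF wp[OF ee] bounded_linear_vec_nth] edge_lebesgue[OF graph ee] L2D[OF L(1) ee] dsq[OF ee])
          show "sq_integrable (edge_measure G e) (\<lambda>x. v e x $ 1)"
            by (rule sq_integrable_bounded_linear[OF bounded_linear_vec_nth L2D[OF L(1) ee]])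
          show "continuous_on (edge_interval G e) (\<lambda>x. w e x $ 1)" by (intro continuous_intros w(1) ee)
          have "AE x in edge_measure G e. w e x = v e x" using w(2) ee by (simp add: ae_eq_def)
          then show "AE x in edge_measure G e. w e x $ 1 = v e x $ 1" by eventually_elim simp
        qed (use l d1 edge_is_interval[OF graph ee] edge_lebesgue[OF graph ee] in auto)
        moreover have "w e l $ 1 = \<phi> (tgt G e)" using \<phi>[OF edge_ends(4)[OF graph ee e] edge_ends(2)[OF graph ee e]] l by simp
        moreover have "w e 0 $ 1 = \<phi> (src G e)" using \<phi>[OF edge_ends(3,1)[OF graph ee]] by simp
        ultimately show ?thesis using lebesgue_integral_eq_integral[OF i] l(3) by simp
      qed
      finally show ?thesis by (simp add: inner_scaleR_right)
    qed
    have "rip G f (cyc t) - rip G v ((- ?M) *\<^sub>R cyc t) = rip G (f + ?M *\<^sub>R v) (cyc t)"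
      using L cyc_L2 by (simp add: H.ip_simps)
    also have "\<dots> = (\<Sum>e\<in>bounded_edges G. LINT x|edge_measure G e. inner (f e x + ?M *\<^sub>R v e x) (cyc t e x))"
      unfolding rip_def by (subst sum_edges_bounded[OF graph]) (auto simp: cyc_def half_lines_def bounded_edges_def)
    also have "\<dots> = (\<Sum>e\<in>bounded_edges G. t * inner (- \<i> * of_real c) (cnj (g e *\<^sub>R (\<phi> (tgt G e) - \<phi> (src G e)))))"
      by (rule sum.cong[OF refl edge])
    also have "\<dots> = t * inner (- \<i> * of_real c) (cnj (\<Sum>e\<in>bounded_edges G. g e *\<^sub>R (\<phi> (tgt G e) - \<phi> (src G e))))"
      by (simp only: sum_distrib_left inner_sum_right cnj_sum)
    also have "(\<Sum>e\<in>bounded_edges G. g e *\<^sub>R (\<phi> (tgt G e) - \<phi> (src G e))) = 0"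
      by (rule circulation_potential[OF edges_split(2)[OF graph]]) (use cycle in \<open>simp add: simple_cycle_def\<close>)
    finally show ?thesis
      by (simp only: complex_cnj_zero inner_zero_right mult_zero_right right_minus_eq)
  qed
  have "(- ?M) *\<^sub>R cyc t \<in> L2 G" by (intro H.V_scale cyc_L2)
  then show ?thesis unfolding H.adj_def mem_Collect_eq prod.case using cyc_L2 * by blast
qed

text \<open>Von Neumann's theorem, for the complex adjoint.\<close>

lemma dirac_square:
  shows "self_adjoint G (dirac G m c O op_adjoint G (dirac G m c))" "nonneg_op G (dirac G m c O op_adjoint G (dirac G m c))"
proof -
  let ?D = "dirac G m c"
  have adj: "op_adjoint G ?D = H.adj ?D" by (rule op_adjoint_eq_adj[OF dirac_sub dirac_rot_closed])
  have r: "rot_closed (?D O op_adjoint G ?D)"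
    using dirac_rot_closed rot_closed_op_adjoint[of ?D] unfolding rot_closed_def by blast
  note vN = H.von_Neumann_adj_comp[OF dirac_sub dirac_subspace dirac_closed dirac_dense]
  show "self_adjoint G (?D O op_adjoint G ?D)" using vN(1) r by (simp add: self_adjoint_iff adj)
  show "nonneg_op G (?D O op_adjoint G ?D)" using vN(2) nonneg_op_iff[OF H.sa_sub[OF vN(1)]] by (simp add: adj)
qed

text \<open>\<open>D\<^sup>*D u = (m c\<^sup>2)\<^sup>2 u\<close>, and two square roots are taken.\<close>

lemma cyc_abs_sqrt: "(cyc t, sqrt (m * c\<^sup>2) *\<^sub>R cyc t) \<in> dirac_abs_sqrt G m c"
proof -
  let ?M = "m * c\<^sup>2" and ?D = "dirac G m c"
  have M: "?M > 0" using m_pos c_pos by simp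
  have adj: "op_adjoint G ?D = H.adj ?D" by (rule op_adjoint_eq_adj[OF dirac_sub dirac_rot_closed])
  have "((- ?M) *\<^sub>R cyc t, (- ?M) *\<^sub>R ((- ?M) *\<^sub>R cyc t)) \<in> H.adj ?D"
    by (rule H.subspace_rel(3)[OF H.adj_subspace[OF dirac_sub] cyc_adjoint cyc_adjoint])
  then have "(cyc t, ?M\<^sup>2 *\<^sub>R cyc t) \<in> ?D O op_adjoint G ?D"
    using cyc_dirac[of t] unfolding adj by (auto simp: power2_eq_square)
  from op_sqrt_eigenvector[OF dirac_square this M]
  have "(cyc t, ?M *\<^sub>R cyc t) \<in> op_abs G ?D" by (simp add: op_abs_def)
  then have "(cyc t, (sqrt ?M)\<^sup>2 *\<^sub>R cyc t) \<in> op_abs G ?D" using M by simp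
  moreover have "self_adjoint G (op_abs G ?D)" "nonneg_op G (op_abs G ?D)"
    unfolding op_abs_def by (rule op_sqrt_works[OF dirac_square])+
  ultimately show ?thesis
    unfolding dirac_abs_sqrt_def using M by (intro op_sqrt_eigenvector) auto
qed

text \<open>
  For mass one both sides of the inequality are explicit: the left-hand side is
  \<open>t\<^bsup>p\<^esup> L = t\<^bsup>p - 2\<^esup>\<close>, and the norms on the right-hand side are \<open>(m c\<^sup>2)\<^bsup>1/2\<^esup>\<close> and \<open>1\<close>.
\<close>

lemma cyc_GNS:
  assumes C: "GNS_const G m c p C" and p: "p > 2" and t: "t > 0" "t\<^sup>2 * cycle_length = 1"
  shows "t powr (p - 2) \<le> C * (m * c\<^sup>2) powr ((p - 2) / 2)"
proof -
  let ?M = "m * c\<^sup>2"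
  have M: "?M > 0" using m_pos c_pos by simp
  have C0: "C > 0" using C by (simp add: GNS_const_def)
  have "(\<Sum>e\<in>bounded_edges G. \<integral>\<^sup>+x. ennreal (norm (cyc t e x) powr p) \<partial>edge_measure G e)
        \<le> ennreal (C * L2_norm G (sqrt ?M *\<^sub>R cyc t) powr (p - 2) * (L2_norm G (cyc t))\<^sup>2)"
    using C cyc_abs_sqrt[of t] unfolding GNS_const_def by blast
  moreover have "L2_norm G (cyc t) = 1" using t by (simp add: L2_norm_def mass_cyc)
  moreover have "L2_norm G (sqrt ?M *\<^sub>R cyc t) = sqrt ?M"
  proof -
    have "mass G (sqrt ?M *\<^sub>R cyc t) = ?M * mass G (cyc t)"
      using M cyc_L2 by (simp add: H.ip_simps flip: rip_self)
    then show ?thesis using t by (simp add: L2_norm_def mass_cyc)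
  qed
  moreover have "(\<Sum>e\<in>bounded_edges G. \<integral>\<^sup>+x. ennreal (norm (cyc t e x) powr p) \<partial>edge_measure G e) = ennreal (t powr (p - 2))"
  proof -
    have "(\<integral>\<^sup>+x. ennreal (norm (cyc t e x) powr p) \<partial>edge_measure G e) = ennreal (t powr p * (\<bar>g e\<bar> * real_of_ereal (len G e)))"
      if e: "e \<in> bounded_edges G" for e
      using e
    proof (rule bounded_edge_measure)
      fix l assume l: "l > 0" "real_of_ereal (len G e) = l" "edge_interval G e = {0..l}"
      have "norm (cyc t e x) powr p = t powr p * \<bar>g e\<bar>" for x using e g_cases[OF e] t by (auto simp: norm_cyc)
      moreover have "emeasure (lebesgue_on {0..l}) (space (lebesgue_on {0..l})) = ennreal l"
        using l by (simp add: emeasure_restrict_space)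
      ultimately show ?thesis using l by (simp add: ennreal_mult mult.assoc)
    qed
    then have "(\<Sum>e\<in>bounded_edges G. \<integral>\<^sup>+x. ennreal (norm (cyc t e x) powr p) \<partial>edge_measure G e)
      = (\<Sum>e\<in>bounded_edges G. ennreal (t powr p * (\<bar>g e\<bar> * real_of_ereal (len G e))))" by (rule sum.cong[OF refl])
    also have "\<dots> = ennreal (\<Sum>e\<in>bounded_edges G. t powr p * (\<bar>g e\<bar> * real_of_ereal (len G e)))"
    proof (rule sum_ennreal)
      fix e assume e: "e \<in> bounded_edges G"
      show "0 \<le> t powr p * (\<bar>g e\<bar> * real_of_ereal (len G e))"
        using bounded_edge_measure[OF e] by (metis abs_ge_zero less_imp_le mult_nonneg_nonneg powr_ge_zero)
    qed
    also have "(\<Sum>e\<in>bounded_edges G. t powr p * (\<bar>g e\<bar> * real_of_ereal (len G e))) = t powr p * cycle_length"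
      by (simp add: cycle_length_def sum_distrib_left)
    also have "t powr p = t powr (p - 2) * t\<^sup>2"
      using t powr_add[of t "p - 2" 2] by simp
    finally show ?thesis using t by (simp add: mult.assoc)
  qed
  ultimately have "ennreal (t powr (p - 2)) \<le> ennreal (C * sqrt ?M powr (p - 2))" by simp
  then have "t powr (p - 2) \<le> C * sqrt ?M powr (p - 2)" using C0 by (simp add: ennreal_le_iff)
  also have "sqrt ?M powr (p - 2) = ?M powr ((p - 2) / 2)"
    using M by (simp add: powr_half_sqrt[symmetric] powr_powr)
  finally show ?thesis .
qed

end

text \<open>
  The powers of \<open>m\<close> and \<open>c\<close> in \<open>a0_tilde\<close> are such that the product is \<open>m c\<^sup>2\<close> times a number: \<open>1/2\<close> for
  \<open>p < 4\<close>, and for \<open>p \<ge> 4\<close> the number \<open>2\<^bsup>-p/4\<^esup> (p/(p - 2))\<^bsup>- (p - 1)(p - 4)/(2p - 4)\<^esup> \<le> 1\<close>.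
\<close>

lemma a0_tilde_bound:
  assumes m: "m > 0" and c: "c > 0" and p: "p > 2" and C: "C > 0"
  shows "a0_tilde m c p C * (C * (m * c\<^sup>2) powr ((p - 2) / 2)) \<le> m * c\<^sup>2"
proof -
  have Mp: "(m * c\<^sup>2) powr ((p - 2) / 2) = m powr ((p - 2) / 2) * c powr (p - 2)"
  proof -
    have "(c\<^sup>2) powr ((p - 2) / 2) = c powr (p - 2)"
    proof -
      have "c\<^sup>2 = c powr 2" using c by simp
      then have "(c\<^sup>2) powr ((p - 2) / 2) = c powr (2 * ((p - 2) / 2))" by (simp only: powr_powr)
      also have "2 * ((p - 2) / 2) = p - 2" by simp
      finally show ?thesis .
    qed
    then show ?thesis using m c by (simp add: powr_mult)
  qed
  have "m powr ((4 - p) / 2) * m powr ((p - 2) / 2) = m"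
    using m by (simp add: powr_add[symmetric] add_divide_distrib[symmetric])
  moreover have "c powr (4 - p) * c powr (p - 2) = c\<^sup>2"
    using c by (simp add: powr_add[symmetric])
  ultimately have key: "m powr ((4 - p) / 2) * c powr (4 - p) * (m * c\<^sup>2) powr ((p - 2) / 2) = m * c\<^sup>2"
    unfolding Mp by (metis mult.assoc mult.left_commute)
  have M: "m * c\<^sup>2 > 0" using m c by simp
  show ?thesis
  proof (cases "p < 4")
    case True
    then have "a0_tilde m c p C * (C * (m * c\<^sup>2) powr ((p - 2) / 2))
      = (m powr ((4 - p) / 2) * c powr (4 - p) * (m * c\<^sup>2) powr ((p - 2) / 2)) / 2"
      using C by (simp add: a0_tilde_def)
    then show ?thesis using key M by simp
  next
    case False
    define q where "q = (p / (p - 2)) powr ((- p\<^sup>2 + 5 * p - 4) / (2 * p - 4))"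
    have "- p\<^sup>2 + 5 * p - 4 = - ((p - 1) * (p - 4))" by (simp add: power2_eq_square algebra_simps)
    moreover have "0 \<le> (p - 1) * (p - 4)" using False by simp
    ultimately have "(- p\<^sup>2 + 5 * p - 4) / (2 * p - 4) \<le> 0" using p by (simp add: divide_le_0_iff)
    moreover have "1 \<le> p / (p - 2)" using p by simp
    ultimately have q: "q \<le> 1" unfolding q_def using powr_mono[of "(- p\<^sup>2 + 5 * p - 4) / (2 * p - 4)" 0 "p / (p - 2)"] p by simp
    have q0: "0 \<le> q" by (simp add: q_def)
    have t: "2 powr (- p / 4) \<le> (1::real)" using p powr_mono[of "- p / 4" 0 "2::real"] by simp
    have "a0_tilde m c p C * (C * (m * c\<^sup>2) powr ((p - 2) / 2))
      = 2 powr (- p / 4) * q * (m powr ((4 - p) / 2) * c powr (4 - p) * (m * c\<^sup>2) powr ((p - 2) / 2))"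
      using False C by (simp add: a0_tilde_def q_def)
    also have "\<dots> = 2 powr (- p / 4) * q * (m * c\<^sup>2)" by (simp only: key)
    also have "\<dots> \<le> 1 * (m * c\<^sup>2)"
      using mult_mono[OF t q] q0 M by (intro mult_right_mono) auto
    finally show ?thesis by simp
  qed
qed

section \<open>The dichotomy\<close>

theorem theorem8p3:
  fixes G :: "('v, 'e) mgraph" and m c a p :: real
  assumes "metric_graph G" and "noncompact_mgraph G" and "bounded_edges G \<noteq> {}"
    and "m > 0" and "c > 0" and "a > 0" and "p > 2"
    and "eigenvalue G (dirac G m c) (of_real (- (m * c\<^sup>2)))"
  shows "((\<exists>u\<in>dirac_dom G. \<exists>\<omega>\<in>{- (m * c\<^sup>2)<..<m * c\<^sup>2}.
             nontrivial G u \<and> NLD_solution G m c a p \<omega> u \<and> mass G u = 1)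
          \<or> (\<forall>\<omega>\<in>{- (m * c\<^sup>2)<..<m * c\<^sup>2}. \<exists>u\<in>dirac_dom G.
             nontrivial G u \<and> NLD_solution G m c a p \<omega> u \<and> mass G u < 1))
         \<and> (\<forall>C. GNS_const G m c p C \<longrightarrow> a < a0_tilde m c p C \<longrightarrow>
             (\<exists>u\<in>dirac_dom G. \<exists>\<omega>\<in>{0..<m * c\<^sup>2}.
                nontrivial G u \<and> NLD_solution G m c a p \<omega> u \<and> mass G u = 1))"
proof -
  interpret D: dirac_graph G m c using assms by unfold_locales
  obtain k :: "'e \<Rightarrow> complex" where k: "circulation (bounded_edges G) (src G) (tgt G) k" "\<exists>e\<in>bounded_edges G. k e \<noteq> 0"
    by (rule D.eigenspinor_circulation[OF assms(2,8)])
  obtain g where g: "simple_cycle (bounded_edges G) (src G) (tgt G) g"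
    using circulation_imp_simple_cycle[OF edges_split(2)[OF assms(1)] k] by blast
  interpret cycle_graph G m c g using g by unfold_locales
  let ?M = "m * c\<^sup>2"
  have M: "?M > 0" using assms by simp
  \<comment> \<open>the amplitude of mass one\<close>
  define t1 where "t1 = 1 / sqrt cycle_length"
  have t1: "t1 > 0" "t1\<^sup>2 * cycle_length = 1"
    using cycle_length_pos by (auto simp: t1_def power_divide)
  define \<omega>1 where "\<omega>1 = ?M - a * t1 powr (p - 2)"
  have \<omega>1: "\<omega>1 < ?M" using assms t1 by (simp add: \<omega>1_def)
  have sol: "cyc t1 \<in> dirac_dom G" "nontrivial G (cyc t1)" "NLD_solution G m c a p \<omega>1 (cyc t1)" "mass G (cyc t1) = 1"
    using cyc_dom cyc_nontrivial cyc_NLD[of t1 a p \<omega>1] t1 by (auto simp: \<omega>1_def mass_cyc)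
  show ?thesis
  proof (intro conjI allI impI)
    show "(\<exists>u\<in>dirac_dom G. \<exists>\<omega>\<in>{- ?M<..<?M}. nontrivial G u \<and> NLD_solution G m c a p \<omega> u \<and> mass G u = 1)
          \<or> (\<forall>\<omega>\<in>{- ?M<..<?M}. \<exists>u\<in>dirac_dom G. nontrivial G u \<and> NLD_solution G m c a p \<omega> u \<and> mass G u < 1)"
    proof (cases "\<omega>1 > - ?M")
      case True
      then show ?thesis using sol \<omega>1 by (intro disjI1 bexI[of _ "cyc t1"] bexI[of _ \<omega>1]) auto
    next
      case False
      have "\<exists>u\<in>dirac_dom G. nontrivial G u \<and> NLD_solution G m c a p \<omega> u \<and> mass G u < 1" if \<omega>: "\<omega> \<in> {- ?M<..<?M}" for \<omega>
      proof -
        \<comment> \<open>the amplitude that solves the equation for the given frequency\<close>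
        define r where "r = (?M - \<omega>) / a"
        define t where "t = r powr (1 / (p - 2))"
        have pos: "r > 0" using \<omega> assms by (simp add: r_def)
        have t: "t > 0" using pos by (simp add: t_def)
        have "t powr (p - 2) = r" using pos assms(7) by (simp add: t_def powr_powr)
        then have tp: "t powr (p - 2) = (?M - \<omega>) / a" by (simp only: r_def)
        have "(?M - \<omega>) / a < t1 powr (p - 2)" using False \<omega> assms by (simp add: \<omega>1_def field_simps)
        then have "t powr (p - 2) < t1 powr (p - 2)" using tp by simp
        then have "t < t1" using t t1 assms powr_mono2[of "p - 2" t1 t] by (meson diff_gt_0_iff_gt less_imp_le not_le)
        then have "t\<^sup>2 * cycle_length < t1\<^sup>2 * cycle_length"
          using power_strict_mono[of t t1 2] t cycle_length_pos by (simp add: mult_strict_right_mono)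
        then have "mass G (cyc t) < 1" using t1 by (simp add: mass_cyc)
        moreover have "NLD_solution G m c a p \<omega> (cyc t)" by (rule cyc_NLD[OF t]) (use assms(6) in \<open>simp add: tp\<close>)
        ultimately show ?thesis
          using cyc_nontrivial[of t] t by (intro bexI[OF _ cyc_dom[of t]]) simp
      qed
      then show ?thesis by blast
    qed
  next
    fix C assume C: "GNS_const G m c p C" and a: "a < a0_tilde m c p C"
    have C0: "C > 0" using C by (simp add: GNS_const_def)
    have "a * t1 powr (p - 2) \<le> a * (C * ?M powr ((p - 2) / 2))"
      using cyc_GNS[OF C assms(7) t1] assms by (intro mult_left_mono) auto
    also have "\<dots> \<le> a0_tilde m c p C * (C * ?M powr ((p - 2) / 2))"
      using a C0 by (intro mult_right_mono) auto
    also have "\<dots> \<le> ?M" by (rule a0_tilde_bound) (use assms C0 in auto)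
    finally have "0 \<le> \<omega>1" by (simp add: \<omega>1_def)
    then show "\<exists>u\<in>dirac_dom G. \<exists>\<omega>\<in>{0..<?M}. nontrivial G u \<and> NLD_solution G m c a p \<omega> u \<and> mass G u = 1"
      using sol \<omega>1 by (intro bexI[of _ "cyc t1"] bexI[of _ \<omega>1]) auto
  qed
qed

end
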